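(* Let $(V^+,V^-)$ be a topological (C2)-Jordan pair over the topological ring $\mathbb{K}$ and $(X^+,X^-)$ its projective completion. (i) There exist on $X^\pm$ structures of smooth manifolds, modeled on the topological $\mathbb{K}$-modules $V^+$, resp. $V^-$, uniquely defined by the condition that the collection of charts $\mathcal{A}^\pm=\{(g(V^\pm),\phi_g): g\in G\}$, $\phi_g: g(V^\pm)\to V^\pm$, $g.x\mapsto x$, becomes an atlas of $X^\pm$. (ii) The projective group $G$ acts by diffeomorphisms of $X^+$ and of $X^-$. If $g\in G$ is such that $d_g(x)$ is invertible for some $x\in V^+$, then the set $$V_{(g)}:=\{x\in V^+ : d_g(x)\in \mathrm{GL}(V^+),\ c_g(x)\in \mathrm{GL}(V^-)\}=\{x\in V^+: g.x\in V^+\}$$ is open in $V^+$, and $g: V_{(g)}\to V^+$, $x\mapsto d_g(x)^{-1}n_g(x)$ is a smooth map whose differential at the point $x$ is given by $dg(x)=d_g(x)^{-1}$. If, in addition, $(V^+,V^-)$ satisfies (C1), then with respect to the manifold structure defined in (i): (iii) The actions $V^+\times X^+\to X^+$, $(v,x)\mapsto e^{\mathrm{ad}(v)}.x$, and $V^-\times X^+\to X^+$, $(w,x)\mapsto e^{\mathrm{ad}(w)}.x$, are smooth. (iv) The set $M\subset X^+\times X^-$ of transversal pairs is open in $X^+\times X^-$. (v) For $r\in\mathbb{K}^\times$, the multiplication map $$\mu_r:(X^+\times X^-\times X^+)^\top:=\{(x,y,z): (x,y)\in M,\ (z,y)\in M\}\to X^+$$ is defined on an open set and is smooth.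
   Context: Throughout, $\mathbb{K}$ is a commutative topological ring with unit $1$ (ring operations continuous, unit group $\mathbb{K}^\times$ open, inversion on $\mathbb{K}^\times$ continuous) such that $\mathbb{K}^\times$ is dense in $\mathbb{K}$ and $2$ is invertible. Topological $\mathbb{K}$-modules are assumed Hausdorff; $C^0$ means continuous. Calculus: for topological $\mathbb{K}$-modules $V,W$ and $U\subset V$ open, $f:U\to W$ is $C^1$ if there is a continuous map $f^{[1]}:U^{[1]}:=\{(x,v,t)\in U\times V\times\mathbb{K}: x+tv\in U\}\to W$ with $f(x+tv)-f(x)=t\,f^{[1]}(x,v,t)$; then $df(x)v:=f^{[1]}(x,v,0)$. $f$ is $C^{k+1}$ if it is $C^1$ and $f^{[1]}$ is $C^k$; smooth means $C^k$ for all $k$. A smooth manifold modeled on a topological $\mathbb{K}$-module $E$ is a topological space with an atlas of charts (homeomorphisms of open sets onto open subsets of $E$) with smooth transition functions; smooth maps between manifolds are defined as usual. 3-graded Lie algebras and Jordan pairs: a 3-graded Lie algebra is a Lie algebra $\mathfrak{g}=\mathfrak{g}_1\oplus\mathfrak{g}_0\oplus\mathfrak{g}_{-1}$ over $\mathbb{K}$ with $[\mathfrak{g}_k,\mathfrak{g}_l]\subset\mathfrak{g}_{k+l}$ (and $\mathfrak g_k=0$ for $|k|>1$). Let $D$ be the derivation with $DX=iX$ for $X\in\mathfrak{g}_i$; it is assumed inner, $D=\mathrm{ad}(E)$, $E\in\mathfrak g$. Then $V^\pm:=\mathfrak{g}_{\pm1}$ with $T^\pm:V^\pm\times V^\mp\times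 V^\pm\to V^\pm$, $T^\pm(x,y,z)=-[[x,y],z]$, is a (linear) Jordan pair, and every linear Jordan pair arises in this way; we fix such $(\mathfrak{g},D)$ for the given Jordan pair $(V^+,V^-)$. It is a topological Jordan pair if $V^\pm$ are topological $\mathbb{K}$-modules and $T^\pm$ are continuous. Bergman operators: for $x\in V^+$, $a\in V^-$, $B_+(x,a)=\mathrm{id}_{V^+}+\mathrm{ad}(x)\mathrm{ad}(a)+\frac14\mathrm{ad}(x)^2\mathrm{ad}(a)^2\in\mathrm{End}(V^+)$ and $B_-(a,x)=\mathrm{id}_{V^-}+\mathrm{ad}(a)\mathrm{ad}(x)+\frac14\mathrm{ad}(a)^2\mathrm{ad}(x)^2\in\mathrm{End}(V^-)$. Put $(V^+\times V^-)^\times=\{(x,a): B_+(x,a),B_-(a,x)\text{ invertible}\}$. (C1): $(V^+\times V^-)^\times$ is open in $V^+\times V^-$ and the map $(V^+\times V^-)^\times\times V^+\times V^-\to V^+\times V^-$, $(x,a,v,b)\mapsto(B_+(x,a)^{-1}v,B_-(a,x)^{-1}b)$ is continuous. (C2): for every $a\in V^-$ the set $U_a=\{x\in V^+: B_+(x,a),B_-(a,x)\text{ invertible}\}$ is open in $V^+$ and $U_a\times V^+\to V^+$, $(x,v)\mapsto B_+(x,a)^{-1}v$ is continuous; and the dual condition with $V^+$ and $V^-$ interchanged also holds. Projective completion: for $x\in\mathfrak{g}_{\pm1}$, $e^{\mathrm{ad}x}=1+\mathrm{ad}x+\frac12(\mathrm{ad}x)^2\in\mathrm{Aut}(\mathfrak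 g)$, and $G\subset\mathrm{Aut}(\mathfrak g)$ (the projective elementary group) is the group generated by all these automorphisms. Let $o^+$ be the flag $0\subset\mathfrak g_{-1}\subset\mathfrak g_{-1}\oplus\mathfrak g_0\subset\mathfrak g$ and $o^-$ the flag $0\subset\mathfrak g_{1}\subset\mathfrak g_{1}\oplus\mathfrak g_0\subset\mathfrak g$; $X^\pm:=G.o^\pm$ are their $G$-orbits in the set of flags of $\mathfrak g$. $V^\pm$ is embedded in $X^\pm$ via $x\mapsto e^{\mathrm{ad}(x)}.o^\pm$ (an injective map) and identified with its image. Transversality: flags $\mathfrak f=(0\subset\mathfrak f_1\subset\mathfrak f_0\subset\mathfrak g)$ and $\mathfrak e=(0\subset\mathfrak e_1\subset\mathfrak e_0\subset\mathfrak g)$ are transversal if $\mathfrak g=\mathfrak f_1\oplus\mathfrak e_0$ and $\mathfrak g=\mathfrak e_1\oplus\mathfrak f_0$. $M$ is the set of transversal pairs in $X^+\times X^-$. For $y=g.o^-\in X^-$, the set $V_y:=g(V^+)\subset X^+$ is the set of elements of $X^+$ transversal to $y$; it carries an affine $\mathbb{K}$-structure, transported by $g$ from $V^+$ and depending only on $y$. For $x,z\in V_y$, $\mu_r(x,y,z)$ denotes the product $rz$ in the $\mathbb K$-module obtained from $V_y$ by taking $x$ as zero vector. Denominators and nominators: for $g\in\mathrm{Aut}(\mathfrak g)$ let $g_{ij}:\mathfrak g_j\to\mathfrak g_i$ be its matrix coefficients. For $x\in V^+$: $d_g(x):=(e^{-\mathrm{ad}(x)}g^{-1})_{11}\in\mathrm{End}(V^+)$,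 $c_g(x):=(g e^{\mathrm{ad}(x)})_{-1,-1}\in\mathrm{End}(V^-)$, and $n_g(x):=\mathrm{pr}_1(e^{-\mathrm{ad}(x)}g^{-1}E)\in V^+$, where $\mathrm{pr}_1$ is the projection onto $\mathfrak g_1$. *)

theory Defs
  imports "HOL-Analysis.Analysis" "HOL-Algebra.Generated_Groups"
begin

section \<open>Topological modules and calculus over a topological ring\<close>

text \<open>In a commutative ring the units are the divisors of 1.\<close>

definition ring_inv :: "'k::comm_ring_1 \<Rightarrow> 'k" where
  "ring_inv u = (THE v. u * v = 1)"

text \<open>A topological module is a submodule of an ambient module type together with a topology
  on it; the topology carries the submodule as its \<^term>\<open>topspace\<close>.\<close>

definition topological_module ::
  "('k::{comm_ring_1, topological_space} \<Rightarrow> 'e::ab_group_add \<Rightarrow> 'e) \<Rightarrow> 'e topology \<Rightarrow> bool" where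
  "topological_module s T \<longleftrightarrow>
     module s \<and> module.subspace s (topspace T) \<and> Hausdorff_space T \<and>
     continuous_map (prod_topology T T) T (\<lambda>(x, y). x + y) \<and>
     continuous_map (prod_topology euclidean T) T (\<lambda>(r, x). s r x)"

text \<open>The definition of $C^k$ maps passes from $V$ to $V \times V \times K$, then to
  $(V \times V \times K) \times (V \times V \times K) \times K$, and so on. All these modules
  are represented in one datatype: level 0 of the tower consists of the elements
  \<open>Pt x\<close>, and level $n+1$ of the triples \<open>Inc x v t\<close> with \<open>x\<close>, \<open>v\<close> in level $n$ and $t \in K$.\<close>

datatype ('k, 'e) tower =
    Pt (un_Pt: 'e)
  | Inc (base: "('k, 'e) tower") (dir: "('k, 'e) tower") (par: 'k)

fun tower_add :: "('k::comm_ring_1, 'e::ab_group_add) tower \<Rightarrow> ('k, 'e) tower \<Rightarrow> ('k, 'e) tower" where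
  "tower_add (Pt x) (Pt y) = Pt (x + y)"
| "tower_add (Inc x v t) (Inc y w u) = Inc (tower_add x y) (tower_add v w) (t + u)"

primrec tower_scale ::
  "('k::comm_ring_1 \<Rightarrow> 'e \<Rightarrow> 'e) \<Rightarrow> 'k \<Rightarrow> ('k, 'e) tower \<Rightarrow> ('k, 'e) tower" where
  "tower_scale s r (Pt x) = Pt (s r x)"
| "tower_scale s r (Inc x v t) = Inc (tower_scale s r x) (tower_scale s r v) (r * t)"

primrec tower_top :: "'e topology \<Rightarrow> nat \<Rightarrow> ('k::topological_space, 'e) tower topology" where
  "tower_top T 0 = pullback_topology (range Pt) un_Pt T"
| "tower_top T (Suc n) =
     pullback_topology {Inc x v t | x v t. True} (\<lambda>p. (base p, dir p, par p))
       (prod_topology (tower_top T n) (prod_topology (tower_top T n) euclidean))"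

text \<open>The set $U^{[1]}$ for a subset $U$ of level $n$.\<close>

definition dq_domain ::
  "('k::{comm_ring_1, topological_space} \<Rightarrow> 'e::ab_group_add \<Rightarrow> 'e) \<Rightarrow> 'e topology \<Rightarrow> nat \<Rightarrow>
     ('k, 'e) tower set \<Rightarrow> ('k, 'e) tower set" where
  "dq_domain s T n U =
     {Inc x v t | x v t. x \<in> U \<and> v \<in> topspace (tower_top T n) \<and>
        tower_add x (tower_scale s t v) \<in> U}"

text \<open>\<open>F1\<close> is a map $F^{[1]}$ for $F$.\<close>

definition diff_quotient ::
  "('k::{comm_ring_1, topological_space} \<Rightarrow> 'e::ab_group_add \<Rightarrow> 'e) \<Rightarrow> 'e topology \<Rightarrow>
   ('k \<Rightarrow> 'f::ab_group_add \<Rightarrow> 'f) \<Rightarrow> 'f topology \<Rightarrow> nat \<Rightarrow>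
     ('k, 'e) tower set \<Rightarrow> (('k, 'e) tower \<Rightarrow> 'f) \<Rightarrow> (('k, 'e) tower \<Rightarrow> 'f) \<Rightarrow> bool" where
  "diff_quotient s T s' T' n U F F1 \<longleftrightarrow>
     continuous_map (subtopology (tower_top T (Suc n)) (dq_domain s T n U)) T' F1 \<and>
     (\<forall>x v t. Inc x v t \<in> dq_domain s T n U \<longrightarrow>
        F (tower_add x (tower_scale s t v)) - F x = s' t (F1 (Inc x v t)))"

primrec Ck_level ::
  "('k::{comm_ring_1, topological_space} \<Rightarrow> 'e::ab_group_add \<Rightarrow> 'e) \<Rightarrow> 'e topology \<Rightarrow>
   ('k \<Rightarrow> 'f::ab_group_add \<Rightarrow> 'f) \<Rightarrow> 'f topology \<Rightarrow> nat \<Rightarrow>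
     nat \<Rightarrow> ('k, 'e) tower set \<Rightarrow> (('k, 'e) tower \<Rightarrow> 'f) \<Rightarrow> bool" where
  "Ck_level s T s' T' 0 n U F \<longleftrightarrow> continuous_map (subtopology (tower_top T n) U) T' F"
| "Ck_level s T s' T' (Suc k) n U F \<longleftrightarrow>
     (\<exists>F1. diff_quotient s T s' T' n U F F1 \<and>
           Ck_level s T s' T' k (Suc n) (dq_domain s T n U) F1)"

definition smooth_on ::
  "('k::{comm_ring_1, topological_space} \<Rightarrow> 'e::ab_group_add \<Rightarrow> 'e) \<Rightarrow> 'e topology \<Rightarrow>
   ('k \<Rightarrow> 'f::ab_group_add \<Rightarrow> 'f) \<Rightarrow> 'f topology \<Rightarrow> 'e set \<Rightarrow> ('e \<Rightarrow> 'f) \<Rightarrow> bool" where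
  "smooth_on s T s' T' U f \<longleftrightarrow>
     openin T U \<and> (\<forall>k. Ck_level s T s' T' k 0 (Pt ` U) (f \<circ> un_Pt))"

text \<open>$df(x)v = f^{[1]}(x,v,0)$; the value is unique because units are dense and the target is
  Hausdorff.\<close>

definition differential ::
  "('k::{comm_ring_1, topological_space} \<Rightarrow> 'e::ab_group_add \<Rightarrow> 'e) \<Rightarrow> 'e topology \<Rightarrow>
   ('k \<Rightarrow> 'f::ab_group_add \<Rightarrow> 'f) \<Rightarrow> 'f topology \<Rightarrow> 'e set \<Rightarrow> ('e \<Rightarrow> 'f) \<Rightarrow> 'e \<Rightarrow> 'e \<Rightarrow> 'f" where
  "differential s T s' T' U f x v =
     (THE w. \<exists>F1. diff_quotient s T s' T' 0 (Pt ` U) (f \<circ> un_Pt) F1 \<and>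
                  w = F1 (Inc (Pt x) (Pt v) 0))"


section \<open>Smooth manifolds\<close>

text \<open>Charts are pairs of a domain and a map; values of the map off the domain are irrelevant.\<close>

record ('k, 'e, 'x) manifold =
  scal :: "'k \<Rightarrow> 'e \<Rightarrow> 'e"
  model :: "'e topology"
  mtop :: "'x topology"
  atlas :: "('x set \<times> ('x \<Rightarrow> 'e)) set"

definition smooth_manifold ::
  "('k::{comm_ring_1, topological_space}, 'e::ab_group_add, 'x) manifold \<Rightarrow> bool" where
  "smooth_manifold M \<longleftrightarrow>
     topological_module (scal M) (model M) \<and>
     \<Union>(fst ` atlas M) = topspace (mtop M) \<and>
     (\<forall>(U, \<phi>) \<in> atlas M.
        openin (mtop M) U \<and> openin (model M) (\<phi> ` U) \<and>
        homeomorphic_map (subtopology (mtop M) U) (subtopology (model M) (\<phi> ` U)) \<phi>) \<and>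
     (\<forall>(U, \<phi>) \<in> atlas M. \<forall>(W, \<psi>) \<in> atlas M.
        smooth_on (scal M) (model M) (scal M) (model M)
          (\<phi> ` (U \<inter> W)) (\<lambda>x. \<psi> (inv_into U \<phi> x)))"

text \<open>Over a general topological ring smoothness is not a local property, so
  the local representatives are required to be smooth on their full domains, for all pairs of
  charts of the two given atlases.\<close>

definition smooth_map_on ::
  "('k::{comm_ring_1, topological_space}, 'e::ab_group_add, 'x) manifold \<Rightarrow>
   ('k, 'f::ab_group_add, 'y) manifold \<Rightarrow> 'x set \<Rightarrow> ('x \<Rightarrow> 'y) \<Rightarrow> bool" where
  "smooth_map_on M N D f \<longleftrightarrow>
     openin (mtop M) D \<and>
     continuous_map (subtopology (mtop M) D) (mtop N) f \<and>
     (\<forall>(U, \<phi>) \<in> atlas M. \<forall>(W, \<psi>) \<in> atlas N.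
        smooth_on (scal M) (model M) (scal N) (model N)
          (\<phi> ` {p \<in> U \<inter> D. f p \<in> W}) (\<lambda>x. \<psi> (f (inv_into U \<phi> x))))"

abbreviation smooth_map ::
  "('k::{comm_ring_1, topological_space}, 'e::ab_group_add, 'x) manifold \<Rightarrow>
   ('k, 'f::ab_group_add, 'y) manifold \<Rightarrow> ('x \<Rightarrow> 'y) \<Rightarrow> bool" where
  "smooth_map M N f \<equiv> smooth_map_on M N (topspace (mtop M)) f"

definition diffeomorphism ::
  "('k::{comm_ring_1, topological_space}, 'e::ab_group_add, 'x) manifold \<Rightarrow>
   ('k, 'f::ab_group_add, 'y) manifold \<Rightarrow> ('x \<Rightarrow> 'y) \<Rightarrow> bool" where
  "diffeomorphism M N f \<longleftrightarrow>
     bij_betw f (topspace (mtop M)) (topspace (mtop N)) \<and>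
     smooth_map M N f \<and> smooth_map N M (inv_into (topspace (mtop M)) f)"

definition prod_manifold ::
  "('k::{comm_ring_1, topological_space}, 'e::ab_group_add, 'x) manifold \<Rightarrow>
   ('k, 'f::ab_group_add, 'y) manifold \<Rightarrow> ('k, 'e \<times> 'f, 'x \<times> 'y) manifold" where
  "prod_manifold M N =
     \<lparr> scal = module_prod.scale (scal M) (scal N),
       model = prod_topology (model M) (model N),
       mtop = prod_topology (mtop M) (mtop N),
       atlas = {(U \<times> W, map_prod \<phi> \<psi>) | U \<phi> W \<psi>. (U, \<phi>) \<in> atlas M \<and> (W, \<psi>) \<in> atlas N} \<rparr>"

definition module_manifold :: "('k \<Rightarrow> 'e \<Rightarrow> 'e) \<Rightarrow> 'e topology \<Rightarrow> ('k, 'e, 'e) manifold" where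
  "module_manifold s T = \<lparr> scal = s, model = T, mtop = T, atlas = {(topspace T, id)} \<rparr>"


section \<open>3-graded Lie algebras and topological Jordan pairs\<close>

text \<open>\<open>grade\<close> gives all homogeneous components, \<open>euler\<close> is the element $E$ with $D = ad(E)$, and
  \<open>gtop \<sigma>\<close> is the topology of $V^\sigma$, used for $\sigma = 1$ and $\sigma = -1$ only.\<close>

record ('k, 'g) graded_lie =
  smul :: "'k \<Rightarrow> 'g \<Rightarrow> 'g"
  brk :: "'g \<Rightarrow> 'g \<Rightarrow> 'g"
  grade :: "int \<Rightarrow> 'g set"
  euler :: 'g
  gtop :: "int \<Rightarrow> 'g topology"

definition lie_algebra :: "('k::comm_ring_1, 'g::ab_group_add) graded_lie \<Rightarrow> bool" where
  "lie_algebra L \<longleftrightarrow>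
     module (smul L) \<and>
     (\<forall>x. module_hom (smul L) (smul L) (\<lambda>y. brk L x y)) \<and>
     (\<forall>y. module_hom (smul L) (smul L) (\<lambda>x. brk L x y)) \<and>
     (\<forall>x. brk L x x = 0) \<and>
     (\<forall>x y z. brk L x (brk L y z) + brk L y (brk L z x) + brk L z (brk L x y) = 0)"

definition three_graded_lie_algebra ::
  "('k::comm_ring_1, 'g::ab_group_add) graded_lie \<Rightarrow> bool" where
  "three_graded_lie_algebra L \<longleftrightarrow>
     lie_algebra L \<and>
     (\<forall>k. module.subspace (smul L) (grade L k)) \<and>
     (\<forall>k. \<bar>k\<bar> > 1 \<longrightarrow> grade L k = {0}) \<and>
     (\<forall>x. \<exists>!(a, b, c). a \<in> grade L 1 \<and> b \<in> grade L 0 \<and> c \<in> grade L (-1) \<and> x = a + b + c) \<and>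
     (\<forall>k l. \<forall>x \<in> grade L k. \<forall>y \<in> grade L l. brk L x y \<in> grade L (k + l)) \<and>
     (\<forall>k. \<forall>x \<in> grade L k. brk L (euler L) x = smul L (of_int k) x)"

definition pr :: "('k, 'g::ab_group_add) graded_lie \<Rightarrow> int \<Rightarrow> 'g \<Rightarrow> 'g" where
  "pr L i x = (THE y. \<exists>f. (\<forall>k. f k \<in> grade L k) \<and> x = f 1 + f 0 + f (-1) \<and> y = f i)"

definition jordan_triple :: "('k, 'g::ab_group_add) graded_lie \<Rightarrow> 'g \<Rightarrow> 'g \<Rightarrow> 'g \<Rightarrow> 'g" where
  "jordan_triple L x y z = - brk L (brk L x y) z"

definition topological_jordan_pair ::
  "('k::{comm_ring_1, topological_space}, 'g::ab_group_add) graded_lie \<Rightarrow> bool" where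
  "topological_jordan_pair L \<longleftrightarrow>
     (\<forall>\<sigma> \<in> {1, -1}.
        topspace (gtop L \<sigma>) = grade L \<sigma> \<and>
        topological_module (smul L) (gtop L \<sigma>) \<and>
        continuous_map
          (prod_topology (gtop L \<sigma>) (prod_topology (gtop L (-\<sigma>)) (gtop L \<sigma>))) (gtop L \<sigma>)
          (\<lambda>(x, y, z). jordan_triple L x y z))"

text \<open>Endomorphisms of a submodule \<open>S\<close>, as functions on the ambient type whose values off \<open>S\<close> are
  irrelevant.\<close>

definition End_on :: "('k \<Rightarrow> 'g \<Rightarrow> 'g) \<Rightarrow> 'g::ab_group_add set \<Rightarrow> ('g \<Rightarrow> 'g) set" where
  "End_on s S = {f. f \<in> S \<rightarrow> S \<and> (\<forall>x\<in>S. \<forall>y\<in>S. f (x + y) = f x + f y) \<and>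
                    (\<forall>r. \<forall>x\<in>S. f (s r x) = s r (f x))}"

definition GL_on :: "('k \<Rightarrow> 'g \<Rightarrow> 'g) \<Rightarrow> 'g::ab_group_add set \<Rightarrow> ('g \<Rightarrow> 'g) set" where
  "GL_on s S = {f \<in> End_on s S. \<exists>h \<in> End_on s S. \<forall>x\<in>S. h (f x) = x \<and> f (h x) = x}"

text \<open>One formula covers both Bergman operators: $B_+(x,a)$ on $V^+$ is \<open>bergman L x a\<close> and
  $B_-(a,x)$ on $V^-$ is \<open>bergman L a x\<close>.\<close>

definition bergman ::
  "('k::comm_ring_1, 'g::ab_group_add) graded_lie \<Rightarrow> 'g \<Rightarrow> 'g \<Rightarrow> 'g \<Rightarrow> 'g" where
  "bergman L x a v =
     v + brk L x (brk L a v) + smul L (ring_inv 4) (brk L x (brk L x (brk L a (brk L a v))))"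

definition condition_C1 ::
  "('k::{comm_ring_1, topological_space}, 'g::ab_group_add) graded_lie \<Rightarrow> bool" where
  "condition_C1 L \<longleftrightarrow>
     (let Vp = grade L 1; Vm = grade L (-1);
          V2 = prod_topology (gtop L 1) (gtop L (-1));
          Q = {(x, a). x \<in> Vp \<and> a \<in> Vm \<and>
                 bergman L x a \<in> GL_on (smul L) Vp \<and> bergman L a x \<in> GL_on (smul L) Vm}
      in openin V2 Q \<and>
         continuous_map (subtopology (prod_topology V2 V2) (Q \<times> (Vp \<times> Vm))) V2
           (\<lambda>((x, a), (v, b)). (inv_into Vp (bergman L x a) v, inv_into Vm (bergman L a x) b)))"

definition condition_C2 ::
  "('k::{comm_ring_1, topological_space}, 'g::ab_group_add) graded_lie \<Rightarrow> bool" where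
  "condition_C2 L \<longleftrightarrow>
     (\<forall>\<sigma> \<in> {1, -1}. \<forall>a \<in> grade L (-\<sigma>).
        let V = grade L \<sigma>;
            U = {x \<in> V. bergman L x a \<in> GL_on (smul L) V \<and>
                        bergman L a x \<in> GL_on (smul L) (grade L (-\<sigma>))}
        in openin (gtop L \<sigma>) U \<and>
           continuous_map (subtopology (prod_topology (gtop L \<sigma>) (gtop L \<sigma>)) (U \<times> V)) (gtop L \<sigma>)
             (\<lambda>(x, v). inv_into V (bergman L x a) v))"


section \<open>The projective completion\<close>

definition lie_aut :: "('k::comm_ring_1, 'g::ab_group_add) graded_lie \<Rightarrow> ('g \<Rightarrow> 'g) monoid" where
  "lie_aut L =
     \<lparr> carrier = {f. bij f \<and> module_hom (smul L) (smul L) f \<and>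
                     (\<forall>x y. f (brk L x y) = brk L (f x) (f y))},
       mult = (\<circ>), one = id \<rparr>"

definition exp_ad :: "('k::comm_ring_1, 'g::ab_group_add) graded_lie \<Rightarrow> 'g \<Rightarrow> 'g \<Rightarrow> 'g" where
  "exp_ad L x y = y + brk L x y + smul L (ring_inv 2) (brk L x (brk L x y))"

text \<open>That the maps $e^{ad(x)}$, $x \in V^\pm$, are automorphisms belongs to the setting in which the
  projective elementary group is defined. It is automatic if 3 is invertible, but
  for rings of characteristic 3 it does not follow from the axioms of a 3-graded Lie algebra:
  $e^{ad(x)}[a,b] = [e^{ad(x)}a, e^{ad(x)}b]$ for $a, b \in V^-$ and $x \in V^+$ requires that
  $[ad(x)^2 a, ad(x) b] + [ad(x) a, ad(x)^2 b]$ vanishes, whereas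
  $ad(x)^3[a,b] = 0$ only yields three times this.\<close>

definition exp_ad_automorphic :: "('k::comm_ring_1, 'g::ab_group_add) graded_lie \<Rightarrow> bool" where
  "exp_ad_automorphic L \<longleftrightarrow> (\<forall>x \<in> grade L 1 \<union> grade L (-1). exp_ad L x \<in> carrier (lie_aut L))"

definition elementary_group :: "('k::comm_ring_1, 'g::ab_group_add) graded_lie \<Rightarrow> ('g \<Rightarrow> 'g) set" where
  "elementary_group L = generate (lie_aut L) (exp_ad L ` (grade L 1 \<union> grade L (-1)))"

text \<open>A flag $0 \subset f_1 \subset f_0 \subset g$ is the pair of $f_1$ and $f_0$. The spaces attached to a sign
  \<open>\<sigma>\<close>, such as $o^\sigma$ and $X^\sigma$, are indexed by \<open>\<sigma> = 1\<close> and \<open>\<sigma> = -1\<close>.\<close>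

type_synonym 'g flag = "'g set \<times> 'g set"

definition act :: "('g \<Rightarrow> 'g) \<Rightarrow> 'g flag \<Rightarrow> 'g flag" where
  "act g f = (g ` fst f, g ` snd f)"

definition base_flag :: "('k, 'g::ab_group_add) graded_lie \<Rightarrow> int \<Rightarrow> 'g flag" where
  "base_flag L \<sigma> = (grade L (-\<sigma>), {a + b | a b. a \<in> grade L (-\<sigma>) \<and> b \<in> grade L 0})"

definition proj_completion ::
  "('k::comm_ring_1, 'g::ab_group_add) graded_lie \<Rightarrow> int \<Rightarrow> 'g flag set" where
  "proj_completion L \<sigma> = (\<lambda>g. act g (base_flag L \<sigma>)) ` elementary_group L"

text \<open>The embedding of $V^\sigma$ into $X^\sigma$.\<close>

definition flag_embed :: "('k::comm_ring_1, 'g::ab_group_add) graded_lie \<Rightarrow> int \<Rightarrow> 'g \<Rightarrow> 'g flag" where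
  "flag_embed L \<sigma> x = act (exp_ad L x) (base_flag L \<sigma>)"

definition chart_dom ::
  "('k::comm_ring_1, 'g::ab_group_add) graded_lie \<Rightarrow> int \<Rightarrow> ('g \<Rightarrow> 'g) \<Rightarrow> 'g flag set" where
  "chart_dom L \<sigma> g = (\<lambda>x. act g (flag_embed L \<sigma> x)) ` grade L \<sigma>"

definition chart_map ::
  "('k::comm_ring_1, 'g::ab_group_add) graded_lie \<Rightarrow> int \<Rightarrow> ('g \<Rightarrow> 'g) \<Rightarrow> 'g flag \<Rightarrow> 'g" where
  "chart_map L \<sigma> g p = (THE x. x \<in> grade L \<sigma> \<and> p = act g (flag_embed L \<sigma> x))"

definition chart_atlas ::
  "('k::comm_ring_1, 'g::ab_group_add) graded_lie \<Rightarrow> int \<Rightarrow> ('g flag set \<times> ('g flag \<Rightarrow> 'g)) set" where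
  "chart_atlas L \<sigma> = (\<lambda>g. (chart_dom L \<sigma> g, chart_map L \<sigma> g)) ` elementary_group L"

definition completion_with ::
  "('k::comm_ring_1, 'g::ab_group_add) graded_lie \<Rightarrow> int \<Rightarrow> 'g flag topology \<Rightarrow>
     ('k, 'g, 'g flag) manifold" where
  "completion_with L \<sigma> T =
     \<lparr> scal = smul L, model = gtop L \<sigma>, mtop = T, atlas = chart_atlas L \<sigma> \<rparr>"

text \<open>$X^\sigma$ with the topology making the given charts a smooth atlas, whose unique existence
  is part of the theorem.\<close>

definition completion_manifold ::
  "('k::{comm_ring_1, topological_space}, 'g::ab_group_add) graded_lie \<Rightarrow> int \<Rightarrow>
     ('k, 'g, 'g flag) manifold" where
  "completion_manifold L \<sigma> =
     completion_with L \<sigma>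
       (THE T. topspace T = proj_completion L \<sigma> \<and> smooth_manifold (completion_with L \<sigma> T))"

definition complementary :: "'g::ab_group_add set \<Rightarrow> 'g set \<Rightarrow> bool" where
  "complementary A B \<longleftrightarrow> {a + b | a b. a \<in> A \<and> b \<in> B} = UNIV \<and> A \<inter> B = {0}"

definition transversal :: "'g::ab_group_add flag \<Rightarrow> 'g flag \<Rightarrow> bool" where
  "transversal f e \<longleftrightarrow> complementary (fst f) (snd e) \<and> complementary (fst e) (snd f)"

definition transversal_pairs ::
  "('k::comm_ring_1, 'g::ab_group_add) graded_lie \<Rightarrow> ('g flag \<times> 'g flag) set" where
  "transversal_pairs L =
     {(x, y). x \<in> proj_completion L 1 \<and> y \<in> proj_completion L (-1) \<and> transversal x y}"

text \<open>$\mu_r(x,y,z)$: writing $y = g.o^-$, $x = g.u$ and $z = g.w$ with $u, w \in V^+$, the product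
  $rz$ in the module $V_y = g(V^+)$ with zero vector $x$ is $g.(u + r(w - u))$. It does not
  depend on the choice of $g$.\<close>

definition mu ::
  "('k::comm_ring_1, 'g::ab_group_add) graded_lie \<Rightarrow> 'k \<Rightarrow> 'g flag \<Rightarrow> 'g flag \<Rightarrow> 'g flag \<Rightarrow> 'g flag" where
  "mu L r x y z =
     (THE p. \<exists>g \<in> elementary_group L. \<exists>u \<in> grade L 1. \<exists>w \<in> grade L 1.
        y = act g (base_flag L (-1)) \<and>
        x = act g (flag_embed L 1 u) \<and> z = act g (flag_embed L 1 w) \<and>
        p = act g (flag_embed L 1 (u + smul L r (w - u))))"

definition mu_domain ::
  "('k::comm_ring_1, 'g::ab_group_add) graded_lie \<Rightarrow> ('g flag \<times> 'g flag \<times> 'g flag) set" where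
  "mu_domain L = {(x, y, z). (x, y) \<in> transversal_pairs L \<and> (z, y) \<in> transversal_pairs L}"


section \<open>Denominators and nominators\<close>

text \<open>The matrix coefficient $g_{ij}$, a map from the component \<open>j\<close> to the component \<open>i\<close>.\<close>

definition coef ::
  "('k, 'g::ab_group_add) graded_lie \<Rightarrow> ('g \<Rightarrow> 'g) \<Rightarrow> int \<Rightarrow> int \<Rightarrow> 'g \<Rightarrow> 'g" where
  "coef L g i j = (\<lambda>v \<in> grade L j. pr L i (g v))"

definition denom ::
  "('k::comm_ring_1, 'g::ab_group_add) graded_lie \<Rightarrow> ('g \<Rightarrow> 'g) \<Rightarrow> 'g \<Rightarrow> 'g \<Rightarrow> 'g" where
  "denom L g x = coef L (exp_ad L (- x) \<circ> inv_into UNIV g) 1 1"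

definition codenom ::
  "('k::comm_ring_1, 'g::ab_group_add) graded_lie \<Rightarrow> ('g \<Rightarrow> 'g) \<Rightarrow> 'g \<Rightarrow> 'g \<Rightarrow> 'g" where
  "codenom L g x = coef L (g \<circ> exp_ad L x) (-1) (-1)"

definition nomin ::
  "('k::comm_ring_1, 'g::ab_group_add) graded_lie \<Rightarrow> ('g \<Rightarrow> 'g) \<Rightarrow> 'g \<Rightarrow> 'g" where
  "nomin L g x = pr L 1 (exp_ad L (- x) (inv_into UNIV g (euler L)))"

definition regular_set ::
  "('k::comm_ring_1, 'g::ab_group_add) graded_lie \<Rightarrow> ('g \<Rightarrow> 'g) \<Rightarrow> 'g set" where
  "regular_set L g =
     {x \<in> grade L 1. denom L g x \<in> GL_on (smul L) (grade L 1) \<and>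
                     codenom L g x \<in> GL_on (smul L) (grade L (-1))}"

end

theory Submission
  imports Defs
begin

text \<open>Every group element $g$ acts on the flags, and everything is decided by the question when
  $\gamma.o^+$ lies in $V^+$ for a given automorphism $\gamma$. The answer is a Gauss decomposition:
  $\gamma.o^+$ is transversal to $o^-$ if and only if
  $\gamma = e^{ad(x)} h e^{ad(w)}$ with $x \in V^+$, $w \in V^-$ and $h$ preserving the grading, and then
  $\gamma.o^+ = x$. (Such $\gamma$ are said to lie in the big cell.) The decomposition can be read off from
  matrix coefficients: $h^{-1}$ on $V^+$ is the denominator $(\gamma^{-1})_{11}$ and
  $x$ is the inverse denominator applied to the nominator $pr_1(\gamma^{-1} E)$. The conditions
  on the coefficients are invertibility of $(\gamma^{-1})_{11}$ and $\gamma_{-1,-1}$, and for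
  $\gamma = e^{ad(a)} e^{ad(x)}$ these two are the Bergman operators.

  Let $\gamma_y$ be a product of exponentials whose arguments depend on a parameter $y$. No
  topology is given on $g_0$, but components in $g_0$ only enter through their brackets with elements of
  $V^\pm$, hence denominators and nominators are polynomial in the arguments
  (\<open>gclass_word\<close>). If the inverse denominator is known to be jointly continuous, then it is
  smooth: the difference quotient of an inverse family is again built from the family and its inverse
  (\<open>Cinf_on_solve\<close>), so that by the chain rule each degree of differentiability gives the next.
  Hence the coordinate of $\gamma_y.o^+$ is smooth where it is defined (\<open>cell_point_smooth\<close>).
  The chain rule is proved for maps between the towers on which iterated difference quotients
  live.

  It remains to show that the big cell is open in the parameter and that inverse
  denominators are continuous. For $\gamma_x = g e^{ad(x)}$ with $g$ fixed, translation to
  a base point reduces this to a Bergman operator $B_+(x, a)$ with fixed $a$, that is, to (C2). This yields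
  the charts, their smooth transition maps and the action of the group. If all
  arguments vary, (C1) is used: families with a continuous Gauss decomposition can be
  multiplied as long as the limit of the product stays in the big cell, so families tending to
  the identity are closed under products and under conjugation, and every family of words is such a
  family times its value at a point (\<open>cell_family_word\<close>). In charts, the actions of $V^\pm$, the
  transversality relation and the maps $\mu_r$ are all given by families of words, the last one with
  arguments that are themselves coordinates of such families.

  The statements about $X^-$ are those about $X^+$ for the Lie algebra with reversed grading.\<close>

section \<open>Topological modules\<close>

definition continuous_module ::
  "('k::{comm_ring_1, topological_space} \<Rightarrow> 'e::ab_group_add \<Rightarrow> 'e) \<Rightarrow> 'e topology \<Rightarrow> bool" where
  "continuous_module s T \<longleftrightarrow>
     module s \<and> module.subspace s (topspace T) \<and>
     continuous_map (prod_topology T T) T (\<lambda>(x, y). x + y) \<and>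
     continuous_map (prod_topology euclidean T) T (\<lambda>(r, x). s r x)"

lemma topological_module_continuous_module: "topological_module s T \<Longrightarrow> continuous_module s T"
  by (simp add: topological_module_def continuous_module_def)

lemma continuous_module_module: "continuous_module s T \<Longrightarrow> module s"
  by (simp add: continuous_module_def)

lemma continuous_module_mem:
  assumes "continuous_module s T"
  shows "0 \<in> topspace T" "\<And>x y. x \<in> topspace T \<Longrightarrow> y \<in> topspace T \<Longrightarrow> x + y \<in> topspace T"
    "\<And>r x. x \<in> topspace T \<Longrightarrow> s r x \<in> topspace T"
    "\<And>x y. x \<in> topspace T \<Longrightarrow> y \<in> topspace T \<Longrightarrow> x - y \<in> topspace T"
proof -
  interpret module s using assms by (rule continuous_module_module)
  have sub: "subspace (topspace T)" using assms by (simp add: continuous_module_def)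
  show "0 \<in> topspace T" "\<And>x y. x \<in> topspace T \<Longrightarrow> y \<in> topspace T \<Longrightarrow> x + y \<in> topspace T"
    "\<And>r x. x \<in> topspace T \<Longrightarrow> s r x \<in> topspace T"
    "\<And>x y. x \<in> topspace T \<Longrightarrow> y \<in> topspace T \<Longrightarrow> x - y \<in> topspace T"
    using sub subspace_0 subspace_add subspace_scale subspace_diff by blast+
qed

lemma continuous_map_add_module:
  assumes "continuous_module s T" "continuous_map X T f" "continuous_map X T g"
  shows "continuous_map X T (\<lambda>p. f p + g p)"
proof -
  have "continuous_map X (prod_topology T T) (\<lambda>p. (f p, g p))"
    using assms by (simp add: continuous_map_pairedI)
  moreover have "continuous_map (prod_topology T T) T (\<lambda>(x, y). x + y)"
    using assms by (simp add: continuous_module_def)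
  ultimately show ?thesis
    by (auto dest: continuous_map_compose simp: o_def)
qed

lemma continuous_map_scale_module:
  assumes "continuous_module s T" "continuous_map X euclidean r" "continuous_map X T f"
  shows "continuous_map X T (\<lambda>p. s (r p) (f p))"
proof -
  have "continuous_map X (prod_topology euclidean T) (\<lambda>p. (r p, f p))"
    using assms by (simp add: continuous_map_pairedI)
  moreover have "continuous_map (prod_topology euclidean T) T (\<lambda>(r, x). s r x)"
    using assms by (simp add: continuous_module_def)
  ultimately show ?thesis
    by (auto dest: continuous_map_compose simp: o_def)
qed

lemma module_prod_scale:
  assumes "module s" "module s'"
  shows "module_prod.scale s s' r x = (s r (fst x), s' r (snd x))"
proof -
  interpret module_prod s s' using assms by (simp add: module_pair_def module_prod_def)
  show ?thesis by (simp add: scale_def)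
qed

lemma continuous_map_component_of:
  assumes "continuous_map X (prod_topology T T') f"
  shows "continuous_map X T (\<lambda>p. fst (f p))" "continuous_map X T' (\<lambda>p. snd (f p))"
  using assms by (simp_all add: continuous_map_pairwise o_def)

lemma continuous_module_prod:
  assumes "continuous_module s T" "continuous_module s' T'"
  shows "continuous_module (module_prod.scale s s') (prod_topology T T')"
proof -
  interpret module_prod s s'
    using assms by (simp add: module_pair_def module_prod_def continuous_module_module)
  let ?P = "prod_topology T T'"
  have "p.subspace (topspace ?P)"
    using assms subspace_Times by (simp add: continuous_module_def)
  moreover have "continuous_map (prod_topology ?P ?P) ?P (\<lambda>(x, y). x + y)"
  proof -
    have 1: "continuous_map (prod_topology ?P ?P) T (\<lambda>p. fst (fst p) + fst (snd p))"
      by (rule continuous_map_add_module[OF assms(1) continuous_map_component_of(1)[OF continuous_map_fst] continuous_map_component_of(1)[OF continuous_map_snd]])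
    have 2: "continuous_map (prod_topology ?P ?P) T' (\<lambda>p. snd (fst p) + snd (snd p))"
      by (rule continuous_map_add_module[OF assms(2) continuous_map_component_of(2)[OF continuous_map_fst] continuous_map_component_of(2)[OF continuous_map_snd]])
    show ?thesis
      using continuous_map_pairedI[OF 1 2] by (simp add: case_prod_unfold plus_prod_def)
  qed
  moreover have "continuous_map (prod_topology euclidean ?P) ?P (\<lambda>(r, x). scale r x)"
  proof -
    have 1: "continuous_map (prod_topology euclidean ?P) T (\<lambda>p. s (fst p) (fst (snd p)))"
      by (rule continuous_map_scale_module[OF assms(1) continuous_map_fst continuous_map_component_of(1)[OF continuous_map_snd]])
    have 2: "continuous_map (prod_topology euclidean ?P) T' (\<lambda>p. s' (fst p) (snd (snd p)))"
      by (rule continuous_map_scale_module[OF assms(2) continuous_map_fst continuous_map_component_of(2)[OF continuous_map_snd]])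
    show ?thesis
      using continuous_map_pairedI[OF 1 2] by (simp add: case_prod_unfold scale_def)
  qed
  ultimately show ?thesis
    using p.module_axioms by (simp add: continuous_module_def)
qed

section \<open>The tower over a topological module\<close>

lemma topspace_tower_0 [simp]: "topspace (tower_top T 0) = Pt ` topspace T"
  by (auto simp: topspace_pullback_topology)

lemma topspace_tower_Suc [simp]:
  "topspace (tower_top T (Suc n)) =
     {Inc x v t | x v t. x \<in> topspace (tower_top T n) \<and> v \<in> topspace (tower_top T n)}"
  by (auto simp: topspace_pullback_topology)

declare tower_top.simps [simp del]

lemma continuous_map_tower_0:
  "continuous_map X (tower_top T 0) f \<longleftrightarrow>
     (\<forall>p \<in> topspace X. f p = Pt (un_Pt (f p))) \<and> continuous_map X T (\<lambda>p. un_Pt (f p))"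
  (is "?l \<longleftrightarrow> ?r")
proof
  assume l: ?l
  have "continuous_map (tower_top T 0) T un_Pt"
    using continuous_map_pullback[of T T id "range Pt" un_Pt] by (simp add: tower_top.simps)
  from continuous_map_compose[OF l this] have "continuous_map X T (\<lambda>p. un_Pt (f p))"
    by (simp add: o_def)
  moreover have "f p = Pt (un_Pt (f p))" if "p \<in> topspace X" for p
    using continuous_map_image_subset_topspace[OF l] that by (auto simp: image_subset_iff)
  ultimately show ?r by blast
next
  assume r: ?r
  then have "topspace X \<subseteq> f -` range Pt" by (metis rangeI subsetI vimageI)
  with r show ?l
    unfolding tower_top.simps by (intro continuous_map_pullback') (auto simp: o_def)
qed

lemma continuous_map_tower_Suc:
  "continuous_map X (tower_top T (Suc n)) f \<longleftrightarrow>
     (\<forall>p \<in> topspace X. f p = Inc (base (f p)) (dir (f p)) (par (f p))) \<and>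
     continuous_map X (tower_top T n) (\<lambda>p. base (f p)) \<and>
     continuous_map X (tower_top T n) (\<lambda>p. dir (f p)) \<and>
     continuous_map X euclidean (\<lambda>p. par (f p))"
  (is "?l \<longleftrightarrow> ?r")
proof
  let ?P = "prod_topology (tower_top T n) (prod_topology (tower_top T n) euclidean)"
  assume l: ?l
  have "continuous_map (tower_top T (Suc n)) ?P (\<lambda>p. (base p, dir p, par p))"
    using continuous_map_pullback[of ?P ?P id] by (simp add: tower_top.simps)
  from continuous_map_compose[OF l this]
  have "continuous_map X ?P (\<lambda>p. (base (f p), dir (f p), par (f p)))"
    by (simp add: o_def)
  moreover have "f p = Inc (base (f p)) (dir (f p)) (par (f p))" if "p \<in> topspace X" for p
    using continuous_map_image_subset_topspace[OF l] that by (auto simp: image_subset_iff)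
  ultimately show ?r by (auto simp: continuous_map_pairwise o_def)
next
  assume r: ?r
  then have "topspace X \<subseteq> f -` {Inc x v t | x v t. True}" by blast
  with r show ?l
    unfolding tower_top.simps
    by (intro continuous_map_pullback') (auto simp: o_def continuous_map_pairedI)
qed

lemma continuous_map_un_Pt: "continuous_map (tower_top T 0) T un_Pt"
  using continuous_map_tower_0[of "tower_top T 0" T id] by simp

lemma continuous_map_base: "continuous_map (tower_top T (Suc n)) (tower_top T n) base"
  and continuous_map_dir: "continuous_map (tower_top T (Suc n)) (tower_top T n) dir"
  and continuous_map_par: "continuous_map (tower_top T (Suc n)) euclidean par"
  using continuous_map_tower_Suc[THEN iffD1, OF continuous_map_id, unfolded id_apply, of T n] by blast+

lemma dq_domain_subset: "U \<subseteq> topspace (tower_top T n) \<Longrightarrow> dq_domain s T n U \<subseteq> topspace (tower_top T (Suc n))"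
  by (auto simp: dq_domain_def)

lemma Inc_in_dq_domain [simp]:
  "Inc x v t \<in> dq_domain s T n U \<longleftrightarrow>
     x \<in> U \<and> v \<in> topspace (tower_top T n) \<and> tower_add x (tower_scale s t v) \<in> U"
  by (auto simp: dq_domain_def)

text \<open>Compatibility with $x + t v$ is all that difference quotients see of linearity; in this form the
  property passes from a map to its lift to the next level, which acts on base point and direction.\<close>

definition tower_linear ::
  "('k::{comm_ring_1, topological_space} \<Rightarrow> 'e::ab_group_add \<Rightarrow> 'e) \<Rightarrow> 'e topology \<Rightarrow> nat \<Rightarrow>
   ('k \<Rightarrow> 'f::ab_group_add \<Rightarrow> 'f) \<Rightarrow> 'f topology \<Rightarrow> nat \<Rightarrow>
     (('k, 'e) tower \<Rightarrow> ('k, 'f) tower) \<Rightarrow> bool" where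
  "tower_linear s T n s' T' n' \<pi> \<longleftrightarrow>
     continuous_map (tower_top T n) (tower_top T' n') \<pi> \<and>
     (\<forall>x \<in> topspace (tower_top T n). \<forall>v \<in> topspace (tower_top T n). \<forall>t.
        \<pi> (tower_add x (tower_scale s t v)) = tower_add (\<pi> x) (tower_scale s' t (\<pi> v)))"

lemma tower_linear_lift:
  assumes "tower_linear s T n s' T' n' \<pi>"
  shows "tower_linear s T (Suc n) s' T' (Suc n') (\<lambda>p. Inc (\<pi> (base p)) (\<pi> (dir p)) (par p))"
  using assms
  by (fastforce simp: tower_linear_def continuous_map_tower_Suc continuous_map_par
      intro: continuous_map_compose[OF continuous_map_base, unfolded o_def]
             continuous_map_compose[OF continuous_map_dir, unfolded o_def])

lemma tower_linear_base: "tower_linear s T (Suc n) s T n base"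
  by (auto simp: tower_linear_def continuous_map_base)

section \<open>Differentiability along the tower\<close>

text \<open>The map itself is required to be continuous at every degree, not only at degree 0. This makes it
  evident that the degree can be lowered, which all the inductions below rely on.\<close>

primrec Ck_on ::
  "('k::{comm_ring_1, topological_space} \<Rightarrow> 'e::ab_group_add \<Rightarrow> 'e) \<Rightarrow> 'e topology \<Rightarrow>
   ('k \<Rightarrow> 'f::ab_group_add \<Rightarrow> 'f) \<Rightarrow> 'f topology \<Rightarrow> nat \<Rightarrow>
     nat \<Rightarrow> ('k, 'e) tower set \<Rightarrow> (('k, 'e) tower \<Rightarrow> 'f) \<Rightarrow> bool" where
  "Ck_on s T s' T' 0 n U F \<longleftrightarrow> continuous_map (subtopology (tower_top T n) U) T' F"
| "Ck_on s T s' T' (Suc k) n U F \<longleftrightarrow>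
     continuous_map (subtopology (tower_top T n) U) T' F \<and>
     (\<exists>F1. diff_quotient s T s' T' n U F F1 \<and> Ck_on s T s' T' k (Suc n) (dq_domain s T n U) F1)"

lemma Ck_on_Ck_level: "Ck_on s T s' T' k n U F \<Longrightarrow> Ck_level s T s' T' k n U F"
  by (induction k arbitrary: n U F) auto

lemma Ck_on_continuous: "Ck_on s T s' T' k n U F \<Longrightarrow> continuous_map (subtopology (tower_top T n) U) T' F"
  by (cases k) auto

lemma Ck_on_mono_Suc: "Ck_on s T s' T' (Suc k) n U F \<Longrightarrow> Ck_on s T s' T' k n U F"
proof (induction k arbitrary: n U F)
  case (Suc k)
  then obtain F1 where "diff_quotient s T s' T' n U F F1"
    "Ck_on s T s' T' (Suc k) (Suc n) (dq_domain s T n U) F1"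
    by (metis Ck_on.simps(2))
  from this(1) Suc.IH[OF this(2)] Ck_on_continuous[OF Suc.prems] show ?case by auto
qed simp

lemma Ck_on_mem: 
  assumes "Ck_on s T s' T' k n U F" "U \<subseteq> topspace (tower_top T n)" "p \<in> U"
  shows "F p \<in> topspace T'"
  using continuous_map_image_subset_topspace[OF Ck_on_continuous[OF assms(1)]] assms(2,3)
  by (auto simp: image_subset_iff)

lemma Ck_on_cong:
  assumes "Ck_on s T s' T' k n U F" "\<And>p. p \<in> U \<Longrightarrow> F p = G p" 
  shows "Ck_on s T s' T' k n U G"
proof -
  have c: "continuous_map (subtopology (tower_top T n) U) T' F \<Longrightarrow> continuous_map (subtopology (tower_top T n) U) T' G"
    by (erule continuous_map_eq) (simp add: assms(2))
  show ?thesis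
  proof (cases k)
    case 0 then show ?thesis using c assms(1) by simp
  next
    case (Suc l)
    have "diff_quotient s T s' T' n U F F1 \<Longrightarrow> diff_quotient s T s' T' n U G F1" for F1
      using assms(2) by (auto simp: diff_quotient_def)
    then show ?thesis using c assms(1) Suc by auto
  qed
qed

lemma dq_domain_mono: "U' \<subseteq> U \<Longrightarrow> dq_domain s T n U' \<subseteq> dq_domain s T n U"
  by (auto simp: dq_domain_def)

lemma Ck_on_subset: "Ck_on s T s' T' k n U F \<Longrightarrow> U' \<subseteq> U \<Longrightarrow> Ck_on s T s' T' k n U' F"
proof (induction k arbitrary: n U U' F)
  case 0 then show ?case using continuous_map_from_subtopology_mono by auto
next
  case (Suc k)
  then obtain F1 where F1: "diff_quotient s T s' T' n U F F1"
    "Ck_on s T s' T' k (Suc n) (dq_domain s T n U) F1" by auto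
  have "diff_quotient s T s' T' n U' F F1"
    using F1(1) dq_domain_mono[OF Suc.prems(2), of s T n]
    unfolding diff_quotient_def by (meson continuous_map_from_subtopology_mono subsetD)
  with Suc.IH[OF F1(2) dq_domain_mono[OF Suc.prems(2)]] Suc.prems show ?case
    by (auto intro: continuous_map_from_subtopology_mono)
qed

text \<open>The difference quotient of $F \circ \pi$ is $F^{[1]}$ composed with the lift of $\pi$, and
  the lift is again linear. In particular pullback along the base point preserves $C^k$; products, inverse
  families and the chain rule need this special case before the chain rule is available.\<close>

lemma Ck_on_linear_comp:
  assumes "Ck_on s' T' s'' T'' k n' U F" "tower_linear s T n s' T' n' \<pi>"
    "U' \<subseteq> topspace (tower_top T n)" "\<pi> ` U' \<subseteq> U"
  shows "Ck_on s T s'' T'' k n U' (\<lambda>p. F (\<pi> p))"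
  using assms
proof (induction k arbitrary: n n' U U' F \<pi>)
  case 0
  have "continuous_map (subtopology (tower_top T n) U') (subtopology (tower_top T' n') U) \<pi>"
    using 0 by (auto simp: continuous_map_in_subtopology tower_linear_def continuous_map_from_subtopology)
  from continuous_map_compose[OF this] 0 show ?case by (simp add: o_def)
next
  case (Suc k)
  then obtain F1 where F1: "diff_quotient s' T' s'' T'' n' U F F1"
    "Ck_on s' T' s'' T'' k (Suc n') (dq_domain s' T' n' U) F1" by auto
  have "continuous_map (subtopology (tower_top T n) U') (subtopology (tower_top T' n') U) \<pi>"
    using Suc by (auto simp: continuous_map_in_subtopology tower_linear_def continuous_map_from_subtopology)
  from continuous_map_compose[OF this Ck_on_continuous[OF Suc.prems(1)]]
  have c: "continuous_map (subtopology (tower_top T n) U') T'' (\<lambda>p. F (\<pi> p))"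
    by (simp add: o_def)
  let ?\<pi> = "\<lambda>p. Inc (\<pi> (base p)) (\<pi> (dir p)) (par p)"
  have l: "\<pi> (tower_add x (tower_scale s t v)) = tower_add (\<pi> x) (tower_scale s' t (\<pi> v))"
    if "x \<in> U'" "v \<in> topspace (tower_top T n)" for x v t
    using Suc.prems that by (auto simp: tower_linear_def)
  have m: "\<pi> v \<in> topspace (tower_top T' n')" if "v \<in> topspace (tower_top T n)" for v
    using Suc.prems(2) that continuous_map_image_subset_topspace[of "tower_top T n" _ \<pi>]
    by (auto simp: tower_linear_def)
  have im: "?\<pi> ` dq_domain s T n U' \<subseteq> dq_domain s' T' n' U"
    using Suc.prems(4) l m by (fastforce simp: dq_domain_def)
  have Ck: "Ck_on s T s'' T'' k (Suc n) (dq_domain s T n U') (\<lambda>p. F1 (?\<pi> p))"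
    by (rule Suc.IH[OF F1(2) tower_linear_lift[OF Suc.prems(2)] dq_domain_subset[OF Suc.prems(3)] im])
  moreover have "diff_quotient s T s'' T'' n U' (\<lambda>p. F (\<pi> p)) (\<lambda>p. F1 (?\<pi> p))"
    unfolding diff_quotient_def
  proof (intro conjI allI impI)
    fix x v t assume i: "Inc x v t \<in> dq_domain s T n U'"
    have "?\<pi> (Inc x v t) \<in> dq_domain s' T' n' U"
      using im i by blast
    then show "F (\<pi> (tower_add x (tower_scale s t v))) - F (\<pi> x) = s'' t (F1 (?\<pi> (Inc x v t)))"
      using F1(1) i l by (simp add: diff_quotient_def)
  qed (rule Ck_on_continuous[OF Ck])
  ultimately show ?case using c by auto
qed

lemma Ck_on_linear:
  assumes "continuous_map (tower_top T n) T' F" "U \<subseteq> topspace (tower_top T n)"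
    "\<And>x v t. x \<in> topspace (tower_top T n) \<Longrightarrow> v \<in> topspace (tower_top T n) \<Longrightarrow>
        F (tower_add x (tower_scale s t v)) = F x + s' t (F v)"
  shows "Ck_on s T s' T' k n U F"
  using assms
proof (induction k arbitrary: n U F)
  case 0 then show ?case by (auto simp: continuous_map_from_subtopology)
next
  case (Suc k)
  have cd: "continuous_map (tower_top T (Suc n)) T' (\<lambda>p. F (dir p))"
    using continuous_map_compose[OF continuous_map_dir Suc.prems(1)] by (simp add: o_def)
  have "Ck_on s T s' T' k (Suc n) (dq_domain s T n U) (\<lambda>p. F (dir p))"
    by (rule Suc.IH[OF cd]) (use Suc.prems in \<open>auto simp: dq_domain_subset dest!: dq_domain_subset[THEN subsetD]\<close>)
  moreover have "diff_quotient s T s' T' n U F (\<lambda>p. F (dir p))"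
    using cd Suc.prems by (auto simp: diff_quotient_def continuous_map_from_subtopology subset_iff)
  ultimately show ?case using Suc.prems by (auto simp: continuous_map_from_subtopology)
qed

lemma Ck_on_par: "U \<subseteq> topspace (tower_top T (Suc n)) \<Longrightarrow> Ck_on s T (*) euclidean k (Suc n) U par"
  by (rule Ck_on_linear) (auto simp: continuous_map_par)

lemma Ck_on_const:
  assumes "module s'" "0 \<in> topspace T'" "c \<in> topspace T'" "U \<subseteq> topspace (tower_top T n)"
  shows "Ck_on s T s' T' k n U (\<lambda>_. c)"
proof -
  interpret module s' by fact
  have z: "Ck_on s T s' T' k n U (\<lambda>_. 0)" if "U \<subseteq> topspace (tower_top T n)" for k n U
    by (rule Ck_on_linear) (use that assms in auto)
  show ?thesis
  proof (cases k)
    case 0 then show ?thesis using assms by simp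
  next
    case (Suc l)
    have "Ck_on s T s' T' l (Suc n) (dq_domain s T n U) (\<lambda>_. 0)"
      by (rule z) (rule dq_domain_subset[OF assms(4)])
    then show ?thesis using Suc assms
      by (auto simp: diff_quotient_def intro!: exI[of _ "\<lambda>_. 0"])
  qed
qed

lemma Ck_on_add:
  assumes "continuous_module s' T'" "Ck_on s T s' T' k n U F" "Ck_on s T s' T' k n U G"
  shows "Ck_on s T s' T' k n U (\<lambda>p. F p + G p)"
  using assms(2,3)
proof (induction k arbitrary: n U F G)
  case 0 then show ?case using assms(1) by (simp add: continuous_map_add_module)
next
  case (Suc k)
  interpret module s' using assms(1) by (rule continuous_module_module)
  from Suc.prems obtain F1 G1 where F1: "diff_quotient s T s' T' n U F F1"
    "Ck_on s T s' T' k (Suc n) (dq_domain s T n U) F1"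
    and G1: "diff_quotient s T s' T' n U G G1"
    "Ck_on s T s' T' k (Suc n) (dq_domain s T n U) G1" by auto
  have 1: "Ck_on s T s' T' k (Suc n) (dq_domain s T n U) (\<lambda>p. F1 p + G1 p)"
    by (rule Suc.IH) fact+
  moreover have "diff_quotient s T s' T' n U (\<lambda>p. F p + G p) (\<lambda>p. F1 p + G1 p)"
    using F1(1) G1(1) Ck_on_continuous[OF 1]
    by (simp add: diff_quotient_def scale_right_distrib add_diff_add)
  moreover have "continuous_map (subtopology (tower_top T n) U) T' (\<lambda>p. F p + G p)"
    using assms(1) Suc.prems by (auto intro: continuous_map_add_module)
  ultimately show ?case by auto
qed

text \<open>The product rule $(rF)^{[1]} = r^{[1]} F + r F^{[1]} + t\, r^{[1]} F^{[1]}$: the last summand contains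
  the parameter $t$ as a factor, which is a product of lower degree of differentiability.\<close>

lemma Ck_on_smul:
  assumes "continuous_module s' T'" "Ck_on s T (*) euclidean k n U r" "Ck_on s T s' T' k n U F"
    "U \<subseteq> topspace (tower_top T n)"
  shows "Ck_on s T s' T' k n U (\<lambda>p. s' (r p) (F p))"
  using assms(2-)
proof (induction k arbitrary: n U F r)
  case 0 then show ?case using assms(1) by (simp add: continuous_map_scale_module)
next
  case (Suc k)
  interpret module s' using assms(1) by (rule continuous_module_module)
  let ?D = "dq_domain s T n U"
  have D: "?D \<subseteq> topspace (tower_top T (Suc n))" by (rule dq_domain_subset) fact
  from Suc.prems obtain F1 r1 where F1: "diff_quotient s T s' T' n U F F1"
    "Ck_on s T s' T' k (Suc n) ?D F1"
    and r1: "diff_quotient s T (*) euclidean n U r r1"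
    "Ck_on s T (*) euclidean k (Suc n) ?D r1" by auto
  have b: "base ` ?D \<subseteq> U" by (auto simp: dq_domain_def)
  have Fb: "Ck_on s T s' T' k (Suc n) ?D (\<lambda>p. F (base p))"
    by (rule Ck_on_linear_comp[OF _ tower_linear_base D b]) (rule Ck_on_mono_Suc, fact)
  have rb: "Ck_on s T (*) euclidean k (Suc n) ?D (\<lambda>p. r (base p))"
    by (rule Ck_on_linear_comp[OF _ tower_linear_base D b]) (rule Ck_on_mono_Suc, fact)
  let ?H = "\<lambda>p. (s' (r1 p) (F (base p)) + s' (r (base p)) (F1 p)) + s' (par p) (s' (r1 p) (F1 p))"
  have 1: "Ck_on s T s' T' k (Suc n) ?D ?H"
    by (intro Ck_on_add[OF assms(1)] Suc.IH F1 r1 Fb rb D Ck_on_par)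
  have "s' (r (tower_add x (tower_scale s t v))) (F (tower_add x (tower_scale s t v))) - s' (r x) (F x)
     = s' t (?H (Inc x v t))" if "Inc x v t \<in> ?D" for x v t
  proof -
    have "F (tower_add x (tower_scale s t v)) = F x + s' t (F1 (Inc x v t))"
      using F1(1) that by (simp add: diff_quotient_def algebra_simps)
    moreover have "r (tower_add x (tower_scale s t v)) = r x + t * r1 (Inc x v t)"
      using r1(1) that by (simp add: diff_quotient_def algebra_simps)
    ultimately show ?thesis
      by (simp add: scale_right_distrib scale_left_distrib algebra_simps)
  qed
  then have "diff_quotient s T s' T' n U (\<lambda>p. s' (r p) (F p)) ?H"
    using Ck_on_continuous[OF 1] by (simp add: diff_quotient_def)
  moreover have "continuous_map (subtopology (tower_top T n) U) T' (\<lambda>p. s' (r p) (F p))"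
    using assms(1) Suc.prems by (auto intro: continuous_map_scale_module)
  ultimately show ?case using 1 by auto
qed

lemma Ck_on_scale:
  assumes "continuous_module s' T'" "Ck_on s T s' T' k n U F" "U \<subseteq> topspace (tower_top T n)"
  shows "Ck_on s T s' T' k n U (\<lambda>p. s' c (F p))"
proof -
  have "module ((*) :: 'a \<Rightarrow> 'a \<Rightarrow> 'a)" by unfold_locales (auto simp: algebra_simps)
  then show ?thesis
    using Ck_on_const[of "(*)" euclidean c U T n s k] assms by (intro Ck_on_smul) auto
qed

lemma Ck_on_diff:
  assumes "continuous_module s' T'" "Ck_on s T s' T' k n U F" "Ck_on s T s' T' k n U G" "U \<subseteq> topspace (tower_top T n)"
  shows "Ck_on s T s' T' k n U (\<lambda>p. F p - G p)"
proof -
  interpret module s' using assms(1) by (rule continuous_module_module)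
  show ?thesis
    using Ck_on_add[OF assms(1,2) Ck_on_scale[OF assms(1,3,4), of "-1"]] by simp
qed

text \<open>The difference of $\tau(F,G,H)$ at two points telescopes into three terms, in each of which one
  factor is a difference quotient and the factors to its right are taken at the displaced point
  $x + t v$, where $G$ equals $G + t G^{[1]}$. The Jordan triple product is the only continuous multilinear
  operation at hand, hence the three arguments.\<close>

lemma Ck_on_trilinear:
  fixes \<tau> :: "'a::ab_group_add \<Rightarrow> 'b::ab_group_add \<Rightarrow> 'c::ab_group_add \<Rightarrow> 'd::ab_group_add"
  assumes mods: "continuous_module s1 T1" "continuous_module s2 T2" "continuous_module s3 T3" "continuous_module s' T'"
    and cont: "continuous_map (prod_topology T1 (prod_topology T2 T3)) T' (\<lambda>(x, y, z). \<tau> x y z)"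
    and lin1: "\<And>x x' t y z. \<tau> (x + s1 t x') y z = \<tau> x y z + s' t (\<tau> x' y z)"
    and lin2: "\<And>x y y' t z. \<tau> x (y + s2 t y') z = \<tau> x y z + s' t (\<tau> x y' z)"
    and lin3: "\<And>x y z z' t. \<tau> x y (z + s3 t z') = \<tau> x y z + s' t (\<tau> x y z')"
    and F: "Ck_on s T s1 T1 k n U F" and G: "Ck_on s T s2 T2 k n U G" and H: "Ck_on s T s3 T3 k n U H"
    and U: "U \<subseteq> topspace (tower_top T n)"
  shows "Ck_on s T s' T' k n U (\<lambda>p. \<tau> (F p) (G p) (H p))"
proof -
  have c: "continuous_map X T' (\<lambda>p. \<tau> (F p) (G p) (H p))"
    if "continuous_map X T1 F" "continuous_map X T2 G" "continuous_map X T3 H" for X F G H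
  proof -
    have "continuous_map X (prod_topology T1 (prod_topology T2 T3)) (\<lambda>p. (F p, G p, H p))"
      using that by (simp add: continuous_map_pairedI)
    from continuous_map_compose[OF this cont] show ?thesis by (simp add: o_def)
  qed
  show ?thesis using F G H U
  proof (induction k arbitrary: n U F G H)
    case 0 then show ?case by (simp add: c)
  next
    case (Suc k)
    interpret module s' using mods(4) by (rule continuous_module_module)
    let ?D = "dq_domain s T n U"
    have D: "?D \<subseteq> topspace (tower_top T (Suc n))" by (rule dq_domain_subset) fact
    from Suc.prems obtain F1 G1 H1 where F1: "diff_quotient s T s1 T1 n U F F1" "Ck_on s T s1 T1 k (Suc n) ?D F1"
      and G1: "diff_quotient s T s2 T2 n U G G1" "Ck_on s T s2 T2 k (Suc n) ?D G1"
      and H1: "diff_quotient s T s3 T3 n U H H1" "Ck_on s T s3 T3 k (Suc n) ?D H1" by auto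
    have b: "base ` ?D \<subseteq> U" by (auto simp: dq_domain_def)
    have Fb: "Ck_on s T s1 T1 k (Suc n) ?D (\<lambda>p. F (base p))"
      and Gb: "Ck_on s T s2 T2 k (Suc n) ?D (\<lambda>p. G (base p))"
      and Hb: "Ck_on s T s3 T3 k (Suc n) ?D (\<lambda>p. H (base p))"
      by (rule Ck_on_linear_comp[OF _ tower_linear_base D b], rule Ck_on_mono_Suc, fact)+
    let ?G = "\<lambda>p. G (base p) + s2 (par p) (G1 p)" and ?H = "\<lambda>p. H (base p) + s3 (par p) (H1 p)"
    let ?Q = "\<lambda>p. (\<tau> (F1 p) (?G p) (?H p) + \<tau> (F (base p)) (G1 p) (?H p)) + \<tau> (F (base p)) (G (base p)) (H1 p)"
    have G': "Ck_on s T s2 T2 k (Suc n) ?D ?G"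
      by (intro Ck_on_add[OF mods(2)] Ck_on_smul[OF mods(2)] Gb G1 D Ck_on_par)
    have H': "Ck_on s T s3 T3 k (Suc n) ?D ?H"
      by (intro Ck_on_add[OF mods(3)] Ck_on_smul[OF mods(3)] Hb H1 D Ck_on_par)
    have 1: "Ck_on s T s' T' k (Suc n) ?D ?Q"
      by (intro Ck_on_add[OF mods(4)] Suc.IH F1 G1 H1 Fb Gb Hb D G' H')
    have "\<tau> (F (tower_add x (tower_scale s t v))) (G (tower_add x (tower_scale s t v)))
            (H (tower_add x (tower_scale s t v))) - \<tau> (F x) (G x) (H x)
       = s' t (?Q (Inc x v t))" if "Inc x v t \<in> ?D" for x v t
    proof -
      have f: "F (tower_add x (tower_scale s t v)) = F x + s1 t (F1 (Inc x v t))"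
        using F1(1) that by (simp add: diff_quotient_def algebra_simps)
      have g: "G (tower_add x (tower_scale s t v)) = G x + s2 t (G1 (Inc x v t))"
        using G1(1) that by (simp add: diff_quotient_def algebra_simps)
      have h: "H (tower_add x (tower_scale s t v)) = H x + s3 t (H1 (Inc x v t))"
        using H1(1) that by (simp add: diff_quotient_def algebra_simps)
      show ?thesis unfolding f g h
        by (simp add: lin1 lin2 lin3 scale_right_distrib)
    qed
    then have "diff_quotient s T s' T' n U (\<lambda>p. \<tau> (F p) (G p) (H p)) ?Q"
      using Ck_on_continuous[OF 1] by (simp add: diff_quotient_def)
    moreover have "continuous_map (subtopology (tower_top T n) U) T' (\<lambda>p. \<tau> (F p) (G p) (H p))"
      using Suc.prems by (auto intro: c)
    ultimately show ?case using 1 by auto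
  qed
qed

lemma Ck_on_pair:
  assumes "module s1" "module s2" "Ck_on s T s1 T1 k n U F" "Ck_on s T s2 T2 k n U G"
  shows "Ck_on s T (module_prod.scale s1 s2) (prod_topology T1 T2) k n U (\<lambda>p. (F p, G p))"
  using assms(3,4)
proof (induction k arbitrary: n U F G)
  case 0 then show ?case by (simp add: continuous_map_pairedI)
next
  case (Suc k)
  from Suc.prems obtain F1 G1 where F1: "diff_quotient s T s1 T1 n U F F1"
    "Ck_on s T s1 T1 k (Suc n) (dq_domain s T n U) F1"
    and G1: "diff_quotient s T s2 T2 n U G G1"
    "Ck_on s T s2 T2 k (Suc n) (dq_domain s T n U) G1" by auto
  have 1: "Ck_on s T (module_prod.scale s1 s2) (prod_topology T1 T2) k (Suc n) (dq_domain s T n U) (\<lambda>p. (F1 p, G1 p))"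
    by (rule Suc.IH) fact+
  moreover have "diff_quotient s T (module_prod.scale s1 s2) (prod_topology T1 T2) n U (\<lambda>p. (F p, G p)) (\<lambda>p. (F1 p, G1 p))"
    using F1(1) G1(1) Ck_on_continuous[OF 1] assms(1,2)
    by (simp add: diff_quotient_def module_prod_scale minus_prod_def)
  moreover have "continuous_map (subtopology (tower_top T n) U) (prod_topology T1 T2) (\<lambda>p. (F p, G p))"
    using Suc.prems by (auto intro: continuous_map_pairedI)
  ultimately show ?case by auto
qed

section \<open>The chain rule\<close>

text \<open>Tower-valued maps are differentiated by components: a point of level $m$ consists of points of the
  module and of scalars.\<close>

primrec Ck_on_tower ::
  "('k::{comm_ring_1, topological_space} \<Rightarrow> 'e::ab_group_add \<Rightarrow> 'e) \<Rightarrow> 'e topology \<Rightarrow>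
   ('k \<Rightarrow> 'f::ab_group_add \<Rightarrow> 'f) \<Rightarrow> 'f topology \<Rightarrow> nat \<Rightarrow>
     nat \<Rightarrow> ('k, 'e) tower set \<Rightarrow> nat \<Rightarrow> (('k, 'e) tower \<Rightarrow> ('k, 'f) tower) \<Rightarrow> bool" where
  "Ck_on_tower s T s' T' k n U 0 \<Phi> \<longleftrightarrow>
     (\<forall>p \<in> U. \<Phi> p = Pt (un_Pt (\<Phi> p))) \<and> Ck_on s T s' T' k n U (\<lambda>p. un_Pt (\<Phi> p))"
| "Ck_on_tower s T s' T' k n U (Suc m) \<Phi> \<longleftrightarrow>
     (\<forall>p \<in> U. \<Phi> p = Inc (base (\<Phi> p)) (dir (\<Phi> p)) (par (\<Phi> p))) \<and>
     Ck_on_tower s T s' T' k n U m (\<lambda>p. base (\<Phi> p)) \<and>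
     Ck_on_tower s T s' T' k n U m (\<lambda>p. dir (\<Phi> p)) \<and>
     Ck_on s T (*) euclidean k n U (\<lambda>p. par (\<Phi> p))"

lemma Ck_on_tower_continuous:
  "Ck_on_tower s T s' T' k n U m \<Phi> \<Longrightarrow>
     continuous_map (subtopology (tower_top T n) U) (tower_top T' m) \<Phi>"
  by (induction m arbitrary: \<Phi>)
    (auto simp: continuous_map_tower_0 continuous_map_tower_Suc dest: Ck_on_continuous)

lemma Ck_on_tower_mem:
  assumes "Ck_on_tower s T s' T' k n U m \<Phi>" "U \<subseteq> topspace (tower_top T n)" "p \<in> U"
  shows "\<Phi> p \<in> topspace (tower_top T' m)"
  using continuous_map_image_subset_topspace[OF Ck_on_tower_continuous[OF assms(1)]] assms(2,3)
  by (auto simp: image_subset_iff)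

lemma Ck_on_tower_mono_Suc:
  "Ck_on_tower s T s' T' (Suc k) n U m \<Phi> \<Longrightarrow> Ck_on_tower s T s' T' k n U m \<Phi>"
  by (induction m arbitrary: \<Phi>) (auto simp del: Ck_on.simps dest: Ck_on_mono_Suc)

lemma Ck_on_tower_linear_comp:
  assumes "Ck_on_tower s' T' s'' T'' k n' U m \<Phi>" "tower_linear s T n s' T' n' \<pi>"
    "U' \<subseteq> topspace (tower_top T n)" "\<pi> ` U' \<subseteq> U"
  shows "Ck_on_tower s T s'' T'' k n U' m (\<lambda>p. \<Phi> (\<pi> p))"
  using assms
  by (induction m arbitrary: \<Phi>) (auto simp: image_subset_iff intro: Ck_on_linear_comp)

lemma Ck_on_tower_diff_quotient:
  assumes "Ck_on_tower s T s' T' (Suc k) n U m \<Phi>"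
  obtains \<Phi>1 where "Ck_on_tower s T s' T' k (Suc n) (dq_domain s T n U) m \<Phi>1"
    "\<And>x v t. Inc x v t \<in> dq_domain s T n U \<Longrightarrow>
       \<Phi> (tower_add x (tower_scale s t v)) = tower_add (\<Phi> x) (tower_scale s' t (\<Phi>1 (Inc x v t)))"
  using assms
proof (induction m arbitrary: \<Phi> thesis)
  case 0
  then obtain F1 where F1: "diff_quotient s T s' T' n U (\<lambda>p. un_Pt (\<Phi> p)) F1"
    "Ck_on s T s' T' k (Suc n) (dq_domain s T n U) F1" by auto
  show ?case
  proof (rule 0(1)[of "\<lambda>p. Pt (F1 p)"])
    show "Ck_on_tower s T s' T' k (Suc n) (dq_domain s T n U) 0 (\<lambda>p. Pt (F1 p))"
      using F1 by simp
    fix x v t assume i: "Inc x v t \<in> dq_domain s T n U"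
    then have "un_Pt (\<Phi> (tower_add x (tower_scale s t v))) = un_Pt (\<Phi> x) + s' t (F1 (Inc x v t))"
      using F1(1) by (simp add: diff_quotient_def algebra_simps)
    then show "\<Phi> (tower_add x (tower_scale s t v)) = tower_add (\<Phi> x) (tower_scale s' t (Pt (F1 (Inc x v t))))"
      using 0(2) i by (metis Ck_on_tower.simps(1) Inc_in_dq_domain tower_add.simps(1) tower_scale.simps(1))
  qed
next
  case (Suc m)
  let ?D = "dq_domain s T n U"
  obtain B1 where B1: "Ck_on_tower s T s' T' k (Suc n) ?D m B1"
    "\<And>x v t. Inc x v t \<in> ?D \<Longrightarrow> base (\<Phi> (tower_add x (tower_scale s t v)))
        = tower_add (base (\<Phi> x)) (tower_scale s' t (B1 (Inc x v t)))"
    using Suc.IH[of "\<lambda>p. base (\<Phi> p)"] Suc.prems(2) by auto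
  obtain D1 where D1: "Ck_on_tower s T s' T' k (Suc n) ?D m D1"
    "\<And>x v t. Inc x v t \<in> ?D \<Longrightarrow> dir (\<Phi> (tower_add x (tower_scale s t v)))
        = tower_add (dir (\<Phi> x)) (tower_scale s' t (D1 (Inc x v t)))"
    using Suc.IH[of "\<lambda>p. dir (\<Phi> p)"] Suc.prems(2) by auto
  obtain P1 where P1: "diff_quotient s T (*) euclidean n U (\<lambda>p. par (\<Phi> p)) P1"
    "Ck_on s T (*) euclidean k (Suc n) ?D P1" using Suc.prems(2) by auto
  show ?case
  proof (rule Suc.prems(1)[of "\<lambda>p. Inc (B1 p) (D1 p) (P1 p)"])
    show "Ck_on_tower s T s' T' k (Suc n) ?D (Suc m) (\<lambda>p. Inc (B1 p) (D1 p) (P1 p))"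
      using B1 D1 P1 by simp
    fix x v t assume i: "Inc x v t \<in> ?D"
    let ?y = "tower_add x (tower_scale s t v)"
    have "par (\<Phi> ?y) = par (\<Phi> x) + t * P1 (Inc x v t)"
      using P1(1) i by (simp add: diff_quotient_def algebra_simps)
    moreover have "\<Phi> ?y = Inc (base (\<Phi> ?y)) (dir (\<Phi> ?y)) (par (\<Phi> ?y))"
      "\<Phi> x = Inc (base (\<Phi> x)) (dir (\<Phi> x)) (par (\<Phi> x))"
      using Suc.prems(2) i by (auto simp: dq_domain_def)
    ultimately show "\<Phi> ?y = tower_add (\<Phi> x) (tower_scale s' t (Inc (B1 (Inc x v t)) (D1 (Inc x v t)) (P1 (Inc x v t))))"
      using B1(2)[OF i] D1(2)[OF i] by (metis tower_add.simps(2) tower_scale.simps(2))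
  qed
qed

text \<open>$(F \circ \Phi)^{[1]} = F^{[1]} \circ \Phi^{[1]}$ with
  $\Phi^{[1]}(x,v,t) = (\Phi(x), \Phi_1(x,v,t), t)$, and $\Phi^{[1]}$ is of class $C^{k-1}$ with values in the
  next level. Here the levels of the tower are needed even for maps of the modules themselves.\<close>

lemma Ck_on_chain:
  assumes "Ck_on_tower s T s' T' k n U m \<Phi>" "Ck_on s' T' s'' T'' k m W F"
    "U \<subseteq> topspace (tower_top T n)" "\<Phi> ` U \<subseteq> W"
  shows "Ck_on s T s'' T'' k n U (\<lambda>p. F (\<Phi> p))"
  using assms
proof (induction k arbitrary: n m U W F \<Phi>)
  case 0
  have "continuous_map (subtopology (tower_top T n) U) (subtopology (tower_top T' m) W) \<Phi>"
    using 0 by (auto simp: continuous_map_in_subtopology dest: Ck_on_tower_continuous)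
  from continuous_map_compose[OF this] 0 show ?case by (simp add: o_def)
next
  case (Suc k)
  let ?D = "dq_domain s T n U"
  have D: "?D \<subseteq> topspace (tower_top T (Suc n))" by (rule dq_domain_subset) fact
  have "continuous_map (subtopology (tower_top T n) U) (subtopology (tower_top T' m) W) \<Phi>"
    using Suc.prems(1,4) by (auto simp: continuous_map_in_subtopology dest: Ck_on_tower_continuous)
  from continuous_map_compose[OF this Ck_on_continuous[OF Suc.prems(2)]]
  have c: "continuous_map (subtopology (tower_top T n) U) T'' (\<lambda>p. F (\<Phi> p))" by (simp add: o_def)
  obtain F1 where F1: "diff_quotient s' T' s'' T'' m W F F1"
    "Ck_on s' T' s'' T'' k (Suc m) (dq_domain s' T' m W) F1" using Suc.prems by auto
  obtain \<Phi>1 where \<Phi>1: "Ck_on_tower s T s' T' k (Suc n) ?D m \<Phi>1"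
    "\<And>x v t. Inc x v t \<in> ?D \<Longrightarrow>
       \<Phi> (tower_add x (tower_scale s t v)) = tower_add (\<Phi> x) (tower_scale s' t (\<Phi>1 (Inc x v t)))"
    using Ck_on_tower_diff_quotient[OF Suc.prems(1)] by blast
  \<comment> \<open>The extension of the inner map to the next level.\<close>
  let ?\<Psi> = "\<lambda>p. Inc (\<Phi> (base p)) (\<Phi>1 p) (par p)"
  have b: "base ` ?D \<subseteq> U" by (auto simp: dq_domain_def)
  have 1: "Ck_on_tower s T s' T' k (Suc n) ?D (Suc m) ?\<Psi>"
    using Ck_on_tower_linear_comp[OF Ck_on_tower_mono_Suc[OF Suc.prems(1)] tower_linear_base D b] \<Phi>1(1)
      Ck_on_par[OF D] by simp
  have im: "?\<Psi> ` ?D \<subseteq> dq_domain s' T' m W"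
  proof
    fix q assume "q \<in> ?\<Psi> ` ?D"
    then obtain x v t where i: "Inc x v t \<in> ?D" and q: "q = ?\<Psi> (Inc x v t)"
      by (auto simp: dq_domain_def)
    have "\<Phi> x \<in> W" "\<Phi> (tower_add x (tower_scale s t v)) \<in> W"
      using i Suc.prems(4) by auto
    then show "q \<in> dq_domain s' T' m W"
      using q Ck_on_tower_mem[OF \<Phi>1(1) D i] \<Phi>1(2)[OF i] by simp
  qed
  have 2: "Ck_on s T s'' T'' k (Suc n) ?D (\<lambda>p. F1 (?\<Psi> p))"
    by (rule Suc.IH[OF 1 F1(2) D im])
  moreover have "diff_quotient s T s'' T'' n U (\<lambda>p. F (\<Phi> p)) (\<lambda>p. F1 (?\<Psi> p))"
    unfolding diff_quotient_def
  proof (intro conjI allI impI)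
    fix x v t assume i: "Inc x v t \<in> ?D"
    have "?\<Psi> (Inc x v t) \<in> dq_domain s' T' m W"
      using im i by blast
    then show "F (\<Phi> (tower_add x (tower_scale s t v))) - F (\<Phi> x) = s'' t (F1 (?\<Psi> (Inc x v t)))"
      using F1(1) \<Phi>1(2)[OF i] by (simp add: diff_quotient_def)
  qed (rule Ck_on_continuous[OF 2])
  ultimately show ?case using c by auto
qed

section \<open>Smooth maps between modules\<close>

definition Cinf_on ::
  "('k::{comm_ring_1, topological_space} \<Rightarrow> 'e::ab_group_add \<Rightarrow> 'e) \<Rightarrow> 'e topology \<Rightarrow>
   ('k \<Rightarrow> 'f::ab_group_add \<Rightarrow> 'f) \<Rightarrow> 'f topology \<Rightarrow> 'e set \<Rightarrow> ('e \<Rightarrow> 'f) \<Rightarrow> bool" where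
  "Cinf_on s T s' T' U f \<longleftrightarrow> U \<subseteq> topspace T \<and> (\<forall>k. Ck_on s T s' T' k 0 (Pt ` U) (\<lambda>p. f (un_Pt p)))"

lemma Cinf_on_smooth_on: "Cinf_on s T s' T' U f \<Longrightarrow> openin T U \<Longrightarrow> smooth_on s T s' T' U f"
  by (auto simp: Cinf_on_def smooth_on_def o_def intro: Ck_on_Ck_level)

lemma Cinf_on_cong: "Cinf_on s T s' T' U f \<Longrightarrow> (\<And>x. x \<in> U \<Longrightarrow> f x = g x) \<Longrightarrow> Cinf_on s T s' T' U g"
  unfolding Cinf_on_def by (auto intro: Ck_on_cong)

lemma continuous_map_Pt:
  "U \<subseteq> topspace T \<Longrightarrow> continuous_map (subtopology T U) (subtopology (tower_top T 0) (Pt ` U)) Pt"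
  by (auto simp: continuous_map_in_subtopology continuous_map_tower_0 continuous_map_from_subtopology)

lemma continuous_map_un_Pt_on:
  "continuous_map (subtopology (tower_top T 0) (Pt ` U)) (subtopology T U) un_Pt"
  by (auto simp: continuous_map_in_subtopology intro: continuous_map_from_subtopology continuous_map_un_Pt)

lemma Cinf_on_continuous: 
  assumes "Cinf_on s T s' T' U f"
  shows "continuous_map (subtopology T U) T' f"
proof -
  have "Ck_on s T s' T' 0 0 (Pt ` U) (\<lambda>p. f (un_Pt p))" and U: "U \<subseteq> topspace T"
    using assms by (simp_all add: Cinf_on_def del: Ck_on.simps)
  then show ?thesis
    using continuous_map_compose[OF continuous_map_Pt[OF U], of T' "\<lambda>p. f (un_Pt p)"]
    by (simp add: o_def)
qed

lemma Cinf_on_mem: "Cinf_on s T s' T' U f \<Longrightarrow> x \<in> U \<Longrightarrow> f x \<in> topspace T'"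
  using continuous_map_image_subset_topspace[OF Cinf_on_continuous, of s T s' T' U f]
  by (auto simp: Cinf_on_def image_subset_iff)

lemma Cinf_on_subset: "Cinf_on s T s' T' U f \<Longrightarrow> U' \<subseteq> U \<Longrightarrow> Cinf_on s T s' T' U' f"
  unfolding Cinf_on_def by (meson Ck_on_subset image_mono subset_trans)

lemma Cinf_on_linear:
  assumes "continuous_map T T' f" "U \<subseteq> topspace T" "\<And>x v t. f (x + s t v) = f x + s' t (f v)"
  shows "Cinf_on s T s' T' U f"
  unfolding Cinf_on_def
  using assms continuous_map_compose[OF continuous_map_un_Pt assms(1)]
  by (auto intro!: Ck_on_linear simp: o_def)

lemma Cinf_on_const:
  assumes "continuous_module s' T'" "c \<in> topspace T'" "U \<subseteq> topspace T"
  shows "Cinf_on s T s' T' U (\<lambda>_. c)"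
  using assms continuous_module_mem(1)[OF assms(1)] by (auto simp: Cinf_on_def intro!: Ck_on_const continuous_module_module)

lemma Pt_subset: "U \<subseteq> topspace T \<Longrightarrow> Pt ` U \<subseteq> topspace (tower_top T 0)"
  by auto

lemma Cinf_on_add:
  assumes "continuous_module s' T'" "Cinf_on s T s' T' U f" "Cinf_on s T s' T' U g"
  shows "Cinf_on s T s' T' U (\<lambda>x. f x + g x)"
  using assms by (auto simp: Cinf_on_def intro: Ck_on_add)

lemma Cinf_on_diff:
  assumes "continuous_module s' T'" "Cinf_on s T s' T' U f" "Cinf_on s T s' T' U g"
  shows "Cinf_on s T s' T' U (\<lambda>x. f x - g x)"
  using assms Pt_subset by (auto simp: Cinf_on_def intro!: Ck_on_diff)

lemma Cinf_on_scale:
  assumes "continuous_module s' T'" "Cinf_on s T s' T' U f"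
  shows "Cinf_on s T s' T' U (\<lambda>x. s' c (f x))"
  using assms Pt_subset by (auto simp: Cinf_on_def intro!: Ck_on_scale)

lemma Cinf_on_pair:
  assumes "continuous_module s1 T1" "continuous_module s2 T2" "Cinf_on s T s1 T1 U f" "Cinf_on s T s2 T2 U g"
  shows "Cinf_on s T (module_prod.scale s1 s2) (prod_topology T1 T2) U (\<lambda>x. (f x, g x))"
  using assms by (auto simp: Cinf_on_def intro!: Ck_on_pair continuous_module_module)

lemma Cinf_on_compose:
  assumes "Cinf_on s T s' T' U f" "Cinf_on s' T' s'' T'' W g" "f ` U \<subseteq> W"
  shows "Cinf_on s T s'' T'' U (\<lambda>x. g (f x))"
  unfolding Cinf_on_def
proof (intro conjI allI)
  show "U \<subseteq> topspace T" using assms(1) by (simp add: Cinf_on_def)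
  fix k
  have f: "Ck_on_tower s T s' T' k 0 (Pt ` U) 0 (\<lambda>p. Pt (f (un_Pt p)))"
    using assms(1) by (simp add: Cinf_on_def)
  have g: "Ck_on s' T' s'' T'' k 0 (Pt ` W) (\<lambda>p. g (un_Pt p))"
    using assms(2) by (simp add: Cinf_on_def)
  show "Ck_on s T s'' T'' k 0 (Pt ` U) (\<lambda>p. g (f (un_Pt p)))"
    using Ck_on_chain[OF f g] assms by (auto simp: Cinf_on_def image_subset_iff)
qed

text \<open>Put $S_y = D_y^{-1}$. From
  $D_{y+tv}(S_y u) = u + t\, D^{[1]}((y, S_y u), (v, 0), t)$ it follows that
  $$S_{y+tv}(u + tw) - S_y u = t\, S_{y+tv}(w - D^{[1]}((y, S_y u), (v, 0), t)).$$
  So $S^{[1]}$ is composed of $S$ and $D^{[1]}$, and if $S$ is $C^k$, then so is $S^{[1]}$. Continuity of $S$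
  starts the induction. No topology on the endomorphisms of the module is involved.\<close>

lemma Cinf_on_solve:
  fixes s :: "'k::{comm_ring_1, topological_space} \<Rightarrow> 'e::ab_group_add \<Rightarrow> 'e"
    and s' :: "'k \<Rightarrow> 'f::ab_group_add \<Rightarrow> 'f"
  assumes E: "continuous_module s T" and V: "continuous_module s' T'" and \<Omega>: "\<Omega> \<subseteq> topspace T"
    and D: "Cinf_on (module_prod.scale s s') (prod_topology T T') s' T' (\<Omega> \<times> topspace T') (\<lambda>(y, u). D y u)"
    and lin: "\<And>y. y \<in> \<Omega> \<Longrightarrow> D y \<in> End_on s' (topspace T')"
    and S: "continuous_map (subtopology (prod_topology T T') (\<Omega> \<times> topspace T')) T' (\<lambda>(y, u). S y u)"
    and inv: "\<And>y u. y \<in> \<Omega> \<Longrightarrow> u \<in> topspace T' \<Longrightarrow> S y (D y u) = u \<and> D y (S y u) = u"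
  shows "Cinf_on (module_prod.scale s s') (prod_topology T T') s' T' (\<Omega> \<times> topspace T') (\<lambda>(y, u). S y u)"
proof -
  let ?s = "module_prod.scale s s'" and ?T = "prod_topology T T'" and ?V = "topspace T'"
  let ?O = "Pt ` (\<Omega> \<times> ?V) :: ('k, 'e \<times> 'f) tower set"
  let ?D = "dq_domain ?s ?T 0 ?O"
  let ?S = "\<lambda>p. (\<lambda>(y, u). S y u) (un_Pt p)"
  have ET: "continuous_module ?s ?T" by (rule continuous_module_prod[OF E V])
  interpret m: module s' using V by (rule continuous_module_module)
  note sc = module_prod_scale[OF continuous_module_module[OF E] continuous_module_module[OF V]]
  have O: "?O \<subseteq> topspace (tower_top ?T 0)" using \<Omega> by auto
  have Dsub: "?D \<subseteq> topspace (tower_top ?T (Suc 0))" by (rule dq_domain_subset[OF O])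
  have SV: "S y u \<in> ?V" if "y \<in> \<Omega>" "u \<in> ?V" for y u
    using continuous_map_image_subset_topspace[OF S] that \<Omega> by (fastforce simp: image_subset_iff)
  have DV: "D y u \<in> ?V" if "y \<in> \<Omega>" "u \<in> ?V" for y u
    using lin[OF that(1)] that(2) by (auto simp: End_on_def)
  have Slin: "S y (u + s' t w) = S y u + s' t (S y w)" if "y \<in> \<Omega>" "u \<in> ?V" "w \<in> ?V" for y u w t
  proof -
    have "D y (S y u + s' t (S y w)) = D y (S y u) + s' t (D y (S y w))"
      using lin[OF that(1)] SV that continuous_module_mem[OF V] by (simp add: End_on_def)
    also have "\<dots> = u + s' t w" using inv that by simp
    finally show ?thesis using inv[OF that(1), of "S y u + s' t (S y w)"] SV that continuous_module_mem[OF V] by simp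
  qed
  have Cc: "continuous_map (subtopology (tower_top ?T 0) ?O) T' ?S"
    using continuous_map_compose[OF continuous_map_un_Pt_on S] by (simp add: o_def)
  have "Ck_on ?s ?T s' T' k 0 ?O ?S" for k
  proof (induction k)
    case 0 show ?case using Cc by simp
  next
    case (Suc k)
    have "Ck_on ?s ?T s' T' (Suc k) 0 ?O (\<lambda>p. (\<lambda>(y, u). D y u) (un_Pt p))"
      using D by (auto simp: Cinf_on_def simp del: Ck_on.simps)
    then obtain D1 where D1: "diff_quotient ?s ?T s' T' 0 ?O (\<lambda>p. (\<lambda>(y, u). D y u) (un_Pt p)) D1"
      "Ck_on ?s ?T s' T' k (Suc 0) ?D D1" by auto
    let ?\<Psi> = "\<lambda>p. Inc (Pt (fst (un_Pt (base p)), ?S (base p))) (Pt (fst (un_Pt (dir p)), 0)) (par p)"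
    \<comment> \<open>The quotient is S after (y + t v, w - D1 (y, S y u) (v, 0) t), written on tower points.\<close>
    let ?y = "\<lambda>p. fst (un_Pt (base p)) + s (par p) (fst (un_Pt (dir p)))"
    let ?w = "\<lambda>p. snd (un_Pt (dir p)) - D1 (?\<Psi> p)"
    have cE: "continuous_map (tower_top ?T 0) T (\<lambda>p. fst (un_Pt p))"
      "continuous_map (tower_top ?T 0) T' (\<lambda>p. snd (un_Pt p))"
      by (rule continuous_map_component_of[OF continuous_map_un_Pt])+
    have l1: "Ck_on ?s ?T s T k (Suc 0) ?D (\<lambda>p. fst (un_Pt (base p)))"
      using continuous_map_compose[OF continuous_map_base cE(1)]
      by (intro Ck_on_linear Dsub) (auto simp: o_def sc)
    have l2: "Ck_on ?s ?T s T k (Suc 0) ?D (\<lambda>p. fst (un_Pt (dir p)))"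
      using continuous_map_compose[OF continuous_map_dir cE(1)]
      by (intro Ck_on_linear Dsub) (auto simp: o_def sc)
    have l3: "Ck_on ?s ?T s' T' k (Suc 0) ?D (\<lambda>p. snd (un_Pt (dir p)))"
      using continuous_map_compose[OF continuous_map_dir cE(2)]
      by (intro Ck_on_linear Dsub) (auto simp: o_def sc)
    have b: "base ` ?D \<subseteq> ?O" by (auto simp: dq_domain_def)
    have Sb: "Ck_on ?s ?T s' T' k (Suc 0) ?D (\<lambda>p. ?S (base p))"
      by (rule Ck_on_linear_comp[OF Suc.IH tower_linear_base Dsub b])
    have par: "Ck_on ?s ?T (*) euclidean k (Suc 0) ?D par" by (rule Ck_on_par[OF Dsub])
    have z: "Ck_on ?s ?T s' T' k (Suc 0) ?D (\<lambda>_. 0)"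
      by (rule Ck_on_const[OF continuous_module_module[OF V] continuous_module_mem(1)[OF V] continuous_module_mem(1)[OF V] Dsub])
    have \<Psi>: "Ck_on_tower ?s ?T ?s ?T k (Suc 0) ?D (Suc 0) ?\<Psi>"
      using Ck_on_pair[OF continuous_module_module[OF E] continuous_module_module[OF V] l1 Sb]
        Ck_on_pair[OF continuous_module_module[OF E] continuous_module_module[OF V] l2 z] par by simp
    have elem: "\<exists>y u v w t. p = Inc (Pt (y, u)) (Pt (v, w)) t \<and> y \<in> \<Omega> \<and> u \<in> ?V \<and> v \<in> topspace T \<and> w \<in> ?V \<and>
        y + s t v \<in> \<Omega> \<and> u + s' t w \<in> ?V" if "p \<in> ?D" for p
      using that by (auto simp: dq_domain_def sc)
    have \<Psi>im: "?\<Psi> ` ?D \<subseteq> ?D"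
    proof
      fix q assume "q \<in> ?\<Psi> ` ?D"
      then obtain y u v w t where "q = ?\<Psi> (Inc (Pt (y, u)) (Pt (v, w)) t)" "y \<in> \<Omega>" "u \<in> ?V"
          "v \<in> topspace T" "y + s t v \<in> \<Omega>"
        using elem by fast
      then show "q \<in> ?D" using SV continuous_module_mem[OF V] by (auto simp: sc)
    qed
    have D\<Psi>: "Ck_on ?s ?T s' T' k (Suc 0) ?D (\<lambda>p. D1 (?\<Psi> p))"
      by (rule Ck_on_chain[OF \<Psi> D1(2) Dsub \<Psi>im])
    have D1V: "D1 (?\<Psi> p) \<in> ?V" if "p \<in> ?D" for p
      by (rule Ck_on_mem[OF D\<Psi> Dsub that])
    let ?\<Phi> = "\<lambda>p. Pt (?y p, ?w p) :: ('k, 'e \<times> 'f) tower"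
    have \<Phi>: "Ck_on_tower ?s ?T ?s ?T k (Suc 0) ?D 0 ?\<Phi>"
      using Ck_on_pair[OF continuous_module_module[OF E] continuous_module_module[OF V]
          Ck_on_add[OF E l1 Ck_on_smul[OF E par l2 Dsub]] Ck_on_diff[OF V l3 D\<Psi> Dsub]] by simp
    have \<Phi>im: "?\<Phi> ` ?D \<subseteq> ?O"
    proof
      fix q assume "q \<in> ?\<Phi> ` ?D"
      then obtain p where p: "q = ?\<Phi> p" "p \<in> ?D" by blast
      with elem[OF p(2)] D1V[OF p(2)] continuous_module_mem[OF V] show "q \<in> ?O" by fastforce
    qed
    have F: "Ck_on ?s ?T s' T' k (Suc 0) ?D (\<lambda>p. ?S (?\<Phi> p))"
      by (rule Ck_on_chain[OF \<Phi> Suc.IH Dsub \<Phi>im])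
    have "diff_quotient ?s ?T s' T' 0 ?O ?S (\<lambda>p. ?S (?\<Phi> p))"
      unfolding diff_quotient_def
    proof (intro conjI allI impI)
      fix x v t assume i: "Inc x v t \<in> ?D"
      from elem[OF i] obtain y u a w where x: "x = Pt (y, u)" "v = Pt (a, w)" and
        m: "y \<in> \<Omega>" "u \<in> ?V" "a \<in> topspace T" "w \<in> ?V" "y + s t a \<in> \<Omega>" "u + s' t w \<in> ?V" by blast
      let ?q = "Inc (Pt (y, S y u)) (Pt (a, 0)) t" and ?y' = "y + s t a"
      have q: "?q \<in> ?D" using m SV continuous_module_mem[OF V] by (auto simp: sc)
      have "D ?y' (S y u) - D y (S y u) = s' t (D1 ?q)"
        using D1(1)[unfolded diff_quotient_def, THEN conjunct2, rule_format, OF q] by (simp add: sc)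
      then have "D ?y' (S y u) = u + s' t (D1 ?q)" using inv[OF m(1,2)] by (simp add: algebra_simps)
      moreover have "D1 ?q \<in> ?V" using D1V[OF i] by (simp add: x)
      ultimately have 1: "S ?y' (u + s' t (D1 ?q)) = S y u" 
        using inv[OF m(5)] SV[OF m(1,2)] by metis
      have "S ?y' (u + s' t w) = S ?y' ((u + s' t (D1 ?q)) + s' t (w - D1 ?q))"
        by (simp add: m.scale_right_diff_distrib)
      also have "\<dots> = S ?y' (u + s' t (D1 ?q)) + s' t (S ?y' (w - D1 ?q))"
        by (rule Slin[OF m(5)]) (use m continuous_module_mem[OF V] \<open>D1 ?q \<in> ?V\<close> in auto)
      finally show "?S (tower_add x (tower_scale ?s t v)) - ?S x = s' t (?S (?\<Phi> (Inc x v t)))"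
        using 1 by (simp add: x sc)
    qed (rule Ck_on_continuous[OF F])
    then show ?case using Cc F by auto
  qed
  then show ?thesis using \<Omega> by (auto simp: Cinf_on_def)
qed

section \<open>Three-graded Lie algebras\<close>

lemma ring_inv_unit:
  fixes u :: "'k::comm_ring_1"
  assumes "u dvd 1"
  shows "u * ring_inv u = 1"
proof -
  from assms obtain v where v: "u * v = 1" by (metis dvdE)
  have "w = v" if "u * w = 1" for w
    using v that by (metis mult.assoc mult.commute mult.right_neutral)
  with v show ?thesis unfolding ring_inv_def by (metis (mono_tags, lifting) theI)
qed

locale jordan_lie =
  fixes L :: "('k::comm_ring_1, 'g::ab_group_add) graded_lie"
  assumes two: "(2::'k) dvd 1"
    and graded: "three_graded_lie_algebra L"
    and automorphic: "exp_ad_automorphic L"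
begin

abbreviation sm (infixr "\<cdot>" 75) where "sm \<equiv> smul L"
abbreviation br ("\<lbrakk>_, _\<rbrakk>") where "br \<equiv> brk L"
abbreviation gr where "gr \<equiv> grade L"
abbreviation EE where "EE \<equiv> euler L"
abbreviation half where "half \<equiv> ring_inv (2::'k)"
abbreviation "Aut \<equiv> carrier (lie_aut L)"
abbreviation "ex \<equiv> exp_ad L"
abbreviation "ginv f \<equiv> inv_into UNIV f"

sublocale module "smul L"
  using graded by (simp add: three_graded_lie_algebra_def lie_algebra_def)

lemma half: "half + half = 1" "2 * half = 1"
proof -
  show "2 * half = 1" using ring_inv_unit[OF two] .
  then show "half + half = 1" by (metis mult_2)
qed

lemma quarter: "ring_inv 4 = half * half"
proof -
  have "(4::'k) * (half * half) = (2 * half) * (2 * half)" by (simp add: algebra_simps)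
  then have 1: "(4::'k) * (half * half) = 1" by (simp only: half mult_1)
  then have "(4::'k) dvd 1" by (metis dvdI)
  from ring_inv_unit[OF this] 1 show ?thesis
    by (metis mult.assoc mult.commute mult.right_neutral)
qed

lemma br_lin:
  "\<lbrakk>x + x', y\<rbrakk> = \<lbrakk>x, y\<rbrakk> + \<lbrakk>x', y\<rbrakk>" "\<lbrakk>x, y + y'\<rbrakk> = \<lbrakk>x, y\<rbrakk> + \<lbrakk>x, y'\<rbrakk>"
  "\<lbrakk>r \<cdot> x, y\<rbrakk> = r \<cdot> \<lbrakk>x, y\<rbrakk>" "\<lbrakk>x, r \<cdot> y\<rbrakk> = r \<cdot> \<lbrakk>x, y\<rbrakk>"
  "\<lbrakk>0, y\<rbrakk> = 0" "\<lbrakk>x, 0\<rbrakk> = 0" "\<lbrakk>-x, y\<rbrakk> = -\<lbrakk>x, y\<rbrakk>" "\<lbrakk>x, -y\<rbrakk> = -\<lbrakk>x, y\<rbrakk>"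
  "\<lbrakk>x - x', y\<rbrakk> = \<lbrakk>x, y\<rbrakk> - \<lbrakk>x', y\<rbrakk>" "\<lbrakk>x, y - y'\<rbrakk> = \<lbrakk>x, y\<rbrakk> - \<lbrakk>x, y'\<rbrakk>"
proof -
  have r: "module_hom sm sm (\<lambda>y. \<lbrakk>x, y\<rbrakk>)" and l: "module_hom sm sm (\<lambda>x. \<lbrakk>x, y\<rbrakk>)" for x y
    using graded by (simp_all add: three_graded_lie_algebra_def lie_algebra_def)
  show "\<lbrakk>x + x', y\<rbrakk> = \<lbrakk>x, y\<rbrakk> + \<lbrakk>x', y\<rbrakk>" "\<lbrakk>r \<cdot> x, y\<rbrakk> = r \<cdot> \<lbrakk>x, y\<rbrakk>" "\<lbrakk>0, y\<rbrakk> = 0" "\<lbrakk>-x, y\<rbrakk> = -\<lbrakk>x, y\<rbrakk>"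
    "\<lbrakk>x - x', y\<rbrakk> = \<lbrakk>x, y\<rbrakk> - \<lbrakk>x', y\<rbrakk>"
    using module_hom.add[OF l] module_hom.scale[OF l] module_hom.zero[OF l] module_hom.neg[OF l]
      module_hom.diff[OF l] by auto
  show "\<lbrakk>x, y + y'\<rbrakk> = \<lbrakk>x, y\<rbrakk> + \<lbrakk>x, y'\<rbrakk>" "\<lbrakk>x, r \<cdot> y\<rbrakk> = r \<cdot> \<lbrakk>x, y\<rbrakk>" "\<lbrakk>x, 0\<rbrakk> = 0" "\<lbrakk>x, -y\<rbrakk> = -\<lbrakk>x, y\<rbrakk>"
    "\<lbrakk>x, y - y'\<rbrakk> = \<lbrakk>x, y\<rbrakk> - \<lbrakk>x, y'\<rbrakk>"
    using module_hom.add[OF r] module_hom.scale[OF r] module_hom.zero[OF r] module_hom.neg[OF r]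
      module_hom.diff[OF r] by auto
qed

lemma br_self: "\<lbrakk>x, x\<rbrakk> = 0"
  using graded by (simp add: three_graded_lie_algebra_def lie_algebra_def)

lemma br_anti: "\<lbrakk>x, y\<rbrakk> = - \<lbrakk>y, x\<rbrakk>"
proof -
  have "\<lbrakk>x, y\<rbrakk> + \<lbrakk>y, x\<rbrakk> = 0"
  proof -
    have "\<lbrakk>x + y, x + y\<rbrakk> = \<lbrakk>x, y\<rbrakk> + \<lbrakk>y, x\<rbrakk>"
      by (simp only: br_lin(1,2)) (simp add: br_self)
    then show ?thesis by (simp only: br_self)
  qed
  then show ?thesis by (simp add: eq_neg_iff_add_eq_0)
qed

lemma jacobi: "\<lbrakk>x, \<lbrakk>y, z\<rbrakk>\<rbrakk> = \<lbrakk>\<lbrakk>x, y\<rbrakk>, z\<rbrakk> + \<lbrakk>y, \<lbrakk>x, z\<rbrakk>\<rbrakk>"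
proof -
  have "\<lbrakk>x, \<lbrakk>y, z\<rbrakk>\<rbrakk> + \<lbrakk>y, \<lbrakk>z, x\<rbrakk>\<rbrakk> + \<lbrakk>z, \<lbrakk>x, y\<rbrakk>\<rbrakk> = 0"
    using graded by (simp add: three_graded_lie_algebra_def lie_algebra_def)
  moreover have "\<lbrakk>y, \<lbrakk>z, x\<rbrakk>\<rbrakk> = - \<lbrakk>y, \<lbrakk>x, z\<rbrakk>\<rbrakk>" "\<lbrakk>z, \<lbrakk>x, y\<rbrakk>\<rbrakk> = - \<lbrakk>\<lbrakk>x, y\<rbrakk>, z\<rbrakk>"
    using br_anti[of z x] br_anti[of z "\<lbrakk>x, y\<rbrakk>"] by (simp_all add: br_lin)
  ultimately show ?thesis by (simp add: algebra_simps)
qed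

lemma gr_subspace: "subspace (gr k)"
  using graded by (simp add: three_graded_lie_algebra_def)

lemma gr_mem:
  "0 \<in> gr k" "x \<in> gr k \<Longrightarrow> y \<in> gr k \<Longrightarrow> x + y \<in> gr k" "x \<in> gr k \<Longrightarrow> r \<cdot> x \<in> gr k"
  "x \<in> gr k \<Longrightarrow> - x \<in> gr k" "x \<in> gr k \<Longrightarrow> y \<in> gr k \<Longrightarrow> x - y \<in> gr k"
  using gr_subspace[of k] subspace_0 subspace_add subspace_scale subspace_neg subspace_diff by blast+

lemma br_gr: "x \<in> gr k \<Longrightarrow> y \<in> gr l \<Longrightarrow> \<lbrakk>x, y\<rbrakk> \<in> gr (k + l)"
  using graded by (simp add: three_graded_lie_algebra_def)

lemma br_gr': "x \<in> gr k \<Longrightarrow> y \<in> gr l \<Longrightarrow> k + l = m \<Longrightarrow> \<lbrakk>x, y\<rbrakk> \<in> gr m"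
  using br_gr by blast

lemma gr_trivial: "\<bar>k\<bar> > 1 \<Longrightarrow> gr k = {0}"
  using graded by (simp add: three_graded_lie_algebra_def)

lemma br_zero: "x \<in> gr k \<Longrightarrow> y \<in> gr l \<Longrightarrow> \<bar>k + l\<bar> > 1 \<Longrightarrow> \<lbrakk>x, y\<rbrakk> = 0"
  using br_gr gr_trivial by blast

lemma euler_br: "x \<in> gr k \<Longrightarrow> \<lbrakk>EE, x\<rbrakk> = of_int k \<cdot> x"
  using graded by (simp add: three_graded_lie_algebra_def)

lemma decomp_unique:
  assumes "a \<in> gr 1" "b \<in> gr 0" "c \<in> gr (-1)" "a' \<in> gr 1" "b' \<in> gr 0" "c' \<in> gr (-1)"
    "a + b + c = a' + b' + c'"
  shows "a = a'" "b = b'" "c = c'"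
proof -
  let ?P = "\<lambda>p. case p of (a, b, c) \<Rightarrow> a \<in> gr 1 \<and> b \<in> gr 0 \<and> c \<in> gr (-1) \<and> a' + b' + c' = a + b + c"
  have "\<exists>!p. ?P p"
    using graded by (simp add: three_graded_lie_algebra_def)
  moreover have "?P (a, b, c)" "?P (a', b', c')"
    using assms by simp_all
  ultimately have "(a, b, c) = (a', b', c')" by blast
  then show "a = a'" "b = b'" "c = c'" by auto
qed

lemma pr_eq:
  assumes "a \<in> gr 1" "b \<in> gr 0" "c \<in> gr (-1)"
  shows "pr L 1 (a + b + c) = a" "pr L 0 (a + b + c) = b" "pr L (-1) (a + b + c) = c"
    "\<bar>i\<bar> > 1 \<Longrightarrow> pr L i (a + b + c) = 0"
proof -
  let ?f = "\<lambda>k::int. if k = 1 then a else if k = 0 then b else if k = -1 then c else 0"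
  have f: "\<forall>k. ?f k \<in> gr k" using assms gr_mem by auto
  have "pr L i (a + b + c) = ?f i" if "i = 1 \<or> i = 0 \<or> i = -1 \<or> \<bar>i\<bar> > 1" for i
    unfolding pr_def
  proof (rule the_equality)
    show "\<exists>f. (\<forall>k. f k \<in> gr k) \<and> a + b + c = f 1 + f 0 + f (-1) \<and> ?f i = f i"
      using f by (intro exI[of _ ?f]) auto
    fix y assume "\<exists>f. (\<forall>k. f k \<in> gr k) \<and> a + b + c = f 1 + f 0 + f (-1) \<and> y = f i"
    then obtain f where h: "\<forall>k. f k \<in> gr k" "a + b + c = f 1 + f 0 + f (-1)" "y = f i" by blast
    have "a = f 1" "b = f 0" "c = f (-1)" using decomp_unique[OF assms, of "f 1" "f 0" "f (-1)"] h by auto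
    moreover have "\<bar>i\<bar> > 1 \<Longrightarrow> f i = 0" using h gr_trivial by blast
    ultimately show "y = ?f i" using h that by auto
  qed
  from this[of 1] this[of 0] this[of "-1"] this[of i]
  show "pr L 1 (a + b + c) = a" "pr L 0 (a + b + c) = b" "pr L (-1) (a + b + c) = c"
    "\<bar>i\<bar> > 1 \<Longrightarrow> pr L i (a + b + c) = 0" by auto
qed

lemma decomp_exists:
  obtains a b c where "a \<in> gr 1" "b \<in> gr 0" "c \<in> gr (-1)" "x = a + b + c"
proof -
  let ?P = "\<lambda>p. case p of (a, b, c) \<Rightarrow> a \<in> gr 1 \<and> b \<in> gr 0 \<and> c \<in> gr (-1) \<and> x = a + b + c"
  have "\<exists>!p. ?P p"
    using graded by (simp add: three_graded_lie_algebra_def)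
  then obtain p where "?P p" by blast
  with that show ?thesis by (cases p) auto
qed

lemma pr_sum: "pr L 1 x + pr L 0 x + pr L (-1) x = x"
  by (rule decomp_exists[of x]) (simp add: pr_eq)

lemma int_cases_gr: "(i::int) = 1 \<or> i = 0 \<or> i = -1 \<or> \<bar>i\<bar> > 1" by linarith

lemma pr_gr: "pr L i x \<in> gr i"
  using int_cases_gr[of i] by (rule_tac decomp_exists[of x]) (auto simp: pr_eq gr_mem)

lemma pr_add: "pr L i (x + y) = pr L i x + pr L i y"
proof -
  obtain a b c where x: "a \<in> gr 1" "b \<in> gr 0" "c \<in> gr (-1)" "x = a + b + c" by (rule decomp_exists)
  obtain a' b' c' where y: "a' \<in> gr 1" "b' \<in> gr 0" "c' \<in> gr (-1)" "y = a' + b' + c'" by (rule decomp_exists)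
  have "x + y = (a + a') + (b + b') + (c + c')" using x y by (simp add: algebra_simps)
  note q = pr_eq[OF gr_mem(2)[OF x(1) y(1)] gr_mem(2)[OF x(2) y(2)] gr_mem(2)[OF x(3) y(3)], folded this]
  show ?thesis
    using int_cases_gr[of i] q pr_eq[OF x(1-3), folded x(4)] pr_eq[OF y(1-3), folded y(4)] by auto
qed

lemma pr_scale: "pr L i (r \<cdot> x) = r \<cdot> pr L i x"
proof -
  obtain a b c where x: "a \<in> gr 1" "b \<in> gr 0" "c \<in> gr (-1)" "x = a + b + c" by (rule decomp_exists)
  have "r \<cdot> x = r \<cdot> a + r \<cdot> b + r \<cdot> c" using x by (simp add: scale_right_distrib)
  note q = pr_eq[OF gr_mem(3)[OF x(1), of r] gr_mem(3)[OF x(2), of r] gr_mem(3)[OF x(3), of r], folded this]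
  show ?thesis
    using int_cases_gr[of i] q pr_eq[OF x(1-3), folded x(4)] by auto
qed

lemma pr_minus: "pr L i (- x) = - pr L i x" and pr_zero: "pr L i 0 = 0"
  and pr_diff: "pr L i (x - y) = pr L i x - pr L i y"
  using pr_scale[of i "-1" x] pr_scale[of i 0 x] pr_add[of i x "-y"] pr_scale[of i "-1" y] by simp_all

lemmas pr_lin = pr_add pr_scale pr_minus pr_zero pr_diff

lemma pr_of_gr:
  assumes "x \<in> gr j"
  shows "pr L i x = (if i = j then x else 0)"
proof -
  consider "j = 1" | "j = 0" | "j = -1" | "\<bar>j\<bar> > 1" using int_cases_gr[of j] by blast
  then show ?thesis
  proof cases
    case 1 then show ?thesis using pr_eq[of x 0 0] int_cases_gr[of i] assms gr_mem by auto
  next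
    case 2 then show ?thesis using pr_eq[of 0 x 0] int_cases_gr[of i] assms gr_mem by auto
  next
    case 3 then show ?thesis using pr_eq[of 0 0 x] int_cases_gr[of i] assms gr_mem by auto
  next
    case 4 then have "x = 0" using assms gr_trivial by auto
    then show ?thesis by (simp add: pr_zero)
  qed
qed

lemma pr_out: "\<bar>i\<bar> > 1 \<Longrightarrow> pr L i x = 0"
  using pr_gr[of i x] gr_trivial by blast

lemma pr_pr: "pr L i (pr L j x) = (if i = j then pr L j x else 0)"
  by (rule pr_of_gr[OF pr_gr])

lemma gr_eqI: "(\<And>i. i \<in> {1, 0, -1} \<Longrightarrow> pr L i x = pr L i y) \<Longrightarrow> x = y"
proof -
  assume h: "\<And>i. i \<in> {1, 0, -1} \<Longrightarrow> pr L i x = pr L i y"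
  have "pr L 1 x = pr L 1 y" "pr L 0 x = pr L 0 y" "pr L (-1) x = pr L (-1) y" by (rule h, simp)+
  then show "x = y" by (metis pr_sum)
qed

lemma mem_gr_iff:
  assumes "j \<in> {1, 0, -1}"
  shows "x \<in> gr j \<longleftrightarrow> (\<forall>i \<in> {1, 0, -1}. i \<noteq> j \<longrightarrow> pr L i x = 0)"
proof (rule iffI)
  assume h: "\<forall>i \<in> {1, 0, -1}. i \<noteq> j \<longrightarrow> pr L i x = 0"
  have "pr L j x = x"
  proof (rule gr_eqI)
    fix i :: int assume "i \<in> {1, 0, -1}"
    with h show "pr L i (pr L j x) = pr L i x" by (cases "i = j") (auto simp: pr_pr)
  qed
  with pr_gr[of j x] show "x \<in> gr j" by simp
next
  assume "x \<in> gr j"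
  then show "\<forall>i \<in> {1, 0, -1}. i \<noteq> j \<longrightarrow> pr L i x = 0" by (simp add: pr_of_gr)
qed

lemma pr_br:
  assumes "x \<in> gr j" "j \<in> {1, 0, -1}" "i \<in> {1, 0, -1}"
  shows "pr L i \<lbrakk>x, y\<rbrakk> = \<lbrakk>x, pr L (i - j) y\<rbrakk>"
proof -
  have "\<lbrakk>x, y\<rbrakk> = \<lbrakk>x, pr L 1 y\<rbrakk> + \<lbrakk>x, pr L 0 y\<rbrakk> + \<lbrakk>x, pr L (-1) y\<rbrakk>"
    using pr_sum[of y] by (metis br_lin(2))
  moreover have "pr L i \<lbrakk>x, pr L k y\<rbrakk> = (if i = j + k then \<lbrakk>x, pr L k y\<rbrakk> else 0)" for k
    by (rule pr_of_gr[OF br_gr[OF assms(1) pr_gr]])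
  ultimately show ?thesis using assms(2,3) by (auto simp: pr_lin pr_out br_lin)
qed

lemma euler_gr: "EE \<in> gr 0"
proof -
  have "\<lbrakk>EE, EE\<rbrakk> = \<lbrakk>EE, pr L 1 EE\<rbrakk> + \<lbrakk>EE, pr L 0 EE\<rbrakk> + \<lbrakk>EE, pr L (-1) EE\<rbrakk>"
    using pr_sum[of EE] by (metis br_lin(2))
  then have "pr L 1 EE + 0 + (- pr L (-1) EE) = 0 + 0 + 0"
    by (simp add: br_self euler_br[OF pr_gr])
  then have "pr L 1 EE = 0" "- pr L (-1) EE = 0"
    using decomp_unique[OF pr_gr gr_mem(1) gr_mem(4)[OF pr_gr] gr_mem(1) gr_mem(1) gr_mem(1)] by blast+
  then show ?thesis by (subst mem_gr_iff) auto
qed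

text \<open>Different degrees in $\{1, 0, -1\}$ differ by a unit of the ring, because 2 is invertible.\<close>

lemma eigen_gr:
  assumes "\<lbrakk>EE, y\<rbrakk> = of_int i \<cdot> y" "i \<in> {1, 0, -1}"
  shows "y \<in> gr i"
proof -
  have "of_int (j - i) \<cdot> pr L j y = 0" if "j \<in> {1, 0, -1}" for j
  proof -
    have "pr L j \<lbrakk>EE, y\<rbrakk> = \<lbrakk>EE, pr L j y\<rbrakk>" using pr_br[OF euler_gr _ that] by simp
    then have "of_int j \<cdot> pr L j y = of_int i \<cdot> pr L j y"
      using assms(1) by (simp add: euler_br[OF pr_gr] pr_lin)
    then show ?thesis by (simp add: scale_left_diff_distrib)
  qed
  note * = this
  have two: "x = 0" if "2 \<cdot> x = 0" for x
  proof -
    have "half \<cdot> (2 \<cdot> x) = x" using half(2) by (simp add: mult.commute)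
    with that show ?thesis by simp
  qed
  show ?thesis
    using assms(2) *[of 1] *[of 0] *[of "-1"] two
    by (subst mem_gr_iff[OF assms(2)]) (auto simp: scale_minus_left)
qed

section \<open>Automorphisms, exponentials and the elementary group\<close>

lemma Aut_iff: "f \<in> Aut \<longleftrightarrow> bij f \<and> module_hom sm sm f \<and> (\<forall>x y. f \<lbrakk>x, y\<rbrakk> = \<lbrakk>f x, f y\<rbrakk>)"
  by (simp add: lie_aut_def)

lemma Aut_lin:
  assumes "f \<in> Aut"
  shows "f (x + y) = f x + f y" "f (r \<cdot> x) = r \<cdot> f x" "f 0 = 0" "f (- x) = - f x" "f (x - y) = f x - f y"
    "f \<lbrakk>x, y\<rbrakk> = \<lbrakk>f x, f y\<rbrakk>"
proof -
  interpret f: module_hom sm sm f using assms by (simp add: Aut_iff)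
  show "f (x + y) = f x + f y" "f (r \<cdot> x) = r \<cdot> f x" "f 0 = 0" "f (- x) = - f x" "f (x - y) = f x - f y"
    by (simp_all add: f.add f.scale f.zero f.neg f.diff)
  show "f \<lbrakk>x, y\<rbrakk> = \<lbrakk>f x, f y\<rbrakk>" using assms by (simp add: Aut_iff)
qed

lemma AutI:
  assumes "bij f" "\<And>x y. f (x + y) = f x + f y" "\<And>r x. f (r \<cdot> x) = r \<cdot> f x" "\<And>x y. f \<lbrakk>x, y\<rbrakk> = \<lbrakk>f x, f y\<rbrakk>"
  shows "f \<in> Aut"
  using assms by (auto simp: Aut_iff module_hom_iff module_axioms)

lemma Aut_bij: "f \<in> Aut \<Longrightarrow> bij f" by (simp add: Aut_iff)

lemma Aut_id: "id \<in> Aut" by (rule AutI) auto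

lemma Aut_comp: "f \<in> Aut \<Longrightarrow> g \<in> Aut \<Longrightarrow> f \<circ> g \<in> Aut"
  by (rule AutI) (auto simp: Aut_bij bij_comp Aut_lin)

lemma Aut_inv: assumes "f \<in> Aut" shows "ginv f \<in> Aut"
proof -
  have b: "bij f" by (rule Aut_bij) fact
  then have f: "f (ginv f x) = x" "ginv f (f x) = x" for x
    by (simp_all add: bij_is_inj bij_is_surj surj_f_inv_f)
  show ?thesis
  proof (rule AutI)
    show "ginv f (x + y) = ginv f x + ginv f y" for x y
      using f(2)[of "ginv f x + ginv f y"] by (simp add: Aut_lin[OF assms] f)
    show "ginv f (r \<cdot> x) = r \<cdot> ginv f x" for r x
      using f(2)[of "r \<cdot> ginv f x"] by (simp add: Aut_lin[OF assms] f)
    show "ginv f \<lbrakk>x, y\<rbrakk> = \<lbrakk>ginv f x, ginv f y\<rbrakk>" for x y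
      using f(2)[of "\<lbrakk>ginv f x, ginv f y\<rbrakk>"] by (simp add: Aut_lin[OF assms] f)
  qed (use b in \<open>simp add: bij_imp_bij_inv\<close>)
qed

lemma Aut_inv_apply: "f \<in> Aut \<Longrightarrow> f (ginv f x) = x" "f \<in> Aut \<Longrightarrow> ginv f (f x) = x"
  by (simp_all add: Aut_bij bij_is_inj bij_is_surj surj_f_inv_f)

lemma Aut_inj: "f \<in> Aut \<Longrightarrow> f x = f y \<longleftrightarrow> x = y"
  by (metis Aut_inv_apply(2))

lemma Aut_eq_0: "f \<in> Aut \<Longrightarrow> f x = 0 \<longleftrightarrow> x = 0"
  using Aut_inj[of f x 0] by (simp add: Aut_lin)

lemma group_Aut: "group (lie_aut L)"
proof (rule groupI)
  fix f assume "f \<in> Aut"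
  then show "\<exists>g \<in> Aut. g \<otimes>\<^bsub>lie_aut L\<^esub> f = \<one>\<^bsub>lie_aut L\<^esub>"
    using Aut_inv[of f] by (intro bexI[of _ "ginv f"]) (auto simp: lie_aut_def bij_is_inj)
qed (use Aut_comp Aut_id in \<open>auto simp: lie_aut_def o_assoc\<close>)

lemma Aut_mult: "f \<otimes>\<^bsub>lie_aut L\<^esub> g = f \<circ> g" "\<one>\<^bsub>lie_aut L\<^esub> = id"
  by (simp_all add: lie_aut_def)

lemma Aut_m_inv: "f \<in> Aut \<Longrightarrow> inv\<^bsub>lie_aut L\<^esub> f = ginv f"
  using group.inv_equality[OF group_Aut, of "ginv f" f] Aut_inv[of f]
  by (simp add: Aut_mult bij_is_inj Aut_bij)

lemma ex_def: "ex x y = y + \<lbrakk>x, y\<rbrakk> + half \<cdot> \<lbrakk>x, \<lbrakk>x, y\<rbrakk>\<rbrakk>"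
  by (simp add: exp_ad_def)

lemma ex_Aut: "x \<in> gr 1 \<union> gr (-1) \<Longrightarrow> ex x \<in> Aut"
  using automorphic by (auto simp: exp_ad_automorphic_def)

lemma ex_Aut': "\<sigma> \<in> {1, -1} \<Longrightarrow> x \<in> gr \<sigma> \<Longrightarrow> ex x \<in> Aut"
  using ex_Aut by auto

lemma ex_0: "ex 0 = id" by (auto simp: ex_def br_lin)

lemma Aut_ex: "f \<in> Aut \<Longrightarrow> f (ex x y) = ex (f x) (f y)"
  by (simp add: ex_def Aut_lin)

lemma pr_ex:
  assumes "\<sigma> \<in> {1, -1}" "x \<in> gr \<sigma>"
  shows "pr L \<sigma> (ex x y) = pr L \<sigma> y + \<lbrakk>x, pr L 0 y\<rbrakk> + half \<cdot> \<lbrakk>x, \<lbrakk>x, pr L (-\<sigma>) y\<rbrakk>\<rbrakk>"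
    "pr L 0 (ex x y) = pr L 0 y + \<lbrakk>x, pr L (-\<sigma>) y\<rbrakk>"
    "pr L (-\<sigma>) (ex x y) = pr L (-\<sigma>) y"
  using assms pr_br[OF assms(2)] by (auto simp: ex_def pr_lin br_lin pr_out)

lemma ex_same: "\<sigma> \<in> {1, -1} \<Longrightarrow> x \<in> gr \<sigma> \<Longrightarrow> y \<in> gr \<sigma> \<Longrightarrow> ex x y = y"
  using br_zero[of x \<sigma> y \<sigma>] by (auto simp: ex_def br_lin)

text \<open>Elements of the same degree commute, and a product of three of their adjoint maps vanishes, so
  that the exponential series may be multiplied as power series truncated at degree 2.\<close>

lemma ex_add:
  assumes "\<sigma> \<in> {1, -1}" "x \<in> gr \<sigma>" "y \<in> gr \<sigma>"
  shows "ex x \<circ> ex y = ex (x + y)"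
proof
  fix z
  note m = gr_mem(2)[OF assms(2,3)]
  have c: "\<lbrakk>x, \<lbrakk>y, u\<rbrakk>\<rbrakk> = \<lbrakk>y, \<lbrakk>x, u\<rbrakk>\<rbrakk>" for u
    using jacobi[of x y u] br_zero[of x \<sigma> y \<sigma>] assms by (auto simp: br_lin)
  have d: "half \<cdot> u + half \<cdot> u = u" for u
    using half(1) by (metis scale_left_distrib scale_one)
  show "(ex x \<circ> ex y) z = ex (x + y) z"
  proof (rule gr_eqI)
    fix i :: int assume "i \<in> {1, 0, -1}"
    then consider "i = \<sigma>" | "i = 0" | "i = -\<sigma>" using assms(1) by auto
    then show "pr L i ((ex x \<circ> ex y) z) = pr L i (ex (x + y) z)"
    proof cases
      case 1
      let ?u = "pr L (-\<sigma>) z"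
      have "half \<cdot> \<lbrakk>x + y, \<lbrakk>x + y, ?u\<rbrakk>\<rbrakk> = half \<cdot> \<lbrakk>x, \<lbrakk>x, ?u\<rbrakk>\<rbrakk> + half \<cdot> \<lbrakk>y, \<lbrakk>y, ?u\<rbrakk>\<rbrakk>
          + (half \<cdot> \<lbrakk>x, \<lbrakk>y, ?u\<rbrakk>\<rbrakk> + half \<cdot> \<lbrakk>x, \<lbrakk>y, ?u\<rbrakk>\<rbrakk>)"
        by (simp add: br_lin scale_right_distrib c[symmetric] algebra_simps)
      then show ?thesis
        using 1 by (simp add: pr_ex[OF assms(1,2)] pr_ex[OF assms(1,3)] pr_ex[OF assms(1) m] d br_lin
            algebra_simps)
    next
      case 2 then show ?thesis
        by (simp add: pr_ex[OF assms(1,2)] pr_ex[OF assms(1,3)] pr_ex[OF assms(1) m] br_lin algebra_simps)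
    next
      case 3 then show ?thesis
        by (simp add: pr_ex[OF assms(1,2)] pr_ex[OF assms(1,3)] pr_ex[OF assms(1) m])
    qed
  qed
qed

lemma ex_minus:
  assumes "\<sigma> \<in> {1, -1}" "x \<in> gr \<sigma>"
  shows "ex (- x) (ex x y) = y" "ex x (ex (- x) y) = y"
  using ex_add[OF assms(1), of "-x" x] ex_add[OF assms(1), of x "-x"] assms(2)
  by (auto simp: gr_mem ex_0 fun_eq_iff)

lemma ex_inv: "\<sigma> \<in> {1, -1} \<Longrightarrow> x \<in> gr \<sigma> \<Longrightarrow> ginv (ex x) = ex (- x)"
  by (rule Hilbert_Choice.inv_equality) (simp_all add: ex_minus)

lemma ex_euler:
  assumes "\<sigma> \<in> {1, -1}" "x \<in> gr \<sigma>"
  shows "ex x EE = EE - of_int \<sigma> \<cdot> x"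
proof -
  have "\<lbrakk>x, EE\<rbrakk> = - (of_int \<sigma> \<cdot> x)" using br_anti[of x EE] euler_br[OF assms(2)] by simp
  then show ?thesis by (simp add: ex_def br_lin br_self)
qed

text \<open>Since $e^{-ad(x)}$ inverts $e^{ad(x)}$, the group consists of the products of exponentials. Such
  words, unlike group elements, have arguments that can be varied.\<close>

primrec word :: "'g list \<Rightarrow> 'g \<Rightarrow> 'g" where
  "word [] = id"
| "word (a # as) = ex a \<circ> word as"

abbreviation letters :: "'g set" where "letters \<equiv> gr 1 \<union> gr (-1)"

lemma word_append: "word (as @ bs) = word as \<circ> word bs"
  by (induction as) (auto simp: fun_eq_iff)

lemma word_Aut: "set as \<subseteq> letters \<Longrightarrow> word as \<in> Aut"
  by (induction as) (auto intro!: Aut_id Aut_comp ex_Aut)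

lemma letters_minus: "a \<in> letters \<Longrightarrow> - a \<in> letters"
  using gr_mem(4) by auto

lemma ex_letter_minus: "a \<in> letters \<Longrightarrow> ex (- a) \<circ> ex a = id" "a \<in> letters \<Longrightarrow> ex a \<circ> ex (- a) = id"
  using ex_minus[of 1 a] ex_minus[of "-1" a] by (auto simp: fun_eq_iff)

lemma word_inverse:
  assumes "set as \<subseteq> letters"
  shows "ginv (word as) = word (rev (map uminus as))"
proof -
  have "word as \<circ> word (rev (map uminus as)) = id"
    using assms
  proof (induction as)
    case (Cons a as)
    have IH: "word as (word (rev (map uminus as)) z) = z" for z
      using Cons by (simp add: fun_eq_iff)
    show ?case using Cons.prems ex_letter_minus(2)[of a] by (auto simp: fun_eq_iff word_append IH)
  qed simp
  then have r: "word as (word (rev (map uminus as)) z) = z" for z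
    by (simp add: fun_eq_iff)
  have "inj (word as)" by (rule bij_is_inj[OF Aut_bij[OF word_Aut[OF assms]]])
  then show ?thesis by (metis ext inv_f_f r)
qed

lemma elementary_group_words: "elementary_group L = word ` lists letters"
proof
  interpret group "lie_aut L" by (rule group_Aut)
  show "elementary_group L \<subseteq> word ` lists letters"
  proof
    fix g assume "g \<in> elementary_group L"
    then show "g \<in> word ` lists letters"
      unfolding elementary_group_def
    proof (induction rule: generate.induct)
      case one then show ?case by (intro image_eqI[of _ _ "[]"]) (auto simp: Aut_mult)
    next
      case (incl h) then obtain a where "a \<in> letters" "h = ex a" by blast
      then show ?case by (intro image_eqI[of _ _ "[a]"]) auto
    next
      case (inv h) then obtain a where a: "a \<in> letters" "h = ex a" by blast
      then have "inv\<^bsub>lie_aut L\<^esub> h = ex (- a)"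
        using ex_inv[of 1 a] ex_inv[of "-1" a] by (auto simp: Aut_m_inv ex_Aut)
      then show ?case using letters_minus[OF a(1)] by (intro image_eqI[of _ _ "[- a]"]) auto
    next
      case (eng h1 h2)
      then obtain as bs where "as \<in> lists letters" "bs \<in> lists letters" "h1 = word as" "h2 = word bs" by blast
      then show ?case by (intro image_eqI[of _ _ "as @ bs"]) (auto simp: Aut_mult word_append)
    qed
  qed
  have "word as \<in> elementary_group L" if "set as \<subseteq> letters" for as
    using that
  proof (induction as)
    case Nil show ?case
      using generate.one[of "lie_aut L"] unfolding elementary_group_def Aut_mult word.simps by blast
  next
    case (Cons a as)
    then have "ex a \<in> elementary_group L" "word as \<in> elementary_group L"
      by (auto simp: elementary_group_def intro: generate.incl)
    then show ?case
      using generate.eng[of "ex a" "lie_aut L"] unfolding elementary_group_def Aut_mult word.simps by blast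
  qed
  then show "word ` lists letters \<subseteq> elementary_group L" by auto
qed

lemma G_Aut: "g \<in> elementary_group L \<Longrightarrow> g \<in> Aut"
  using word_Aut by (auto simp: elementary_group_words)

lemma G_word: "set as \<subseteq> letters \<Longrightarrow> word as \<in> elementary_group L"
  by (auto simp: elementary_group_words)

lemma G_obtain_word:
  assumes "g \<in> elementary_group L"
  obtains as where "set as \<subseteq> letters" "g = word as"
  using assms by (auto simp: elementary_group_words)

lemma G_comp:
  assumes "g \<in> elementary_group L" "h \<in> elementary_group L"
  shows "g \<circ> h \<in> elementary_group L"
proof -
  from assms obtain as bs where "set as \<subseteq> letters" "g = word as" "set bs \<subseteq> letters" "h = word bs"
    by (auto simp: elementary_group_words)
  then have "g \<circ> h = word (as @ bs)" "set (as @ bs) \<subseteq> letters" by (simp_all add: word_append)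
  then show ?thesis by (simp only: G_word)
qed

lemma G_ex: "a \<in> letters \<Longrightarrow> ex a \<in> elementary_group L"
  using G_word[of "[a]"] by simp

lemma G_id: "id \<in> elementary_group L"
  using G_word[of "[]"] by simp

lemma G_inv: "g \<in> elementary_group L \<Longrightarrow> ginv g \<in> elementary_group L"
proof -
  assume "g \<in> elementary_group L"
  then obtain as where as: "set as \<subseteq> letters" "g = word as" by (auto simp: elementary_group_words)
  have "set (rev (map uminus as)) \<subseteq> letters" using as letters_minus by auto
  from G_word[OF this] show ?thesis using as word_inverse[OF as(1)] by simp
qed

end

section \<open>Transversality and the Gauss decomposition\<close>

lemma GL_on_iff:
  assumes "module s" "module.subspace s S"
  shows "f \<in> GL_on s S \<longleftrightarrow> f \<in> End_on s S \<and> bij_betw f S S"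
proof
  interpret module s by fact
  assume "f \<in> GL_on s S"
  then obtain h where f: "f \<in> End_on s S" and h: "h \<in> End_on s S" "\<forall>x\<in>S. h (f x) = x \<and> f (h x) = x"
    by (auto simp: GL_on_def)
  then have "bij_betw f S S"
    by (intro bij_betw_byWitness[where f' = h]) (auto simp: End_on_def)
  with f show "f \<in> End_on s S \<and> bij_betw f S S" by blast
next
  interpret module s by fact
  assume f: "f \<in> End_on s S \<and> bij_betw f S S"
  let ?h = "inv_into S f"
  have bij: "bij_betw f S S" using f by blast
  have h: "?h (f x) = x" "f (?h x) = x" "?h x \<in> S" "f x \<in> S" if "x \<in> S" for x
    using bij_betw_inv_into_left[OF bij that] bij_betw_inv_into_right[OF bij that]
      bij_betw_apply[OF bij that] bij_betw_apply[OF bij_betw_inv_into[OF bij] that] by blast+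
  have "?h \<in> End_on s S"
    unfolding End_on_def
  proof (intro CollectI conjI ballI allI)
    fix x y assume xy: "x \<in> S" "y \<in> S"
    have "?h (f (?h x + ?h y)) = ?h x + ?h y"
      by (rule h(1)) (rule subspace_add[OF assms(2) h(3)[OF xy(1)] h(3)[OF xy(2)]])
    moreover have "f (?h x + ?h y) = x + y" using f h(2,3) xy by (simp add: End_on_def)
    ultimately show "?h (x + y) = ?h x + ?h y" by metis
  next
    fix r x assume x: "x \<in> S"
    have "?h (f (s r (?h x))) = s r (?h x)"
      by (rule h(1)) (rule subspace_scale[OF assms(2) h(3)[OF x]])
    moreover have "f (s r (?h x)) = s r x" using f h(2,3) x by (simp add: End_on_def)
    ultimately show "?h (s r x) = s r (?h x)" by metis
  next
    show "?h \<in> S \<rightarrow> S" by (rule funcsetI) (rule h(3))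
  qed
  moreover have "\<forall>x\<in>S. ?h (f x) = x \<and> f (?h x) = x" using h(1,2) by blast
  ultimately show "f \<in> GL_on s S" using f unfolding GL_on_def by blast
qed

lemma complementary_meet: "complementary A B \<Longrightarrow> y \<in> A \<Longrightarrow> y \<in> B \<Longrightarrow> y = 0"
  unfolding complementary_def by blast

lemma complementary_split:
  assumes "complementary A B" obtains a b where "a \<in> A" "b \<in> B" "y = a + b"
proof -
  have "y \<in> {a + b | a b. a \<in> A \<and> b \<in> B}" using assms by (simp add: complementary_def)
  then show ?thesis using that by blast
qed

lemma complementaryI:
  assumes "0 \<in> A" "0 \<in> B" "\<And>y. y \<in> A \<Longrightarrow> y \<in> B \<Longrightarrow> y = 0" "\<And>y. \<exists>a\<in>A. \<exists>b\<in>B. y = a + b"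
  shows "complementary A B"
  using assms unfolding complementary_def by blast

context jordan_lie
begin

lemma coef_apply: "v \<in> gr j \<Longrightarrow> coef L g i j v = pr L i (g v)"
  by (simp add: coef_def)

lemma coef_End: "f \<in> Aut \<Longrightarrow> coef L f i i \<in> End_on sm (gr i)"
  by (auto simp: End_on_def coef_apply pr_gr gr_mem Aut_lin pr_lin)

text \<open>The second space is the kernel of $pr_i$, so it is a complement exactly if $pr_i$ restricts
  to a bijection on $f(g_i)$.\<close>

lemma complementary_iff_GL:
  assumes f: "f \<in> Aut"
  shows "complementary (f ` gr i) {y. pr L i y = 0} \<longleftrightarrow> coef L f i i \<in> GL_on sm (gr i)"
proof -
  let ?c = "coef L f i i"
  have "complementary (f ` gr i) {y. pr L i y = 0} \<longleftrightarrow> bij_betw ?c (gr i) (gr i)"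
  proof
    assume c: "complementary (f ` gr i) {y. pr L i y = 0}"
    have "inj_on ?c (gr i)"
    proof (rule inj_onI)
      fix u v assume uv: "u \<in> gr i" "v \<in> gr i" "?c u = ?c v"
      then have "u - v \<in> gr i" "pr L i (f (u - v)) = 0"
        by (simp_all add: coef_apply Aut_lin[OF f] pr_lin gr_mem)
      then have "f (u - v) = 0" by (intro complementary_meet[OF c]) simp_all
      then show "u = v" using f by (simp add: Aut_eq_0)
    qed
    moreover have "?c ` gr i = gr i"
    proof
      show "gr i \<subseteq> ?c ` gr i"
      proof
        fix v assume v: "v \<in> gr i"
        obtain u b where "u \<in> gr i" "pr L i b = 0" "v = f u + b"
          by (rule complementary_split[OF c, of v]) auto
        then have "?c u = v" using v by (simp add: coef_apply pr_lin) (metis add.right_neutral pr_add pr_of_gr)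
        with \<open>u \<in> gr i\<close> show "v \<in> ?c ` gr i" by blast
      qed
    qed (auto simp: coef_apply pr_gr)
    ultimately show "bij_betw ?c (gr i) (gr i)" by (simp add: bij_betw_def)
  next
    assume b: "bij_betw ?c (gr i) (gr i)"
    show "complementary (f ` gr i) {y. pr L i y = 0}"
    proof (rule complementaryI)
      show "0 \<in> f ` gr i" using imageI[OF gr_mem(1), of f] by (simp add: Aut_lin(3)[OF f])
      show "0 \<in> {y. pr L i y = 0}" by (simp add: pr_zero)
      fix y
      show "y = 0" if "y \<in> f ` gr i" "y \<in> {y. pr L i y = 0}"
      proof -
        from that obtain u where u: "u \<in> gr i" "y = f u" "pr L i (f u) = 0" by auto
        then have "?c u = ?c 0" using gr_mem by (simp add: coef_apply Aut_lin[OF f] pr_lin)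
        then have "u = 0" using b u gr_mem(1) by (meson bij_betw_def inj_onD)
        with u show ?thesis by (simp add: Aut_lin[OF f])
      qed
      obtain u where u: "u \<in> gr i" "?c u = pr L i y"
        using b pr_gr by (metis bij_betw_iff_bijections)
      then have "pr L i (y - f u) = 0" by (simp add: pr_lin coef_apply)
      moreover have "y = f u + (y - f u)" by simp
      ultimately show "\<exists>a\<in>f ` gr i. \<exists>b\<in>{y. pr L i y = 0}. y = a + b" using u(1) by blast
    qed
  qed
  then show ?thesis
    using coef_End[OF f] by (simp add: GL_on_iff[OF module_axioms gr_subspace])
qed

lemma complementary_image:
  assumes "f \<in> Aut"
  shows "complementary (f ` A) (f ` B) \<longleftrightarrow> complementary A B"
proof -
  have imp: "complementary (f ` A) (f ` B)" if c: "complementary A B" and f: "f \<in> Aut" for f and A B :: "'g set"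
  proof -
    have "0 \<in> A" "0 \<in> B" using c by (auto simp: complementary_def)
    note z = imageI[OF this(1), of f] imageI[OF this(2), of f]
    show "complementary (f ` A) (f ` B)"
    proof (rule complementaryI)
      show "0 \<in> f ` A" "0 \<in> f ` B" using z by (simp_all add: Aut_lin(3)[OF f])
      fix y
      show "y = 0" if y: "y \<in> f ` A" "y \<in> f ` B"
      proof -
        from y obtain a b where ab: "a \<in> A" "b \<in> B" "y = f a" "y = f b" by blast
        then have "a = b" using Aut_inj[OF f] by blast
        then have "a = 0" using ab complementary_meet[OF c] by blast
        then show "y = 0" using ab Aut_lin(3)[OF f] by simp
      qed
      obtain a b where ab: "a \<in> A" "b \<in> B" "ginv f y = a + b" by (rule complementary_split[OF c])
      have "y = f a + f b"
        using Aut_inv_apply(1)[OF f, of y] by (simp add: ab Aut_lin(1)[OF f])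
      then show "\<exists>a\<in>f ` A. \<exists>b\<in>f ` B. y = a + b" using ab by blast
    qed
  qed
  have "ginv f ` (f ` A) = A" for A
    using assms by (simp add: Aut_bij bij_is_inj)
  then show ?thesis using imp[OF _ assms] imp[OF _ Aut_inv[OF assms], of "f ` A" "f ` B"] by auto
qed

lemma base_flag_eq:
  assumes "\<sigma> \<in> {1, -1}"
  shows "base_flag L \<sigma> = (gr (- \<sigma>), {y. pr L \<sigma> y = 0})"
proof -
  have "y \<in> {a + b | a b. a \<in> gr (- \<sigma>) \<and> b \<in> gr 0}" if "pr L \<sigma> y = 0" for y
  proof -
    have "y = pr L (- \<sigma>) y + pr L 0 y" using pr_sum[of y] that assms by (auto simp: add.commute)
    then show ?thesis using pr_gr by blast
  qed
  then have "{a + b | a b. a \<in> gr (- \<sigma>) \<and> b \<in> gr 0} = {y. pr L \<sigma> y = 0}"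
    using assms by (auto simp: pr_lin pr_of_gr)
  then show ?thesis by (simp add: base_flag_def)
qed

lemma act_comp: "act (f \<circ> g) p = act f (act g p)"
  by (simp add: act_def image_comp)

lemma act_id: "act id p = p"
  by (simp add: act_def)

lemma act_inv: "f \<in> Aut \<Longrightarrow> act (ginv f) (act f p) = p" "f \<in> Aut \<Longrightarrow> act f (act (ginv f) p) = p"
  by (simp_all add: act_def Aut_bij bij_is_inj bij_is_surj image_f_inv_f)

lemma act_inj: "f \<in> Aut \<Longrightarrow> act f p = act f q \<longleftrightarrow> p = q"
  by (metis act_inv(1))

lemma transversal_act: "f \<in> Aut \<Longrightarrow> transversal (act f p) (act f q) \<longleftrightarrow> transversal p q"
  by (simp add: transversal_def act_def complementary_image)

lemma act_ex_base:
  assumes "\<sigma> \<in> {1, -1}" "w \<in> gr (- \<sigma>)"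
  shows "act (ex w) (base_flag L \<sigma>) = base_flag L \<sigma>"
proof -
  have m: "- \<sigma> \<in> {1, -1}" using assms(1) by auto
  have s1: "ex v ` gr (- \<sigma>) \<subseteq> gr (- \<sigma>)" if "v \<in> gr (- \<sigma>)" for v
    using ex_same[OF m that] by auto
  have s2: "ex v ` {y. pr L \<sigma> y = 0} \<subseteq> {y. pr L \<sigma> y = 0}" if "v \<in> gr (- \<sigma>)" for v
    using pr_ex(3)[OF m that] by auto
  have "ex w ` A = A" if "\<And>v. v \<in> gr (- \<sigma>) \<Longrightarrow> ex v ` A \<subseteq> A" for A
  proof
    show "ex w ` A \<subseteq> A" by (rule that) fact
    show "A \<subseteq> ex w ` A"
    proof
      fix a assume "a \<in> A"
      then have "ex (- w) a \<in> A" using that[of "- w"] assms(2) gr_mem(4) by blast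
      moreover have "a = ex w (ex (- w) a)" using ex_minus(2)[OF m assms(2)] by simp
      ultimately show "a \<in> ex w ` A" by blast
    qed
  qed
  then show ?thesis using s1 s2 by (simp add: base_flag_eq[OF assms(1)] act_def)
qed

text \<open>These automorphisms form the Levi factor of the stabilizer of $o^+$.\<close>

definition graded_aut :: "('g \<Rightarrow> 'g) \<Rightarrow> bool" where
  "graded_aut h \<longleftrightarrow> h \<in> Aut \<and> (\<forall>i. h ` gr i = gr i)"

lemma graded_autD: "graded_aut h \<Longrightarrow> h \<in> Aut" "graded_aut h \<Longrightarrow> x \<in> gr i \<Longrightarrow> h x \<in> gr i"
  by (auto simp: graded_aut_def)

lemma graded_aut_id: "graded_aut id"
  by (simp add: graded_aut_def Aut_id)

lemma graded_aut_comp: "graded_aut h \<Longrightarrow> graded_aut k \<Longrightarrow> graded_aut (h \<circ> k)"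
  unfolding graded_aut_def by (metis Aut_comp image_comp)

lemma graded_aut_inv: "graded_aut h \<Longrightarrow> graded_aut (ginv h)"
  unfolding graded_aut_def by (metis Aut_bij Aut_inv bij_is_inj image_inv_f_f)

lemma graded_aut_pr: 
  assumes "graded_aut h" shows "pr L i (h y) = h (pr L i y)"
proof -
  note h = graded_autD[OF assms]
  have "h y = h (pr L 1 y) + h (pr L 0 y) + h (pr L (-1) y)"
    using pr_sum[of y] by (metis Aut_lin(1)[OF h(1)])
  then show ?thesis
    using pr_eq[OF h(2)[OF pr_gr[of 1 y]] h(2)[OF pr_gr[of 0 y]] h(2)[OF pr_gr[of "-1" y]]] int_cases_gr[of i] pr_out[of i y]
    by (auto simp: Aut_lin[OF h(1)])
qed

lemma graded_aut_ex: "graded_aut h \<Longrightarrow> h \<circ> ex x = ex (h x) \<circ> h"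
  by (auto simp: fun_eq_iff Aut_ex graded_autD)

lemma graded_aut_base: "graded_aut h \<Longrightarrow> \<sigma> \<in> {1, -1} \<Longrightarrow> act h (base_flag L \<sigma>) = base_flag L \<sigma>"
proof -
  assume h: "graded_aut h" and \<sigma>: "\<sigma> \<in> {1, -1}"
  have "h ` {y. pr L \<sigma> y = 0} = {y. pr L \<sigma> y = 0}"
  proof
    show "h ` {y. pr L \<sigma> y = 0} \<subseteq> {y. pr L \<sigma> y = 0}"
      using h by (auto simp: graded_aut_pr Aut_lin graded_autD)
    show "{y. pr L \<sigma> y = 0} \<subseteq> h ` {y. pr L \<sigma> y = 0}"
    proof
      fix y assume "y \<in> {y. pr L \<sigma> y = 0}"
      then have "ginv h y \<in> {y. pr L \<sigma> y = 0}"
        using graded_aut_pr[OF graded_aut_inv[OF h]] Aut_lin(3)[OF Aut_inv[OF graded_autD(1)[OF h]]] by simp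
      moreover have "y = h (ginv h y)" using graded_autD(1)[OF h] by (simp add: Aut_inv_apply)
      ultimately show "y \<in> h ` {y. pr L \<sigma> y = 0}" by blast
    qed
  qed
  then show ?thesis using h by (simp add: base_flag_eq[OF \<sigma>] act_def graded_aut_def)
qed

definition big_cell :: "('g \<Rightarrow> 'g) \<Rightarrow> bool" where
  "big_cell \<gamma> \<longleftrightarrow> (\<exists>x h w. x \<in> gr 1 \<and> graded_aut h \<and> w \<in> gr (-1) \<and> \<gamma> = ex x \<circ> h \<circ> ex w)"

lemma signs: "(1::int) \<in> {1, -1}" "(-1::int) \<in> {1, -1}" by auto

text \<open>Transversality of $\gamma.o^+$ and $o^-$ gives $E = x + \gamma(p)$ with $x \in g_1$ and
  $p \in g_0 + g_{-1}$. For $\kappa = e^{-ad(x)} \gamma$ then $\kappa(p) = E$, so that $ad(p)$ has the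
  eigenspaces $\kappa^{-1}(g_i)$. Comparing these with the grading, by means of the two complements,
  shows that the component $p_0$ acts as $E$ does; hence $ad(p) = ad(E + w) = ad(e^{ad(w)} E)$ for
  $w = p_{-1}$, and $h = \kappa e^{ad(w)}$ commutes with $ad(E)$.\<close>

lemma decomposition_if_transversal:
  assumes \<gamma>: "\<gamma> \<in> Aut"
    and T1: "complementary (\<gamma> ` gr (-1)) {y. pr L (-1) y = 0}"
    and T2: "complementary (gr 1) (\<gamma> ` {y. pr L 1 y = 0})"
  shows "big_cell \<gamma>"
proof -
  let ?N = "{y. pr L (-1) y = 0}" and ?P = "{y. pr L 1 y = 0}"
  obtain x p where x: "x \<in> gr 1" and p: "pr L 1 p = 0" and E: "EE = x + \<gamma> p"
    by (rule complementary_split[OF T2, of EE]) auto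
  \<comment> \<open>After this translation E is the image of p, which has no component in degree 1.\<close>
  define \<kappa> where "\<kappa> = ex (- x) \<circ> \<gamma>"
  have mx: "- x \<in> gr 1" using x gr_mem by blast
  have exA: "ex (- x) \<in> Aut" using ex_Aut'[OF signs(1) mx] .
  have \<kappa>: "\<kappa> \<in> Aut" unfolding \<kappa>_def by (rule Aut_comp[OF exA \<gamma>])
  note \<kappa>l = Aut_lin[OF \<kappa>]
  have "\<gamma> p = EE - x" using E by (simp add: algebra_simps)
  then have \<kappa>p: "\<kappa> p = EE"
    using ex_euler[OF signs(1) mx] ex_same[OF signs(1) mx x] by (simp add: \<kappa>_def Aut_lin[OF exA])
  have im: "ex (- x) ` ?N = ?N" "ex (- x) ` gr 1 = gr 1"
    using act_ex_base[OF signs(2), of "- x"] mx base_flag_eq[OF signs(2)] by (simp_all add: act_def)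
  have T1': "complementary (\<kappa> ` gr (-1)) ?N"
    using T1 complementary_image[OF exA, of "\<gamma> ` gr (-1)" ?N] by (simp add: im \<kappa>_def image_comp)
  have T2': "complementary (gr 1) (\<kappa> ` ?P)"
    using T2 complementary_image[OF exA, of "gr 1" "\<gamma> ` ?P"] by (simp add: im \<kappa>_def image_comp)
  have A: "\<lbrakk>p, X\<rbrakk> = of_int i \<cdot> X" if "\<kappa> X \<in> gr i" for X i
  proof -
    have "\<kappa> \<lbrakk>p, X\<rbrakk> = \<kappa> (of_int i \<cdot> X)" using that by (simp add: \<kappa>l \<kappa>p euler_br)
    then show ?thesis using Aut_inj[OF \<kappa>] by blast
  qed
  have pinv: "\<kappa> (ginv \<kappa> y) = y" for y by (rule Aut_inv_apply(1)[OF \<kappa>])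
  define p0 w where "p0 = pr L 0 p" and "w = pr L (-1) p"
  have p0: "p0 \<in> gr 0" and w: "w \<in> gr (-1)" by (simp_all add: p0_def w_def pr_gr)
  have p_eq: "p = p0 + w" using pr_sum[of p] p by (simp add: p0_def w_def)
  have pr_p: "pr L 1 \<lbrakk>p, X\<rbrakk> = \<lbrakk>p0, pr L 1 X\<rbrakk>" "pr L 0 \<lbrakk>p, X\<rbrakk> = \<lbrakk>p0, pr L 0 X\<rbrakk> + \<lbrakk>w, pr L 1 X\<rbrakk>" for X
    using pr_br[OF p0, of _ X] pr_br[OF w, of _ X] by (simp_all add: p_eq br_lin pr_lin pr_out)
  \<comment> \<open>p0 acts as 1 on degree 1, since that degree is the projection of the 1-eigenspace of ad p.\<close>
  have step1: "\<lbrakk>p0, v\<rbrakk> = v" if v: "v \<in> gr 1" for v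
  proof -
    obtain a q where a: "a \<in> gr 1" and q: "pr L 1 q = 0" and e: "\<kappa> v = a + \<kappa> q"
      by (rule complementary_split[OF T2', of "\<kappa> v"]) auto
    define X where "X = v - q"
    have "\<kappa> X = a" using e by (simp add: X_def \<kappa>l)
    then have "\<lbrakk>p, X\<rbrakk> = X" using A[of X 1] a by simp
    moreover have "pr L 1 X = v" using v q by (simp add: X_def pr_lin pr_of_gr)
    ultimately show ?thesis using pr_p(1)[of X] by simp
  qed
  \<comment> \<open>Modulo degree -1, an element of degree 0 is a sum of eigenvectors for 1 and 0; the first one vanishes.\<close>
  have step2: "\<lbrakk>p0, u\<rbrakk> = 0" if u: "u \<in> gr 0" for u
  proof -
    obtain q n where q: "q \<in> gr (-1)" and n: "pr L (-1) n = 0" and e: "\<kappa> u = \<kappa> q + n"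
      by (rule complementary_split[OF T1', of "\<kappa> u"]) auto
    define X1 X0 where "X1 = ginv \<kappa> (pr L 1 n)" and "X0 = ginv \<kappa> (pr L 0 n)"
    have "n = pr L 1 n + pr L 0 n" using pr_sum[of n] n by simp
    then have "\<kappa> u = \<kappa> (q + X1 + X0)" using e by (simp add: \<kappa>l X1_def X0_def pinv add.assoc)
    then have u_eq: "u = q + X1 + X0" using Aut_inj[OF \<kappa>] by blast
    have "\<lbrakk>p, X1\<rbrakk> = X1" "\<lbrakk>p, X0\<rbrakk> = 0"
      using A[of X1 1] A[of X0 0] by (simp_all add: X1_def X0_def pinv pr_gr)
    then have pu: "\<lbrakk>p, u\<rbrakk> = \<lbrakk>p, q\<rbrakk> + X1" by (simp add: u_eq br_lin)
    have "pr L 1 X1 = 0"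
      using arg_cong[OF pu, of "pr L 1"] u q by (simp add: pr_lin pr_p pr_of_gr br_lin)
    then have "\<kappa> X1 \<in> \<kappa> ` ?P" by blast
    moreover have "\<kappa> X1 \<in> gr 1" by (simp add: X1_def pinv pr_gr)
    ultimately have "\<kappa> X1 = 0" by (intro complementary_meet[OF T2'])
    then have "X1 = 0" using Aut_eq_0[OF \<kappa>] by blast
    with arg_cong[OF pu, of "pr L 0"] u q show ?thesis by (simp add: pr_lin pr_p pr_of_gr br_lin)
  qed
  \<comment> \<open>On degree -1 the map ad p + 1 takes values in degree -1 and in the sum of the eigenspaces for 0 and 1.\<close>
  have step3: "\<lbrakk>p0, b\<rbrakk> = - b" if b: "b \<in> gr (-1)" for b
  proof -
    have wb: "\<lbrakk>w, b\<rbrakk> = 0" by (rule br_zero[OF w b]) simp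
    then have "\<lbrakk>p, b\<rbrakk> + b = \<lbrakk>p0, b\<rbrakk> + b" by (simp add: p_eq br_lin)
    then have m: "\<lbrakk>p, b\<rbrakk> + b \<in> gr (-1)" using br_gr[OF p0 b] b gr_mem(2) by simp
    have "pr L (-1) (\<kappa> (\<lbrakk>p, b\<rbrakk> + b)) = \<lbrakk>EE, pr L (-1) (\<kappa> b)\<rbrakk> + pr L (-1) (\<kappa> b)"
      using pr_br[OF euler_gr, of "-1" "\<kappa> b"] by (simp add: \<kappa>l \<kappa>p pr_lin)
    also have "\<dots> = 0" by (simp add: euler_br[OF pr_gr])
    finally have "\<kappa> (\<lbrakk>p, b\<rbrakk> + b) = 0"
      using complementary_meet[OF T1' imageI[OF m]] by simp
    then have "\<lbrakk>p, b\<rbrakk> + b = 0" using Aut_eq_0[OF \<kappa>] by blast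
    then show ?thesis using wb by (simp add: p_eq br_lin eq_neg_iff_add_eq_0)
  qed
  have ad: "\<lbrakk>p0, y\<rbrakk> = \<lbrakk>EE, y\<rbrakk>" for y
  proof -
    have "\<lbrakk>z, y\<rbrakk> = \<lbrakk>z, pr L 1 y\<rbrakk> + \<lbrakk>z, pr L 0 y\<rbrakk> + \<lbrakk>z, pr L (-1) y\<rbrakk>" for z
      using pr_sum[of y] by (metis br_lin(2))
    from this[of p0] this[of EE] show ?thesis
      by (simp add: step1 step2 step3 pr_gr euler_br[OF pr_gr])
  qed
  have wA: "ex w \<in> Aut" by (rule ex_Aut'[OF signs(2) w])
  have exE: "ex w EE = EE + w" using ex_euler[OF signs(2) w] by simp
  define h where "h = \<kappa> \<circ> ex w"
  have hA: "h \<in> Aut" unfolding h_def by (rule Aut_comp[OF \<kappa> wA])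
  have sub: "h X \<in> gr i" if X: "X \<in> gr i" for X i
  proof (cases "\<bar>i\<bar> > 1")
    case True then show ?thesis using X gr_trivial[OF True] Aut_lin(3)[OF hA] by simp
  next
    case False
    have "\<lbrakk>p, ex w X\<rbrakk> = \<lbrakk>ex w EE, ex w X\<rbrakk>" by (simp add: exE p_eq br_lin ad)
    also have "\<dots> = of_int i \<cdot> ex w X" using X by (simp add: euler_br Aut_lin[OF wA] flip: Aut_lin(6)[OF wA])
    finally have "\<lbrakk>EE, h X\<rbrakk> = of_int i \<cdot> h X" by (simp add: h_def \<kappa>l flip: \<kappa>p \<kappa>l(6))
    moreover have "i \<in> {1, 0, -1}" using False by auto
    ultimately show ?thesis by (rule eigen_gr)
  qed
  have "gr i \<subseteq> h ` gr i" for i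
  proof
    fix y assume y: "y \<in> gr i"
    define z where "z = ginv h y"
    have hz: "h z = y" by (simp add: z_def Aut_inv_apply(1)[OF hA])
    have "h z = h (pr L 1 z) + h (pr L 0 z) + h (pr L (-1) z)"
      using pr_sum[of z] by (metis Aut_lin(1)[OF hA])
    then have e: "y = h (pr L 1 z) + h (pr L 0 z) + h (pr L (-1) z)" using hz by simp
    have "pr L i y = h (pr L i z)"
      using int_cases_gr[of i] pr_eq[OF sub[OF pr_gr[of 1 z]] sub[OF pr_gr[of 0 z]] sub[OF pr_gr[of "-1" z]], folded e]
        pr_out[of i z] Aut_lin(3)[OF hA] by auto
    then have "y = h (pr L i z)" using y by (simp add: pr_of_gr)
    then show "y \<in> h ` gr i" using pr_gr by blast
  qed
  with hA sub have "graded_aut h" unfolding graded_aut_def by blast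
  moreover have "\<gamma> = ex x \<circ> h \<circ> ex (- w)"
    using ex_minus[OF signs(1) x] ex_minus[OF signs(2) w] by (auto simp: h_def \<kappa>_def fun_eq_iff)
  moreover have "- w \<in> gr (-1)" using w gr_mem by blast
  ultimately show ?thesis using x by (auto simp: big_cell_def)
qed

end

lemma GL_on_cong:
  assumes "module s" "module.subspace s S" and eq: "\<And>x. x \<in> S \<Longrightarrow> f x = g x" and f: "f \<in> GL_on s S"
  shows "g \<in> GL_on s S"
proof -
  interpret module s by fact
  have f': "f \<in> End_on s S" "bij_betw f S S" using f GL_on_iff[OF assms(1,2)] by blast+
  have "g \<in> End_on s S"
    unfolding End_on_def
  proof (intro CollectI conjI ballI allI)
    show "g \<in> S \<rightarrow> S" using f'(1) eq by (auto simp: End_on_def Pi_iff)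
    show "g (x + y) = g x + g y" if "x \<in> S" "y \<in> S" for x y
      using f'(1) that subspace_add[OF assms(2) that] by (simp add: End_on_def flip: eq)
    show "g (s r x) = s r (g x)" if "x \<in> S" for r x
      using f'(1) that subspace_scale[OF assms(2) that] by (simp add: End_on_def flip: eq)
  qed
  moreover have "bij_betw g S S" using f'(2) bij_betw_cong[of S f g S] eq by simp
  ultimately show ?thesis using GL_on_iff[OF assms(1,2)] by blast
qed

lemma inv_into_cong_on: "(\<And>x. x \<in> S \<Longrightarrow> f x = g x) \<Longrightarrow> inv_into S f y = inv_into S g y"
  unfolding inv_into_def by (rule arg_cong[where f = Eps]) auto

context jordan_lie
begin

lemma graded_complementary: "complementary (gr i) {y. pr L i y = 0}"
proof -
  have "coef L id i i \<in> GL_on sm (gr i)"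
    unfolding GL_on_iff[OF module_axioms gr_subspace]
    by (auto simp: coef_End Aut_id coef_apply pr_of_gr bij_betw_def inj_on_def image_iff)
  then show ?thesis using complementary_iff_GL[OF Aut_id, of i] by simp
qed

lemma ex_signed_Aut: "x \<in> gr 1 \<Longrightarrow> ex x \<in> Aut" "w \<in> gr (-1) \<Longrightarrow> ex w \<in> Aut"
  using ex_Aut by auto

lemma act_cell:
  assumes "graded_aut h" "w \<in> gr (-1)"
  shows "act (ex x \<circ> h \<circ> ex w) (base_flag L 1) = flag_embed L 1 x"
  using act_ex_base[OF signs(1), of w] assms graded_aut_base[OF assms(1) signs(1)]
  by (simp add: act_comp flag_embed_def)

text \<open>For the converse, $e^{ad(x)}$ fixes $o^-$ and moves the transversal pair
  $(o^+, o^-)$ to $(\gamma.o^+, o^-)$.\<close>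

lemma transversal_iff_big_cell:
  assumes "\<gamma> \<in> Aut"
  shows "transversal (act \<gamma> (base_flag L 1)) (base_flag L (-1)) \<longleftrightarrow> big_cell \<gamma>"
proof
  assume "transversal (act \<gamma> (base_flag L 1)) (base_flag L (-1))"
  then show "big_cell \<gamma>"
    using decomposition_if_transversal[OF assms]
    by (simp add: transversal_def act_def base_flag_eq)
next
  assume "big_cell \<gamma>"
  then obtain x h w where x: "x \<in> gr 1" and h: "graded_aut h" "w \<in> gr (-1)" and g: "\<gamma> = ex x \<circ> h \<circ> ex w"
    by (auto simp: big_cell_def)
  have "transversal (base_flag L 1) (base_flag L (-1))"
    using graded_complementary[of 1] graded_complementary[of "-1"] by (simp add: transversal_def base_flag_eq)
  then have "transversal (act (ex x) (base_flag L 1)) (act (ex x) (base_flag L (-1)))"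
    using transversal_act[OF ex_signed_Aut(1)[OF x]] by blast
  then show "transversal (act \<gamma> (base_flag L 1)) (base_flag L (-1))"
    using act_ex_base[OF signs(2), of x] x by (simp add: g act_cell[OF h] flag_embed_def)
qed

lemma big_cell_iff_GL:
  assumes \<gamma>: "\<gamma> \<in> Aut"
  shows "big_cell \<gamma> \<longleftrightarrow> coef L (ginv \<gamma>) 1 1 \<in> GL_on sm (gr 1) \<and> coef L \<gamma> (-1) (-1) \<in> GL_on sm (gr (-1))"
proof -
  have "complementary (gr 1) (\<gamma> ` {y. pr L 1 y = 0}) \<longleftrightarrow> complementary (ginv \<gamma> ` gr 1) {y. pr L 1 y = 0}"
    using complementary_image[OF Aut_inv[OF \<gamma>], of "gr 1" "\<gamma> ` {y. pr L 1 y = 0}"] Aut_bij[OF \<gamma>]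
    by (simp add: bij_is_inj)
  then show ?thesis
    unfolding transversal_iff_big_cell[OF \<gamma>, symmetric]
    by (auto simp: transversal_def act_def base_flag_eq complementary_iff_GL[OF \<gamma>]
        complementary_iff_GL[OF Aut_inv[OF \<gamma>]])
qed

text \<open>The point $d^{-1} n$, the quotient of nominator and denominator; on the big cell it is the coordinate of
  $\gamma.o^+$ in $V^+$.\<close>

definition cell_point :: "('g \<Rightarrow> 'g) \<Rightarrow> 'g" where
  "cell_point \<gamma> = inv_into (gr 1) (coef L (ginv \<gamma>) 1 1) (pr L 1 (ginv \<gamma> EE))"

text \<open>Conjugation by $e^{ad(w)}$ does not affect the component of highest degree, and
  $e^{ad(x)}$ does not affect that of lowest degree. Hence $h$ can be read off from the extremal matrix
  coefficients of $\gamma^{-1}$ and $\gamma$, and applying both to $E$ gives $x$ and $w$.\<close>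

lemma cell_data:
  assumes x: "x \<in> gr 1" and h: "graded_aut h" and w: "w \<in> gr (-1)" and \<gamma>: "\<gamma> = ex x \<circ> h \<circ> ex w"
  shows "ginv \<gamma> = ex (- w) \<circ> ginv h \<circ> ex (- x)"
    "u \<in> gr 1 \<Longrightarrow> coef L (ginv \<gamma>) 1 1 u = ginv h u"
    "u \<in> gr 1 \<Longrightarrow> inv_into (gr 1) (coef L (ginv \<gamma>) 1 1) u = h u"
    "b \<in> gr (-1) \<Longrightarrow> coef L \<gamma> (-1) (-1) b = h b"
    "b \<in> gr (-1) \<Longrightarrow> inv_into (gr (-1)) (coef L \<gamma> (-1) (-1)) b = ginv h b"
    "cell_point \<gamma> = x"
    "ginv h (pr L (-1) (\<gamma> EE)) = w"
proof -
  note hA = graded_autD(1)[OF h] and gA = Aut_inv[OF graded_autD(1)[OF h]]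
  note gh = graded_aut_inv[OF h]
  have mw: "- w \<in> gr (-1)" and mx: "- x \<in> gr 1" using x w gr_mem(4) by blast+
  have \<gamma>A: "\<gamma> \<in> Aut" unfolding \<gamma> by (intro Aut_comp ex_signed_Aut x w hA)
  show gi: "ginv \<gamma> = ex (- w) \<circ> ginv h \<circ> ex (- x)"
  proof
    fix y
    have "\<gamma> ((ex (- w) \<circ> ginv h \<circ> ex (- x)) y) = y"
      using ex_minus(2)[OF signs(2) w] ex_minus(2)[OF signs(1) x] by (simp add: \<gamma> Aut_inv_apply[OF hA])
    then show "ginv \<gamma> y = (ex (- w) \<circ> ginv h \<circ> ex (- x)) y" by (metis Aut_inv_apply(2)[OF \<gamma>A])
  qed
  have pr1: "pr L 1 (ex (- w) y) = pr L 1 y" "pr L (-1) (ex x y) = pr L (-1) y" for y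
    using pr_ex(3)[OF signs(2) mw, of y] pr_ex(3)[OF signs(1) x, of y] by simp_all
  have c1: "coef L (ginv \<gamma>) 1 1 u = ginv h u" if "u \<in> gr 1" for u
    using that ex_same[OF signs(1) mx that] graded_autD(2)[OF gh that]
    by (simp add: coef_apply gi pr1 pr_of_gr)
  have c2: "coef L \<gamma> (-1) (-1) b = h b" if "b \<in> gr (-1)" for b
    using that ex_same[OF signs(2) w that] graded_autD(2)[OF h that]
    by (simp add: coef_apply \<gamma> pr1 pr_of_gr)
  have inj1: "inj_on (coef L (ginv \<gamma>) 1 1) (gr 1)"
    by (rule inj_onI) (metis c1 Aut_inj[OF gA])
  have inj2: "inj_on (coef L \<gamma> (-1) (-1)) (gr (-1))"
    by (rule inj_onI) (metis c2 Aut_inj[OF hA])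
  have i1: "inv_into (gr 1) (coef L (ginv \<gamma>) 1 1) u = h u" if "u \<in> gr 1" for u
    using inv_into_f_f[OF inj1 graded_autD(2)[OF h that]] c1[OF graded_autD(2)[OF h that]]
    by (simp add: Aut_inv_apply[OF hA])
  have i2: "inv_into (gr (-1)) (coef L \<gamma> (-1) (-1)) b = ginv h b" if "b \<in> gr (-1)" for b
    using inv_into_f_f[OF inj2 graded_autD(2)[OF gh that]] c2[OF graded_autD(2)[OF gh that]]
    by (simp add: Aut_inv_apply[OF hA])
  show "u \<in> gr 1 \<Longrightarrow> coef L (ginv \<gamma>) 1 1 u = ginv h u"
    "u \<in> gr 1 \<Longrightarrow> inv_into (gr 1) (coef L (ginv \<gamma>) 1 1) u = h u"
    "b \<in> gr (-1) \<Longrightarrow> coef L \<gamma> (-1) (-1) b = h b"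
    "b \<in> gr (-1) \<Longrightarrow> inv_into (gr (-1)) (coef L \<gamma> (-1) (-1)) b = ginv h b"
    using c1 c2 i1 i2 by blast+
  have "pr L 1 (ginv \<gamma> EE) = ginv h x"
    using ex_euler[OF signs(1) mx] x euler_gr
    by (simp add: gi pr1 graded_aut_pr[OF gh] pr_lin pr_of_gr)
  then show "cell_point \<gamma> = x"
    using i1[OF graded_autD(2)[OF gh x]] by (simp add: cell_point_def Aut_inv_apply[OF hA])
  have "pr L (-1) (\<gamma> EE) = h w"
    using ex_euler[OF signs(2) w] w euler_gr
    by (simp add: \<gamma> pr1 graded_aut_pr[OF h] pr_lin pr_of_gr)
  then show "ginv h (pr L (-1) (\<gamma> EE)) = w" by (simp add: Aut_inv_apply[OF hA])
qed

lemma big_cell_obtain: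
  assumes "big_cell \<gamma>"
  obtains h w where "cell_point \<gamma> \<in> gr 1" "graded_aut h" "w \<in> gr (-1)" "\<gamma> = ex (cell_point \<gamma>) \<circ> h \<circ> ex w"
proof -
  obtain x h w where c: "x \<in> gr 1" "graded_aut h" "w \<in> gr (-1)" "\<gamma> = ex x \<circ> h \<circ> ex w"
    using assms by (auto simp: big_cell_def)
  have "cell_point \<gamma> = x" by (rule cell_data(6)[OF c])
  with c have "cell_point \<gamma> \<in> gr 1" "\<gamma> = ex (cell_point \<gamma>) \<circ> h \<circ> ex w" by simp_all
  from that[OF this(1) c(2,3) this(2)] show ?thesis .
qed

lemma big_cell_point_gr: "big_cell \<gamma> \<Longrightarrow> cell_point \<gamma> \<in> gr 1"
  by (erule big_cell_obtain)

lemma act_big_cell: "big_cell \<gamma> \<Longrightarrow> act \<gamma> (base_flag L 1) = flag_embed L 1 (cell_point \<gamma>)"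
  by (erule big_cell_obtain) (metis act_cell)

text \<open>An element $d$ with $e^{ad(d)}$ fixing $o^+$ is zero, as $e^{ad(d)} E = E - d$ has to stay in
  $g_0 + g_{-1}$.\<close>

lemma flag_embed_inj:
  assumes "x \<in> gr 1" "x' \<in> gr 1" "flag_embed L 1 x = flag_embed L 1 x'"
  shows "x = x'"
proof -
  define d where "d = - x' + x"
  have mx: "- x' \<in> gr 1" and d: "d \<in> gr 1" unfolding d_def using assms gr_mem by blast+
  have "act (ex (- x') \<circ> ex x) (base_flag L 1) = act (ex (- x') \<circ> ex x') (base_flag L 1)"
    using assms(3) by (simp add: act_comp flag_embed_def)
  then have "act (ex d) (base_flag L 1) = base_flag L 1"
    using ex_add[OF signs(1) mx assms(1)] ex_add[OF signs(1) mx assms(2)] by (simp add: ex_0 act_id d_def)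
  then have "ex d ` {y. pr L 1 y = 0} = {y. pr L 1 y = 0}"
    by (simp add: act_def base_flag_eq)
  moreover have "EE \<in> {y. pr L 1 y = 0}" using euler_gr by (simp add: pr_of_gr)
  ultimately have "pr L 1 (ex d EE) = 0" by blast
  then have "d = 0" using ex_euler[OF signs(1) d] d euler_gr by (simp add: pr_lin pr_of_gr)
  then show ?thesis by (simp add: d_def)
qed

text \<open>Both sides depend only on the flag $\gamma.o^+$, and all $e^{ad(x)}$ are in the big cell.\<close>

lemma in_embed_iff_big_cell:
  assumes "\<gamma> \<in> Aut"
  shows "act \<gamma> (base_flag L 1) \<in> flag_embed L 1 ` gr 1 \<longleftrightarrow> big_cell \<gamma>"
proof
  assume "act \<gamma> (base_flag L 1) \<in> flag_embed L 1 ` gr 1"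
  then obtain x where x: "x \<in> gr 1" "act \<gamma> (base_flag L 1) = act (ex x) (base_flag L 1)"
    by (auto simp: flag_embed_def)
  have "ex x = ex x \<circ> id \<circ> ex 0" by (simp add: ex_0)
  then have "big_cell (ex x)" using x(1) graded_aut_id gr_mem(1) unfolding big_cell_def by blast
  then show "big_cell \<gamma>"
    using transversal_iff_big_cell[OF assms] transversal_iff_big_cell[OF ex_signed_Aut(1)[OF x(1)]] x(2) by simp
next
  assume "big_cell \<gamma>"
  then show "act \<gamma> (base_flag L 1) \<in> flag_embed L 1 ` gr 1"
    using act_big_cell big_cell_point_gr by blast
qed

lemma cell_point_eq:
  assumes "\<gamma> \<in> Aut" "x \<in> gr 1" "act \<gamma> (base_flag L 1) = flag_embed L 1 x"
  shows "big_cell \<gamma>" "cell_point \<gamma> = x"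
proof -
  show b: "big_cell \<gamma>" using in_embed_iff_big_cell[OF assms(1)] assms by blast
  show "cell_point \<gamma> = x"
    using flag_embed_inj[OF big_cell_point_gr[OF b] assms(2)] act_big_cell[OF b] assms(3) by simp
qed

text \<open>The Bergman operators are the two extremal coefficients for the product
  $e^{ad(a)} e^{ad(x)}$, which is why quasi-invertibility is membership in the big cell.\<close>

lemma bergman_coef:
  assumes x: "x \<in> gr 1" and a: "a \<in> gr (-1)"
  shows "u \<in> gr 1 \<Longrightarrow> coef L (ginv (ex a \<circ> ex x)) 1 1 u = bergman L x a u"
    "b \<in> gr (-1) \<Longrightarrow> coef L (ex a \<circ> ex x) (-1) (-1) b = bergman L a x b"
proof -
  have mx: "- x \<in> gr 1" and ma: "- a \<in> gr (-1)" using x a gr_mem by blast+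
  have gi: "ginv (ex a \<circ> ex x) = ex (- x) \<circ> ex (- a)"
  proof
    fix y
    have "(ex a \<circ> ex x) ((ex (- x) \<circ> ex (- a)) y) = y"
      using ex_minus(2)[OF signs(1) x] ex_minus(2)[OF signs(2) a] by simp
    then show "ginv (ex a \<circ> ex x) y = (ex (- x) \<circ> ex (- a)) y"
      using Aut_inv_apply(2)[OF Aut_comp[OF ex_signed_Aut(2)[OF a] ex_signed_Aut(1)[OF x]]] by metis
  qed
  { assume u: "u \<in> gr 1"
    note p = pr_ex[OF signs(2) ma, of u, simplified]
    show "coef L (ginv (ex a \<circ> ex x)) 1 1 u = bergman L x a u"
      using u by (simp add: coef_apply gi pr_ex[OF signs(1) mx] p pr_of_gr br_lin bergman_def quarter) }
  { assume b: "b \<in> gr (-1)"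
    note p = pr_ex[OF signs(1) x, of b] and q = pr_ex[OF signs(2) a, simplified]
    show "coef L (ex a \<circ> ex x) (-1) (-1) b = bergman L a x b"
      using b by (simp add: coef_apply p q pr_of_gr br_lin bergman_def quarter) }
qed

lemma bergman_big_cell:
  assumes x: "x \<in> gr 1" and a: "a \<in> gr (-1)"
  shows "big_cell (ex a \<circ> ex x) \<longleftrightarrow> bergman L x a \<in> GL_on sm (gr 1) \<and> bergman L a x \<in> GL_on sm (gr (-1))"
proof -
  note c = GL_on_cong[OF module_axioms gr_subspace]
  have "coef L (ginv (ex a \<circ> ex x)) 1 1 \<in> GL_on sm (gr 1) \<longleftrightarrow> bergman L x a \<in> GL_on sm (gr 1)"
    using c[of 1 "coef L (ginv (ex a \<circ> ex x)) 1 1" "bergman L x a"]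
      c[of 1 "bergman L x a" "coef L (ginv (ex a \<circ> ex x)) 1 1"] bergman_coef(1)[OF x a] by auto
  moreover have "coef L (ex a \<circ> ex x) (-1) (-1) \<in> GL_on sm (gr (-1)) \<longleftrightarrow> bergman L a x \<in> GL_on sm (gr (-1))"
    using c[of "-1" "coef L (ex a \<circ> ex x) (-1) (-1)" "bergman L a x"]
      c[of "-1" "bergman L a x" "coef L (ex a \<circ> ex x) (-1) (-1)"] bergman_coef(2)[OF x a] by auto
  ultimately show ?thesis
    using big_cell_iff_GL[OF Aut_comp[OF ex_signed_Aut(2)[OF a] ex_signed_Aut(1)[OF x]]] by simp
qed

end

section \<open>Reversal of the grading\<close>

text \<open>Exchanging $V^+$ and $V^-$ turns statements about $X^+$ into statements about $X^-$.\<close>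

definition flip :: "('k, 'g::ab_group_add) graded_lie \<Rightarrow> ('k, 'g) graded_lie" where
  "flip L = L\<lparr>grade := \<lambda>k. grade L (- k), euler := - euler L, gtop := \<lambda>k. gtop L (- k)\<rparr>"

lemma flip_simps [simp]: "smul (flip L) = smul L" "brk (flip L) = brk L" "grade (flip L) k = grade L (- k)"
  "euler (flip L) = - euler L" "gtop (flip L) k = gtop L (- k)"
  by (simp_all add: flip_def)

lemma flip_const: "lie_aut (flip L) = lie_aut L" "exp_ad (flip L) = exp_ad L" "bergman (flip L) = bergman L"
  "elementary_group (flip L) = elementary_group L" 
  "base_flag (flip L) \<sigma> = base_flag L (- \<sigma>)" "flag_embed (flip L) \<sigma> = flag_embed L (- \<sigma>)"
  "proj_completion (flip L) \<sigma> = proj_completion L (- \<sigma>)" "chart_dom (flip L) \<sigma> = chart_dom L (- \<sigma>)"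
  "chart_map (flip L) \<sigma> = chart_map L (- \<sigma>)" "chart_atlas (flip L) \<sigma> = chart_atlas L (- \<sigma>)"
  "completion_with (flip L) \<sigma> = completion_with L (- \<sigma>)"
proof -
  show l: "lie_aut (flip L) = lie_aut L" by (simp add: lie_aut_def)
  show e: "exp_ad (flip L) = exp_ad L" by (simp add: exp_ad_def fun_eq_iff)
  show "bergman (flip L) = bergman L" by (simp add: bergman_def fun_eq_iff)
  show g: "elementary_group (flip L) = elementary_group L"
    by (simp add: elementary_group_def l e Un_commute)
  show b: "base_flag (flip L) \<sigma> = base_flag L (- \<sigma>)" for \<sigma> by (simp add: base_flag_def)
  show f: "flag_embed (flip L) \<sigma> = flag_embed L (- \<sigma>)" for \<sigma> by (simp add: flag_embed_def b e fun_eq_iff)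
  show p: "proj_completion (flip L) \<sigma> = proj_completion L (- \<sigma>)" for \<sigma> by (simp add: proj_completion_def g b)
  show c: "chart_dom (flip L) \<sigma> = chart_dom L (- \<sigma>)" for \<sigma> by (simp add: chart_dom_def f fun_eq_iff)
  show m: "chart_map (flip L) \<sigma> = chart_map L (- \<sigma>)" for \<sigma> by (simp add: chart_map_def f fun_eq_iff)
  show a: "chart_atlas (flip L) \<sigma> = chart_atlas L (- \<sigma>)" for \<sigma> by (simp add: chart_atlas_def c m g)
  show w: "completion_with (flip L) \<sigma> = completion_with L (- \<sigma>)" for \<sigma>
    by (simp add: completion_with_def a fun_eq_iff)
qed

lemma completion_manifold_flip: "completion_manifold (flip L) \<sigma> = completion_manifold L (- \<sigma>)"
  by (simp add: completion_manifold_def flip_const)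

lemma three_graded_flip:
  assumes "three_graded_lie_algebra L"
  shows "three_graded_lie_algebra (flip L)"
  unfolding three_graded_lie_algebra_def
proof (intro conjI allI ballI impI)
  note L = assms[unfolded three_graded_lie_algebra_def]
  interpret module "smul L" using L by (simp add: lie_algebra_def)
  show "lie_algebra (flip L)" using L by (simp add: lie_algebra_def)
  show "module.subspace (smul (flip L)) (grade (flip L) k)" for k using L by simp
  show "grade (flip L) k = {0}" if "\<bar>k\<bar> > 1" for k using L that by simp
  show "brk (flip L) x y \<in> grade (flip L) (k + l)" if "x \<in> grade (flip L) k" "y \<in> grade (flip L) l" for k l x y
  proof -
    have b: "\<forall>k l. \<forall>x \<in> grade L k. \<forall>y \<in> grade L l. brk L x y \<in> grade L (k + l)" using L by blast
    have "brk L x y \<in> grade L (- k + - l)" by (intro b[rule_format]) (use that in simp_all)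
    then show ?thesis unfolding flip_simps minus_add_distrib .
  qed
  show "brk (flip L) (euler (flip L)) x = smul (flip L) (of_int k) x" if "x \<in> grade (flip L) k" for k x
  proof -
    have h: "module_hom (smul L) (smul L) (\<lambda>y. brk L y x)" using L by (simp add: lie_algebra_def)
    have "brk L (euler L) x = smul L (of_int (- k)) x" using L that by simp
    then show ?thesis using module_hom.neg[OF h, of "euler L"] by simp
  qed
  show "\<exists>!(a, b, c). a \<in> grade (flip L) 1 \<and> b \<in> grade (flip L) 0 \<and> c \<in> grade (flip L) (-1) \<and> x = a + b + c" for x
  proof -
    let ?P = "\<lambda>p. case p of (a, b, c) \<Rightarrow> a \<in> grade L 1 \<and> b \<in> grade L 0 \<and> c \<in> grade L (-1) \<and> x = a + b + c"
    have "\<exists>!p. ?P p" using L by blast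
    then obtain p where p: "?P p" "\<And>q. ?P q \<Longrightarrow> q = p" by blast
    obtain a b c where abc: "p = (a, b, c)" by (cases p)
    show ?thesis
    proof (rule ex1I[of _ "(c, b, a)"])
      show "case (c, b, a) of (a, b, c) \<Rightarrow> a \<in> grade (flip L) 1 \<and> b \<in> grade (flip L) 0 \<and> c \<in> grade (flip L) (-1) \<and> x = a + b + c"
        using p(1) by (simp add: abc algebra_simps)
      fix q assume q: "case q of (a, b, c) \<Rightarrow> a \<in> grade (flip L) 1 \<and> b \<in> grade (flip L) 0 \<and> c \<in> grade (flip L) (-1) \<and> x = a + b + c"
      obtain a' b' c' where q': "q = (a', b', c')" by (cases q)
      have "?P (c', b', a')" using q by (simp add: q' algebra_simps)
      then show "q = (c, b, a)" using p(2) by (fastforce simp: q' abc)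
    qed
  qed
qed

context jordan_lie
begin

lemma jordan_lie_flip: "jordan_lie (flip L)"
  by unfold_locales (use two three_graded_flip[OF graded] automorphic in
    \<open>auto simp: exp_ad_automorphic_def flip_const\<close>)

end

section \<open>Continuity at a point\<close>

text \<open>Continuity at one point, for functions that may behave arbitrarily away from it. Neighbourhood
  filters which contain the point itself make the value at the point a special case of eventual
  properties.\<close>

definition cont_at :: "'i topology \<Rightarrow> 'i \<Rightarrow> 'a topology \<Rightarrow> ('i \<Rightarrow> 'a) \<Rightarrow> bool" where
  "cont_at Y y T f \<longleftrightarrow> y \<in> topspace Y \<and> limitin T f (f y) (nhdsin Y y)"

lemma eventually_nhdsin_at: "eventually P (nhdsin Y y) \<Longrightarrow> y \<in> topspace Y \<Longrightarrow> P y"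
  by (auto simp: eventually_nhdsin)

lemma continuous_map_iff_cont_at: "continuous_map Y T f \<longleftrightarrow> (\<forall>y \<in> topspace Y. cont_at Y y T f)"
proof
  assume f: "continuous_map Y T f"
  show "\<forall>y \<in> topspace Y. cont_at Y y T f"
  proof
    fix y assume y: "y \<in> topspace Y"
    have "f y \<in> topspace T" using continuous_map_image_subset_topspace[OF f] y by blast
    moreover have "eventually (\<lambda>x. f x \<in> U) (nhdsin Y y)" if "openin T U" "f y \<in> U" for U
      unfolding eventually_nhdsin
      using openin_continuous_map_preimage[OF f that(1)] y that(2)
      by (intro disjI2 exI[of _ "{x \<in> topspace Y. f x \<in> U}"]) simp
    ultimately show "cont_at Y y T f" using y by (simp add: cont_at_def limitin_def)
  qed
next
  assume h: "\<forall>y \<in> topspace Y. cont_at Y y T f"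
  show "continuous_map Y T f"
    unfolding continuous_map_def
  proof (intro conjI allI impI)
    show "f \<in> topspace Y \<rightarrow> topspace T" using h by (auto simp: cont_at_def dest: limitin_topspace)
    fix U assume U: "openin T U"
    show "openin Y {x \<in> topspace Y. f x \<in> U}"
    proof (subst openin_subopen, intro ballI)
      fix x assume x: "x \<in> {x \<in> topspace Y. f x \<in> U}"
      then have "eventually (\<lambda>x. f x \<in> U) (nhdsin Y x)"
        using h U by (auto simp: cont_at_def limitin_def)
      then obtain S where "openin Y S" "x \<in> S" "\<forall>y \<in> S. f y \<in> U"
        using x by (auto simp: eventually_nhdsin)
      then show "\<exists>S. openin Y S \<and> x \<in> S \<and> S \<subseteq> {x \<in> topspace Y. f x \<in> U}"
        using openin_subset by (intro exI[of _ S]) blast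
    qed
  qed
qed

lemma cont_at_compose:
  assumes "cont_at Y y T f" "continuous_map T T' g"
  shows "cont_at Y y T' (\<lambda>i. g (f i))"
  using assms continuous_map_limit[OF assms(2)] by (auto simp: cont_at_def o_def)

lemma cont_at_pair:
  "cont_at Y y (prod_topology T T') (\<lambda>i. (f i, g i)) \<longleftrightarrow> cont_at Y y T f \<and> cont_at Y y T' g"
  by (auto simp: cont_at_def limitin_pairwise o_def)

lemma cont_at_cong:
  assumes "eventually (\<lambda>i. f i = g i) (nhdsin Y y)" "cont_at Y y T f"
  shows "cont_at Y y T g"
  using assms limitin_transform_eventually[OF assms(1)] eventually_nhdsin_at[OF assms(1)]
  by (auto simp: cont_at_def)

lemma cont_at_mem: "cont_at Y y T f \<Longrightarrow> eventually (\<lambda>i. f i \<in> topspace T) (nhdsin Y y)"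
  by (auto simp: cont_at_def limitin_def)

lemma cont_at_subtopology:
  "cont_at Y y (subtopology T S) f \<longleftrightarrow> cont_at Y y T f \<and> eventually (\<lambda>i. f i \<in> S) (nhdsin Y y)"
  using eventually_nhdsin_at by (fastforce simp: cont_at_def limitin_subtopology)

section \<open>Families with values in the Lie algebra\<close>

locale topological_jordan_lie = jordan_lie L
  for L :: "('k::{comm_ring_1, topological_space}, 'g::ab_group_add) graded_lie" +
  assumes jordan: "topological_jordan_pair L"
begin

abbreviation "Vt \<equiv> gtop L"

lemma Vt_space: "\<sigma> \<in> {1, -1} \<Longrightarrow> topspace (Vt \<sigma>) = gr \<sigma>"
  and Vt_topological_module: "\<sigma> \<in> {1, -1} \<Longrightarrow> topological_module sm (Vt \<sigma>)"
  and Vt_triple: "\<sigma> \<in> {1, -1} \<Longrightarrow> continuous_map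
          (prod_topology (Vt \<sigma>) (prod_topology (Vt (- \<sigma>)) (Vt \<sigma>))) (Vt \<sigma>)
          (\<lambda>(x, y, z). jordan_triple L x y z)"
  using jordan by (auto simp: topological_jordan_pair_def)

lemma Vt_space1 [simp]: "topspace (Vt 1) = gr 1" "topspace (Vt (-1)) = gr (-1)"
  using Vt_space by auto

lemma Vt_continuous_module: "\<sigma> \<in> {1, -1} \<Longrightarrow> continuous_module sm (Vt \<sigma>)"
  by (simp add: Vt_topological_module topological_module_continuous_module)

text \<open>Abstracts from continuity at a point and from smoothness on a set: \<open>P \<sigma>\<close> is a class of families with
  values in $V^\sigma$, determined by the behaviour of families along the filter \<open>F\<close>, and closed under the
  operations of the Jordan pair.\<close>

definition closed_class :: "'i filter \<Rightarrow> (int \<Rightarrow> ('i \<Rightarrow> 'g) \<Rightarrow> bool) \<Rightarrow> bool" where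
  "closed_class F P \<longleftrightarrow> (\<forall>\<sigma> \<in> {1, -1}.
     (\<forall>f. P \<sigma> f \<longrightarrow> eventually (\<lambda>i. f i \<in> gr \<sigma>) F) \<and>
     (\<forall>f g. P \<sigma> f \<longrightarrow> eventually (\<lambda>i. f i = g i) F \<longrightarrow> P \<sigma> g) \<and>
     P \<sigma> (\<lambda>_. 0) \<and>
     (\<forall>f g. P \<sigma> f \<longrightarrow> P \<sigma> g \<longrightarrow> P \<sigma> (\<lambda>i. f i + g i)) \<and>
     (\<forall>r f. P \<sigma> f \<longrightarrow> P \<sigma> (\<lambda>i. r \<cdot> f i)) \<and>
     (\<forall>f g h. P \<sigma> f \<longrightarrow> P (- \<sigma>) g \<longrightarrow> P \<sigma> h \<longrightarrow> P \<sigma> (\<lambda>i. \<lbrakk>\<lbrakk>f i, g i\<rbrakk>, h i\<rbrakk>)))"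

lemma closed_classD:
  assumes "closed_class F P" "\<sigma> \<in> {1, -1}"
  shows "P \<sigma> f \<Longrightarrow> eventually (\<lambda>i. f i \<in> gr \<sigma>) F"
    "P \<sigma> f \<Longrightarrow> eventually (\<lambda>i. f i = g i) F \<Longrightarrow> P \<sigma> g"
    "P \<sigma> (\<lambda>_. 0)"
    "P \<sigma> f \<Longrightarrow> P \<sigma> g \<Longrightarrow> P \<sigma> (\<lambda>i. f i + g i)"
    "P \<sigma> f \<Longrightarrow> P \<sigma> (\<lambda>i. r \<cdot> f i)"
    "P \<sigma> f \<Longrightarrow> P (- \<sigma>) g \<Longrightarrow> P \<sigma> h \<Longrightarrow> P \<sigma> (\<lambda>i. \<lbrakk>\<lbrakk>f i, g i\<rbrakk>, h i\<rbrakk>)"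
    "P \<sigma> f \<Longrightarrow> P \<sigma> (\<lambda>i. - f i)"
proof -
  have a: "(\<forall>f. P \<sigma> f \<longrightarrow> eventually (\<lambda>i. f i \<in> gr \<sigma>) F) \<and>
     (\<forall>f g. P \<sigma> f \<longrightarrow> eventually (\<lambda>i. f i = g i) F \<longrightarrow> P \<sigma> g) \<and>
     P \<sigma> (\<lambda>_. 0) \<and>
     (\<forall>f g. P \<sigma> f \<longrightarrow> P \<sigma> g \<longrightarrow> P \<sigma> (\<lambda>i. f i + g i)) \<and>
     (\<forall>r f. P \<sigma> f \<longrightarrow> P \<sigma> (\<lambda>i. r \<cdot> f i)) \<and>
     (\<forall>f g h. P \<sigma> f \<longrightarrow> P (- \<sigma>) g \<longrightarrow> P \<sigma> h \<longrightarrow> P \<sigma> (\<lambda>i. \<lbrakk>\<lbrakk>f i, g i\<rbrakk>, h i\<rbrakk>))"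
    using assms unfolding closed_class_def by blast
  show "P \<sigma> f \<Longrightarrow> eventually (\<lambda>i. f i \<in> gr \<sigma>) F"
    "P \<sigma> f \<Longrightarrow> eventually (\<lambda>i. f i = g i) F \<Longrightarrow> P \<sigma> g"
    "P \<sigma> (\<lambda>_. 0)"
    "P \<sigma> f \<Longrightarrow> P \<sigma> g \<Longrightarrow> P \<sigma> (\<lambda>i. f i + g i)"
    "P \<sigma> f \<Longrightarrow> P \<sigma> (\<lambda>i. r \<cdot> f i)"
    "P \<sigma> f \<Longrightarrow> P (- \<sigma>) g \<Longrightarrow> P \<sigma> h \<Longrightarrow> P \<sigma> (\<lambda>i. \<lbrakk>\<lbrakk>f i, g i\<rbrakk>, h i\<rbrakk>)"
    using a by auto
  assume "P \<sigma> f"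
  then have "P \<sigma> (\<lambda>i. (-1) \<cdot> f i)" using a by blast
  then show "P \<sigma> (\<lambda>i. - f i)" by simp
qed

text \<open>The component in $g_0$ is tested through its action on families with values in $V^\pm$, in place of the
  topology that $g_0$ lacks.\<close>

definition gclass :: "(int \<Rightarrow> ('i \<Rightarrow> 'g) \<Rightarrow> bool) \<Rightarrow> ('i \<Rightarrow> 'g) \<Rightarrow> bool" where
  "gclass P f \<longleftrightarrow> (\<forall>\<sigma> \<in> {1, -1}. P \<sigma> (\<lambda>i. pr L \<sigma> (f i)) \<and>
     (\<forall>v. P \<sigma> v \<longrightarrow> P \<sigma> (\<lambda>i. \<lbrakk>pr L 0 (f i), v i\<rbrakk>)))"

lemma gclassD: "gclass P f \<Longrightarrow> \<sigma> \<in> {1, -1} \<Longrightarrow> P \<sigma> (\<lambda>i. pr L \<sigma> (f i))"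
  "gclass P f \<Longrightarrow> \<sigma> \<in> {1, -1} \<Longrightarrow> P \<sigma> v \<Longrightarrow> P \<sigma> (\<lambda>i. \<lbrakk>pr L 0 (f i), v i\<rbrakk>)"
  unfolding gclass_def by blast+

text \<open>If \<open>a\<close> has degree $\sigma$, the component $[a, f_0]$ is of the kind that the test on $g_0$ controls,
  and the new contribution $[a, f_{-\sigma}]$ in degree 0 acts by Jordan triple products.\<close>

lemma gclass_ex:
  assumes P: "closed_class F P" and \<sigma>: "\<sigma> \<in> {1, -1}" and a: "P \<sigma> a" and f: "gclass P f"
  shows "gclass P (\<lambda>i. ex (a i) (f i))"
proof -
  have m: "- \<sigma> \<in> {1, -1}" using \<sigma> by auto
  note D = closed_classD[OF P \<sigma>] and Dm = closed_classD[OF P m]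
  have ev: "eventually (\<lambda>i. a i \<in> gr \<sigma>) F" by (rule D(1)[OF a])
  let ?p = "\<lambda>i. pr L (- \<sigma>) (f i)"
  have p: "P (- \<sigma>) ?p" by (rule gclassD(1)[OF f m])
  have "P \<sigma> (\<lambda>i. (pr L \<sigma> (f i) + - \<lbrakk>pr L 0 (f i), a i\<rbrakk>) + half \<cdot> - \<lbrakk>\<lbrakk>a i, ?p i\<rbrakk>, a i\<rbrakk>)"
    by (intro D(4-7) gclassD[OF f \<sigma>] a p)
  moreover have "eventually (\<lambda>i. (pr L \<sigma> (f i) + - \<lbrakk>pr L 0 (f i), a i\<rbrakk>) + half \<cdot> - \<lbrakk>\<lbrakk>a i, ?p i\<rbrakk>, a i\<rbrakk>
      = pr L \<sigma> (ex (a i) (f i))) F"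
    using ev
  proof eventually_elim
    case (elim i)
    then show ?case
      using br_anti[of "pr L 0 (f i)" "a i"] br_anti[of "\<lbrakk>a i, ?p i\<rbrakk>" "a i"]
      by (simp add: pr_ex[OF \<sigma> elim])
  qed
  ultimately have 1: "P \<sigma> (\<lambda>i. pr L \<sigma> (ex (a i) (f i)))" by (rule D(2))
  have 2: "P (- \<sigma>) (\<lambda>i. pr L (- \<sigma>) (ex (a i) (f i)))"
    by (rule Dm(2)[OF p eventually_mono[OF ev]]) (simp add: pr_ex[OF \<sigma>])
  have 3: "P \<sigma> (\<lambda>i. \<lbrakk>pr L 0 (ex (a i) (f i)), v i\<rbrakk>)" if v: "P \<sigma> v" for v
  proof -
    have "P \<sigma> (\<lambda>i. \<lbrakk>pr L 0 (f i), v i\<rbrakk> + \<lbrakk>\<lbrakk>a i, ?p i\<rbrakk>, v i\<rbrakk>)"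
      by (intro D(4-7) gclassD[OF f \<sigma>] a p v)
    from D(2)[OF this eventually_mono[OF ev]] show ?thesis
      by (simp add: pr_ex[OF \<sigma>] br_lin)
  qed
  have 4: "P (- \<sigma>) (\<lambda>i. \<lbrakk>pr L 0 (ex (a i) (f i)), v i\<rbrakk>)" if v: "P (- \<sigma>) v" for v
  proof -
    have a': "P (- (- \<sigma>)) a" using a by simp
    have "P (- \<sigma>) (\<lambda>i. \<lbrakk>pr L 0 (f i), v i\<rbrakk> + - \<lbrakk>\<lbrakk>?p i, a i\<rbrakk>, v i\<rbrakk>)"
      by (intro Dm(4-7) gclassD[OF f m] a' p v)
    then show ?thesis
    proof (rule Dm(2))
      show "eventually (\<lambda>i. \<lbrakk>pr L 0 (f i), v i\<rbrakk> + - \<lbrakk>\<lbrakk>?p i, a i\<rbrakk>, v i\<rbrakk> = \<lbrakk>pr L 0 (ex (a i) (f i)), v i\<rbrakk>) F"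
        using ev
      proof eventually_elim
        case (elim i)
        show ?case using br_anti[of "?p i" "a i"] by (simp add: pr_ex[OF \<sigma> elim] br_lin)
      qed
    qed
  qed
  show ?thesis
    unfolding gclass_def using \<sigma> 1 2 3 4 by auto
qed

text \<open>A family of arguments of exponentials; the sign is the same for the whole family.\<close>

definition letter_family :: "(int \<Rightarrow> ('i \<Rightarrow> 'g) \<Rightarrow> bool) \<Rightarrow> ('i \<Rightarrow> 'g) \<Rightarrow> bool" where
  "letter_family P a \<longleftrightarrow> P 1 a \<or> P (-1) a"

definition word_at :: "('i \<Rightarrow> 'g) list \<Rightarrow> 'i \<Rightarrow> 'g \<Rightarrow> 'g" where
  "word_at as i = word (map (\<lambda>a. a i) as)"

lemma word_at_simps: "word_at [] i = id" "word_at (a # as) i = ex (a i) \<circ> word_at as i"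
  by (simp_all add: word_at_def)

lemma gclass_word:
  assumes P: "closed_class F P" and as: "\<And>a. a \<in> set as \<Longrightarrow> letter_family P a" and f: "gclass P f"
  shows "gclass P (\<lambda>i. word_at as i (f i))"
  using as
proof (induction as)
  case Nil then show ?case using f by (simp add: word_at_simps)
next
  case (Cons a as)
  then have "gclass P (\<lambda>i. word_at as i (f i))" "P 1 a \<or> P (-1) a" by (auto simp: letter_family_def)
  then show ?case
    using gclass_ex[OF P signs(1)] gclass_ex[OF P signs(2)] by (auto simp: word_at_simps)
qed

lemma gclass_homogeneous:
  assumes P: "closed_class F P" and \<sigma>: "\<sigma> \<in> {1, -1}" and u: "P \<sigma> u"
  shows "gclass P u"
proof -
  have ev: "eventually (\<lambda>i. u i \<in> gr \<sigma>) F" by (rule closed_classD(1)[OF P \<sigma> u])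
  have z: "P \<tau> f" if "eventually (\<lambda>i. 0 = f i) F" "\<tau> \<in> {1, -1}" for \<tau> f
    by (rule closed_classD(2)[OF P that(2) closed_classD(3)[OF P that(2)] that(1)])
  have "P \<tau> (\<lambda>i. \<lbrakk>pr L 0 (u i), v i\<rbrakk>)" if "\<tau> \<in> {1, -1}" for \<tau> v
    by (rule z[OF eventually_mono[OF ev] that]) (use \<sigma> in \<open>auto simp: pr_of_gr br_lin\<close>)
  moreover have "P \<tau> (\<lambda>i. pr L \<tau> (u i))" if \<tau>: "\<tau> \<in> {1, -1}" for \<tau>
  proof (cases "\<tau> = \<sigma>")
    case True
    show ?thesis unfolding True
      by (rule closed_classD(2)[OF P \<sigma> u eventually_mono[OF ev]]) (simp add: pr_of_gr)
  next
    case False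
    show ?thesis
      by (rule z[OF eventually_mono[OF ev] \<tau>]) (use False in \<open>simp add: pr_of_gr\<close>)
  qed
  ultimately show ?thesis by (simp add: gclass_def)
qed

lemma gclass_euler:
  assumes P: "closed_class F P"
  shows "gclass P (\<lambda>_. EE)"
proof -
  have "P \<tau> (\<lambda>i. \<lbrakk>EE, v i\<rbrakk>)" if \<tau>: "\<tau> \<in> {1, -1}" and v: "P \<tau> v" for \<tau> v
    by (rule closed_classD(2)[OF P \<tau> closed_classD(5)[OF P \<tau> v, of "of_int \<tau>"]
          eventually_mono[OF closed_classD(1)[OF P \<tau> v]]]) (simp add: euler_br)
  then show ?thesis
    using closed_classD(3)[OF P signs(1)] closed_classD(3)[OF P signs(2)]
    by (auto simp: gclass_def pr_of_gr[OF euler_gr])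
qed

definition inv_letters :: "('i \<Rightarrow> 'g) list \<Rightarrow> ('i \<Rightarrow> 'g) list" where
  "inv_letters as = rev (map (\<lambda>a i. - a i) as)"

lemma inv_letters_family:
  assumes P: "closed_class F P" and as: "\<And>a. a \<in> set as \<Longrightarrow> letter_family P a" and "b \<in> set (inv_letters as)"
  shows "letter_family P b"
  using assms(2,3) closed_classD(7)[OF P signs(1)] closed_classD(7)[OF P signs(2)]
  by (fastforce simp: inv_letters_def letter_family_def)

lemma word_at_Aut: "(\<And>a. a \<in> set as \<Longrightarrow> a i \<in> letters) \<Longrightarrow> word_at as i \<in> Aut"
  unfolding word_at_def by (rule word_Aut) auto

lemma ginv_word_at:
  assumes "\<And>a. a \<in> set as \<Longrightarrow> a i \<in> letters"
  shows "ginv (word_at as i) = word_at (inv_letters as) i"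
  using word_inverse[of "map (\<lambda>a. a i) as"] assms
  by (auto simp: word_at_def inv_letters_def rev_map o_def)

lemma letter_family_mem:
  assumes P: "closed_class F P" and as: "\<And>a. a \<in> set as \<Longrightarrow> letter_family P a"
  shows "eventually (\<lambda>i. \<forall>a \<in> set as. a i \<in> letters) F"
proof -
  have "eventually (\<lambda>i. a i \<in> letters) F" if "a \<in> set as" for a
    using as[OF that] closed_classD(1)[OF P signs(1), of a] closed_classD(1)[OF P signs(2), of a]
    unfolding letter_family_def by (auto elim: eventually_mono)
  then show ?thesis by (simp add: eventually_ball_finite)
qed

text \<open>The inverse of a word is a word in the negated letters; for \<open>f\<close> constant equal to $E$ this is
  the nominator, for homogeneous \<open>f\<close> the denominator.\<close>

lemma gclass_ginv_word:
  assumes P: "closed_class F P" and as: "\<And>a. a \<in> set as \<Longrightarrow> letter_family P a" and f: "gclass P f"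
    and \<sigma>: "\<sigma> \<in> {1, -1}"
  shows "P \<sigma> (\<lambda>i. pr L \<sigma> (ginv (word_at as i) (f i)))"
proof -
  have "gclass P (\<lambda>i. word_at (inv_letters as) i (f i))"
    by (rule gclass_word[OF P inv_letters_family[OF P as] f])
  from closed_classD(2)[OF P \<sigma> gclassD(1)[OF this \<sigma>] eventually_mono[OF letter_family_mem[OF P as]]]
  show ?thesis by (simp add: ginv_word_at)
qed

abbreviation cont_into :: "'i topology \<Rightarrow> 'i \<Rightarrow> int \<Rightarrow> ('i \<Rightarrow> 'g) \<Rightarrow> bool" where
  "cont_into Y y \<sigma> f \<equiv> cont_at Y y (Vt \<sigma>) f"

lemma closed_class_cont_at:
  assumes "y \<in> topspace Y"
  shows "closed_class (nhdsin Y y) (cont_into Y y)"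
  unfolding closed_class_def
proof (intro ballI conjI allI impI)
  fix \<sigma> :: int assume \<sigma>: "\<sigma> \<in> {1, -1}"
  note t = Vt_continuous_module[OF \<sigma>]
  show "eventually (\<lambda>i. f i \<in> gr \<sigma>) (nhdsin Y y)" if "cont_into Y y \<sigma> f" for f
    using cont_at_mem[OF that] \<sigma> by (simp add: Vt_space)
  show "cont_into Y y \<sigma> g" if "cont_into Y y \<sigma> f" "eventually (\<lambda>i. f i = g i) (nhdsin Y y)" for f g
    by (rule cont_at_cong[OF that(2,1)])
  show "cont_into Y y \<sigma> (\<lambda>_. 0)" using assms \<sigma> gr_mem(1) by (simp add: cont_at_def Vt_space)
  show "cont_into Y y \<sigma> (\<lambda>i. f i + g i)" if "cont_into Y y \<sigma> f" "cont_into Y y \<sigma> g" for f g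
    using cont_at_compose[of Y y "prod_topology (Vt \<sigma>) (Vt \<sigma>)" "\<lambda>i. (f i, g i)" "Vt \<sigma>" "\<lambda>(x, y). x + y"]
      that t by (simp add: cont_at_pair continuous_module_def)
  have c: "continuous_map (Vt \<sigma>) (Vt \<sigma>) (sm r)" for r
    using continuous_map_scale_module[OF t, of "Vt \<sigma>" "\<lambda>_. r" id] by simp
  show "cont_into Y y \<sigma> (\<lambda>i. r \<cdot> f i)" if "cont_into Y y \<sigma> f" for r f
    by (rule cont_at_compose[OF that c])
  show "cont_into Y y \<sigma> (\<lambda>i. \<lbrakk>\<lbrakk>f i, g i\<rbrakk>, h i\<rbrakk>)" if "cont_into Y y \<sigma> f" "cont_into Y y (- \<sigma>) g" "cont_into Y y \<sigma> h" for f g h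
  proof -
    have "cont_into Y y \<sigma> (\<lambda>i. jordan_triple L (f i) (g i) (h i))"
      using cont_at_compose[OF _ Vt_triple[OF \<sigma>], of Y y "\<lambda>i. (f i, g i, h i)"] that
      by (simp add: cont_at_pair)
    from cont_at_compose[OF this c[of "-1"]] show ?thesis by (simp add: jordan_triple_def br_lin)
  qed
qed

lemma closed_class_Cinf_on:
  assumes "U \<subseteq> topspace T"
  shows "closed_class (principal U) (\<lambda>\<sigma>. Cinf_on s T sm (Vt \<sigma>) U)"
  unfolding closed_class_def
proof (intro ballI conjI allI impI)
  fix \<sigma> :: int assume \<sigma>: "\<sigma> \<in> {1, -1}"
  then have m: "- \<sigma> \<in> {1, -1}" by auto
  note t = Vt_continuous_module[OF \<sigma>]
  show "eventually (\<lambda>i. f i \<in> gr \<sigma>) (principal U)" if "Cinf_on s T sm (Vt \<sigma>) U f" for f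
    using Cinf_on_mem[OF that] \<sigma> by (simp add: eventually_principal Vt_space)
  show "Cinf_on s T sm (Vt \<sigma>) U g" if "Cinf_on s T sm (Vt \<sigma>) U f" "eventually (\<lambda>i. f i = g i) (principal U)" for f g
    using that by (auto simp: eventually_principal intro: Cinf_on_cong)
  show "Cinf_on s T sm (Vt \<sigma>) U (\<lambda>_. 0)" by (rule Cinf_on_const[OF t continuous_module_mem(1)[OF t] assms])
  show "Cinf_on s T sm (Vt \<sigma>) U (\<lambda>i. f i + g i)" if "Cinf_on s T sm (Vt \<sigma>) U f" "Cinf_on s T sm (Vt \<sigma>) U g" for f g
    by (rule Cinf_on_add[OF t that])
  show "Cinf_on s T sm (Vt \<sigma>) U (\<lambda>i. r \<cdot> f i)" if "Cinf_on s T sm (Vt \<sigma>) U f" for r f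
    by (rule Cinf_on_scale[OF t that])
  show "Cinf_on s T sm (Vt \<sigma>) U (\<lambda>i. \<lbrakk>\<lbrakk>f i, g i\<rbrakk>, h i\<rbrakk>)"
    if "Cinf_on s T sm (Vt \<sigma>) U f" "Cinf_on s T sm (Vt (- \<sigma>)) U g" "Cinf_on s T sm (Vt \<sigma>) U h" for f g h
  proof -
    have "Ck_on s T sm (Vt \<sigma>) k 0 (Pt ` U) (\<lambda>p. jordan_triple L (f (un_Pt p)) (g (un_Pt p)) (h (un_Pt p)))" for k
      using that Pt_subset[OF assms]
      by (intro Ck_on_trilinear[OF t Vt_continuous_module[OF m] t t Vt_triple[OF \<sigma>]])
        (auto simp: Cinf_on_def jordan_triple_def br_lin)
    then have "Cinf_on s T sm (Vt \<sigma>) U (\<lambda>i. jordan_triple L (f i) (g i) (h i))"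
      using assms by (simp add: Cinf_on_def)
    from Cinf_on_scale[OF t this, of "-1"] show ?thesis by (simp add: jordan_triple_def br_lin)
  qed
qed

section \<open>Continuity of the Gauss decomposition\<close>

lemma cont_into_const: "y \<in> topspace Y \<Longrightarrow> \<sigma> \<in> {1, -1} \<Longrightarrow> c \<in> gr \<sigma> \<Longrightarrow> cont_into Y y \<sigma> (\<lambda>_. c)"
  by (simp add: cont_at_def Vt_space)

lemma cont_into_mem:
  assumes "cont_into Y y \<sigma> f" "\<sigma> \<in> {1, -1}"
  shows "y \<in> topspace Y" "f y \<in> gr \<sigma>" "eventually (\<lambda>i. f i \<in> gr \<sigma>) (nhdsin Y y)"
  using assms cont_at_mem[OF assms(1)] by (auto simp: cont_at_def Vt_space dest: limitin_topspace)

lemma cont_into_plus: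
  assumes "cont_into Y y \<sigma> f" "cont_into Y y \<sigma> g" "\<sigma> \<in> {1, -1}"
  shows "cont_into Y y \<sigma> (\<lambda>i. f i + g i)"
  using closed_classD(4)[OF closed_class_cont_at[OF cont_into_mem(1)[OF assms(1,3)]] assms(3)] assms(1,2) .

text \<open>What (C2) provides for constant \<open>a\<close> and (C1) for variable \<open>a\<close>.\<close>

definition bergman_continuous_at :: "'i topology \<Rightarrow> 'i \<Rightarrow> ('i \<Rightarrow> 'g) \<Rightarrow> ('i \<Rightarrow> 'g) \<Rightarrow> bool" where
  "bergman_continuous_at Y y x a \<longleftrightarrow>
     eventually (\<lambda>i. big_cell (ex (a i) \<circ> ex (x i))) (nhdsin Y y) \<and>
     (\<forall>u. cont_into Y y 1 u \<longrightarrow> cont_into Y y 1 (\<lambda>i. inv_into (gr 1) (bergman L (x i) (a i)) (u i)))"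

lemma bergman_continuous_C1:
  assumes C1: "condition_C1 L" and x: "cont_into Y y 1 x" and a: "cont_into Y y (-1) a"
    and b: "big_cell (ex (a y) \<circ> ex (x y))"
  shows "bergman_continuous_at Y y x a"
    "cont_into Y y (-1) v \<Longrightarrow> cont_into Y y (-1) (\<lambda>i. inv_into (gr (-1)) (bergman L (a i) (x i)) (v i))"
proof -
  let ?V2 = "prod_topology (Vt 1) (Vt (-1))"
  let ?Q = "{(x, a). x \<in> gr 1 \<and> a \<in> gr (-1) \<and>
                 bergman L x a \<in> GL_on sm (gr 1) \<and> bergman L a x \<in> GL_on sm (gr (-1))}"
  let ?f = "\<lambda>((x, a), (v, b)). (inv_into (gr 1) (bergman L x a) v, inv_into (gr (-1)) (bergman L a x) b)"
  have Q: "openin ?V2 ?Q" and f: "continuous_map (subtopology (prod_topology ?V2 ?V2) (?Q \<times> (gr 1 \<times> gr (-1)))) ?V2 ?f"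
    using C1 unfolding condition_C1_def Let_def by blast+
  have xa: "cont_at Y y ?V2 (\<lambda>i. (x i, a i))" using x a by (simp add: cont_at_pair)
  note mx = cont_into_mem[OF x signs(1)] and ma = cont_into_mem[OF a signs(2)]
  have "(x y, a y) \<in> ?Q" using bergman_big_cell[OF mx(2) ma(2)] b mx(2) ma(2) by simp
  then have evQ: "eventually (\<lambda>i. (x i, a i) \<in> ?Q) (nhdsin Y y)"
    using xa Q unfolding cont_at_def limitin_def by blast
  then have ev: "eventually (\<lambda>i. big_cell (ex (a i) \<circ> ex (x i))) (nhdsin Y y)"
    by (rule eventually_mono) (auto simp: bergman_big_cell)
  have main: "cont_into Y y 1 (\<lambda>i. inv_into (gr 1) (bergman L (x i) (a i)) (u i)) \<and>
      cont_into Y y (-1) (\<lambda>i. inv_into (gr (-1)) (bergman L (a i) (x i)) (v i))"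
    if u: "cont_into Y y 1 u" and v: "cont_into Y y (-1) v" for u v
  proof -
    have "cont_at Y y (subtopology (prod_topology ?V2 ?V2) (?Q \<times> (gr 1 \<times> gr (-1)))) (\<lambda>i. ((x i, a i), (u i, v i)))"
      unfolding cont_at_subtopology cont_at_pair
      using x a u v eventually_conj[OF evQ eventually_conj[OF cont_into_mem(3)[OF u signs(1)] cont_into_mem(3)[OF v signs(2)]]]
      by (auto elim!: eventually_mono)
    from cont_at_compose[OF this f] show ?thesis by (simp add: cont_at_pair)
  qed
  have z: "cont_into Y y 1 (\<lambda>_. 0)" "cont_into Y y (-1) (\<lambda>_. 0)" using cont_into_const[OF mx(1)] gr_mem(1) by auto
  show "bergman_continuous_at Y y x a" using ev main z unfolding bergman_continuous_at_def by blast
  show "cont_into Y y (-1) v \<Longrightarrow> cont_into Y y (-1) (\<lambda>i. inv_into (gr (-1)) (bergman L (a i) (x i)) (v i))"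
    using main z by blast
qed

lemma bergman_continuous_C2:
  assumes C2: "condition_C2 L" and x: "cont_into Y y 1 x" and a: "a \<in> gr (-1)"
    and b: "big_cell (ex a \<circ> ex (x y))"
  shows "bergman_continuous_at Y y x (\<lambda>_. a)"
proof -
  let ?U = "{x \<in> gr 1. bergman L x a \<in> GL_on sm (gr 1) \<and> bergman L a x \<in> GL_on sm (gr (-1))}"
  let ?f = "\<lambda>(x, v). inv_into (gr 1) (bergman L x a) v"
  have C2': "openin (Vt 1) ?U \<and>
      continuous_map (subtopology (prod_topology (Vt 1) (Vt 1)) (?U \<times> gr 1)) (Vt 1) ?f"
    using C2[unfolded condition_C2_def Let_def, rule_format, of 1 a] a by simp
  then have U: "openin (Vt 1) ?U" and f: "continuous_map (subtopology (prod_topology (Vt 1) (Vt 1)) (?U \<times> gr 1)) (Vt 1) ?f"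
    by blast+
  note mx = cont_into_mem[OF x signs(1)]
  have "x y \<in> ?U" using bergman_big_cell[OF mx(2) a] b mx(2) by simp
  then have evU: "eventually (\<lambda>i. x i \<in> ?U) (nhdsin Y y)"
    using x U unfolding cont_at_def limitin_def by blast
  then have ev: "eventually (\<lambda>i. big_cell (ex a \<circ> ex (x i))) (nhdsin Y y)"
    by (rule eventually_mono) (auto simp: bergman_big_cell a)
  have "cont_into Y y 1 (\<lambda>i. inv_into (gr 1) (bergman L (x i) a) (u i))" if u: "cont_into Y y 1 u" for u
  proof -
    have "cont_at Y y (subtopology (prod_topology (Vt 1) (Vt 1)) (?U \<times> gr 1)) (\<lambda>i. (x i, u i))"
      unfolding cont_at_subtopology cont_at_pair
      using x u eventually_conj[OF evU cont_into_mem(3)[OF u signs(1)]] by (auto elim!: eventually_mono)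
    from cont_at_compose[OF this f] show ?thesis by simp
  qed
  with ev show ?thesis by (simp add: bergman_continuous_at_def)
qed

lemma letters_cont_into: "letter_family (cont_into Y y) a \<Longrightarrow> y \<in> topspace Y" "letter_family (cont_into Y y) a \<Longrightarrow> a y \<in> letters"
  by (auto simp: letter_family_def dest: cont_into_mem(1,2)[OF _ signs(1)] cont_into_mem(1,2)[OF _ signs(2)])

lemma letter_const: "y \<in> topspace Y \<Longrightarrow> c \<in> letters \<Longrightarrow> letter_family (cont_into Y y) (\<lambda>_. c)"
  using cont_into_const[of y Y] by (auto simp: letter_family_def)

lemma group_element_continuous:
  assumes g: "g \<in> elementary_group L" and \<sigma>: "\<sigma> \<in> {1, -1}" and u: "cont_into Y y \<sigma> u"
  shows "cont_into Y y \<sigma> (\<lambda>i. pr L \<sigma> (g (u i)))"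
proof -
  have y: "y \<in> topspace Y" by (rule cont_into_mem(1)[OF u \<sigma>])
  note P = closed_class_cont_at[OF y]
  obtain as where as: "set as \<subseteq> letters" "g = word as" by (rule G_obtain_word[OF g])
  let ?as = "map (\<lambda>a _. a) as"
  have "gclass (cont_into Y y) (\<lambda>i. word_at ?as i (u i))"
    by (rule gclass_word[OF P _ gclass_homogeneous[OF P \<sigma> u]]) (use as letter_const[OF y] in auto)
  then have "cont_into Y y \<sigma> (\<lambda>i. pr L \<sigma> (word_at ?as i (u i)))" by (rule gclassD(1)[OF _ \<sigma>])
  then show ?thesis by (simp add: word_at_def as o_def)
qed

text \<open>Continuity of the graded factor \<open>h\<close> is demanded on $V^+$ and that of its inverse on $V^-$. This is
  exactly what (C1) says about the decomposition of $e^{ad(a)} e^{ad(x)}$, and it suffices for products: moving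
  the two inner exponentials outwards applies $h$ to $V^+$ and the inverse of the other graded factor
  to $V^-$.\<close>

definition cell_family :: "'i topology \<Rightarrow> 'i \<Rightarrow> ('i \<Rightarrow> 'g \<Rightarrow> 'g) \<Rightarrow> bool" where
  "cell_family Y y \<gamma> \<longleftrightarrow> (\<exists>x h w. cont_into Y y 1 x \<and> cont_into Y y (-1) w \<and>
     eventually (\<lambda>i. graded_aut (h i) \<and> \<gamma> i = ex (x i) \<circ> h i \<circ> ex (w i)) (nhdsin Y y) \<and>
     (\<forall>u. cont_into Y y 1 u \<longrightarrow> cont_into Y y 1 (\<lambda>i. h i (u i))) \<and>
     (\<forall>v. cont_into Y y (-1) v \<longrightarrow> cont_into Y y (-1) (\<lambda>i. ginv (h i) (v i))))"

lemma cell_family_regular: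
  assumes "cell_family Y y \<gamma>"
  shows "eventually (\<lambda>i. big_cell (\<gamma> i)) (nhdsin Y y)"
    "cont_into Y y 1 u \<Longrightarrow> cont_into Y y 1 (\<lambda>i. inv_into (gr 1) (coef L (ginv (\<gamma> i)) 1 1) (u i))"
proof -
  obtain x h w where x: "cont_into Y y 1 x" and w: "cont_into Y y (-1) w" and
     ev: "eventually (\<lambda>i. graded_aut (h i) \<and> \<gamma> i = ex (x i) \<circ> h i \<circ> ex (w i)) (nhdsin Y y)" and
     h: "\<And>u. cont_into Y y 1 u \<Longrightarrow> cont_into Y y 1 (\<lambda>i. h i (u i))"
    using assms unfolding cell_family_def by blast
  have all: "eventually (\<lambda>i. x i \<in> gr 1 \<and> graded_aut (h i) \<and> w i \<in> gr (-1) \<and> \<gamma> i = ex (x i) \<circ> h i \<circ> ex (w i)) (nhdsin Y y)"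
    using ev cont_into_mem(3)[OF x signs(1)] cont_into_mem(3)[OF w signs(2)] by eventually_elim simp
  then show "eventually (\<lambda>i. big_cell (\<gamma> i)) (nhdsin Y y)"
    by (rule eventually_mono) (unfold big_cell_def, blast)
  assume u: "cont_into Y y 1 u"
  show "cont_into Y y 1 (\<lambda>i. inv_into (gr 1) (coef L (ginv (\<gamma> i)) 1 1) (u i))"
  proof (rule cont_at_cong[OF _ h[OF u]])
    show "eventually (\<lambda>i. h i (u i) = inv_into (gr 1) (coef L (ginv (\<gamma> i)) 1 1) (u i)) (nhdsin Y y)"
      using all cont_into_mem(3)[OF u signs(1)]
    proof eventually_elim
      case (elim i)
      show ?case
        by (rule cell_data(3)[of "x i" "h i" "w i" "\<gamma> i" "u i", symmetric]) (use elim in blast)+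
    qed
  qed
qed

text \<open>The factors around $\kappa$ belong to two groups, that of all $e^{ad(x)} h$ and that of all $h e^{ad(w)}$,
  under whose left and right multiplications the big cell is stable; here they are cancelled.\<close>

lemma big_cell_core:
  assumes "x \<in> gr 1" "graded_aut h" "graded_aut h'" "w' \<in> gr (-1)" "big_cell (ex x \<circ> h \<circ> \<kappa> \<circ> h' \<circ> ex w')"
  shows "big_cell \<kappa>"
proof -
  obtain p k v where d: "p \<in> gr 1" "graded_aut k" "v \<in> gr (-1)" "ex x \<circ> h \<circ> \<kappa> \<circ> h' \<circ> ex w' = ex p \<circ> k \<circ> ex v"
    using assms(5) by (auto simp: big_cell_def)
  note hA = graded_autD(1)[OF assms(2)] and hA' = graded_autD(1)[OF assms(3)]
  note gh = graded_aut_inv[OF assms(2)] and gh' = graded_aut_inv[OF assms(3)]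
  have mx: "- x \<in> gr 1" and mw: "- w' \<in> gr (-1)" using assms gr_mem(4) by blast+
  have "\<kappa> = ex (ginv h (- x + p)) \<circ> (ginv h \<circ> k \<circ> ginv h') \<circ> ex (h' (v + - w'))"
  proof
    fix z
    define z' where "z' = ex (- w') (ginv h' z)"
    have z: "z = h' (ex w' z')" using ex_minus(2)[OF signs(2) assms(4)] by (simp add: z'_def Aut_inv_apply[OF hA'])
    have "ex x (h (\<kappa> z)) = ex p (k (ex v z'))" using fun_cong[OF d(4), of z'] z by simp
    then have "h (\<kappa> z) = ex (- x) (ex p (k (ex v z')))" using ex_minus(1)[OF signs(1) assms(1)] by metis
    also have "\<dots> = ex (- x + p) (k (ex v z'))"
      using fun_cong[OF ex_add[OF signs(1) mx d(1)]] by simp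
    finally have "\<kappa> z = ginv h (ex (- x + p) (k (ex v z')))" using Aut_inv_apply(2)[OF hA] by metis
    also have "\<dots> = ex (ginv h (- x + p)) (ginv h (k (ex v z')))" by (rule Aut_ex[OF graded_autD(1)[OF gh]])
    also have "ex v z' = ginv h' (ex (h' (v + - w')) z)"
    proof -
      have "ex v z' = ex (v + - w') (ginv h' z)"
        using fun_cong[OF ex_add[OF signs(2) d(3) mw]] by (simp add: z'_def)
      also have "\<dots> = ginv h' (h' (ex (v + - w') (ginv h' z)))" by (simp add: Aut_inv_apply[OF hA'])
      also have "\<dots> = ginv h' (ex (h' (v + - w')) z)" by (simp add: Aut_ex[OF hA'] Aut_inv_apply[OF hA'])
      finally show ?thesis .
    qed
    finally show "\<kappa> z = (ex (ginv h (- x + p)) \<circ> (ginv h \<circ> k \<circ> ginv h') \<circ> ex (h' (v + - w'))) z" by simp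
  qed
  moreover have "ginv h (- x + p) \<in> gr 1" "h' (v + - w') \<in> gr (-1)"
    using graded_autD(2)[OF gh] graded_autD(2)[OF assms(3)] gr_mem(2) mx d mw by blast+
  moreover have "graded_aut (ginv h \<circ> k \<circ> ginv h')"
    by (intro graded_aut_comp gh gh' d(2))
  ultimately show ?thesis unfolding big_cell_def by blast
qed

lemma big_cell_merge:
  assumes "x \<in> gr 1" "graded_aut h" "p \<in> gr 1" "graded_aut k" "v \<in> gr (-1)" "graded_aut h'" "w' \<in> gr (-1)"
  shows "ex x \<circ> h \<circ> (ex p \<circ> k \<circ> ex v) \<circ> h' \<circ> ex w'
     = ex (x + h p) \<circ> (h \<circ> k \<circ> h') \<circ> ex (ginv h' v + w')"
proof
  fix z
  note hA = graded_autD(1)[OF assms(2)] and hA' = graded_autD(1)[OF assms(6)]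
  have "ex v (h' (ex w' z)) = h' (ex (ginv h' v) (ex w' z))"
    using Aut_ex[OF hA', of "ginv h' v"] by (simp add: Aut_inv_apply[OF hA'])
  also have "\<dots> = h' (ex (ginv h' v + w') z)"
    using fun_cong[OF ex_add[OF signs(2) graded_autD(2)[OF graded_aut_inv[OF assms(6)] assms(5)] assms(7)]] by simp
  finally have 1: "ex v (h' (ex w' z)) = h' (ex (ginv h' v + w') z)" .
  have "ex x (h (ex p q)) = ex (x + h p) (h q)" for q
    using fun_cong[OF ex_add[OF signs(1) assms(1) graded_autD(2)[OF assms(2,3)]]] Aut_ex[OF hA] by simp
  then show "(ex x \<circ> h \<circ> (ex p \<circ> k \<circ> ex v) \<circ> h' \<circ> ex w') z
     = (ex (x + h p) \<circ> (h \<circ> k \<circ> h') \<circ> ex (ginv h' v + w')) z"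
    using 1 by simp
qed

lemma ginv_comp: "f \<in> Aut \<Longrightarrow> g \<in> Aut \<Longrightarrow> ginv (f \<circ> g) = ginv g \<circ> ginv f"
  by (rule o_inv_distrib) (rule Aut_bij, assumption)+

text \<open>With the decompositions $\gamma = e^x h e^w$ and $\gamma' = e^{x'} h' e^{w'}$, the product contains
  $e^w e^{x'}$ as its core; its value at the point is in the big cell because that of the product is. By (C1) the
  core is decomposed continuously, and the remaining factors are moved outwards.\<close>

lemma cell_family_prod:
  assumes C1: "condition_C1 L" and f: "cell_family Y y \<gamma>" and f': "cell_family Y y \<gamma>'"
    and big: "big_cell (\<gamma> y \<circ> \<gamma>' y)"
  shows "cell_family Y y (\<lambda>i. \<gamma> i \<circ> \<gamma>' i)"
proof -
  obtain x h w where x: "cont_into Y y 1 x" and w: "cont_into Y y (-1) w" and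
     ev: "eventually (\<lambda>i. graded_aut (h i) \<and> \<gamma> i = ex (x i) \<circ> h i \<circ> ex (w i)) (nhdsin Y y)" and
     h: "\<And>u. cont_into Y y 1 u \<Longrightarrow> cont_into Y y 1 (\<lambda>i. h i (u i))"
        "\<And>v. cont_into Y y (-1) v \<Longrightarrow> cont_into Y y (-1) (\<lambda>i. ginv (h i) (v i))"
    using f unfolding cell_family_def by blast
  obtain x' h' w' where x': "cont_into Y y 1 x'" and w': "cont_into Y y (-1) w'" and
     ev': "eventually (\<lambda>i. graded_aut (h' i) \<and> \<gamma>' i = ex (x' i) \<circ> h' i \<circ> ex (w' i)) (nhdsin Y y)" and
     h': "\<And>u. cont_into Y y 1 u \<Longrightarrow> cont_into Y y 1 (\<lambda>i. h' i (u i))"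
        "\<And>v. cont_into Y y (-1) v \<Longrightarrow> cont_into Y y (-1) (\<lambda>i. ginv (h' i) (v i))"
    using f' unfolding cell_family_def by blast
  note mx = cont_into_mem[OF x signs(1)] and mw = cont_into_mem[OF w signs(2)] and mx' = cont_into_mem[OF x' signs(1)] and mw' = cont_into_mem[OF w' signs(2)]
  have y: "y \<in> topspace Y" by (rule mx(1))
  note P = closed_class_cont_at[OF y]
  \<comment> \<open>The core of the product, a pair to which the Bergman operators apply.\<close>
  let ?\<kappa> = "\<lambda>i. ex (w i) \<circ> ex (x' i)"
  have "big_cell (ex (x y) \<circ> h y \<circ> ?\<kappa> y \<circ> h' y \<circ> ex (w' y))"
    using big eventually_nhdsin_at[OF ev y] eventually_nhdsin_at[OF ev' y] by (simp add: o_assoc)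
  then have b: "big_cell (?\<kappa> y)"
    using big_cell_core[OF mx(2) _ _ mw'(2)] eventually_nhdsin_at[OF ev y] eventually_nhdsin_at[OF ev' y] by blast
  note B = bergman_continuous_C1[OF C1 x' w b]
  have evb: "eventually (\<lambda>i. big_cell (?\<kappa> i)) (nhdsin Y y)"
    and B1: "\<And>u. cont_into Y y 1 u \<Longrightarrow> cont_into Y y 1 (\<lambda>i. inv_into (gr 1) (bergman L (x' i) (w i)) (u i))"
    using B(1) unfolding bergman_continuous_at_def by blast+
  have "\<forall>i. \<exists>k v. big_cell (?\<kappa> i) \<longrightarrow> cell_point (?\<kappa> i) \<in> gr 1 \<and> graded_aut k \<and> v \<in> gr (-1) \<and> ?\<kappa> i = ex (cell_point (?\<kappa> i)) \<circ> k \<circ> ex v"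
    using big_cell_obtain by metis
  then obtain k v where kv: "\<And>i. big_cell (?\<kappa> i) \<Longrightarrow> cell_point (?\<kappa> i) \<in> gr 1 \<and> graded_aut (k i) \<and> v i \<in> gr (-1) \<and>
      ?\<kappa> i = ex (cell_point (?\<kappa> i)) \<circ> k i \<circ> ex (v i)"
    by metis
  let ?p = "\<lambda>i. cell_point (?\<kappa> i)"
  have all: "eventually (\<lambda>i. x' i \<in> gr 1 \<and> w i \<in> gr (-1) \<and> x i \<in> gr 1 \<and> w' i \<in> gr (-1) \<and>
      graded_aut (h i) \<and> \<gamma> i = ex (x i) \<circ> h i \<circ> ex (w i) \<and>
      graded_aut (h' i) \<and> \<gamma>' i = ex (x' i) \<circ> h' i \<circ> ex (w' i) \<and>
      ?p i \<in> gr 1 \<and> graded_aut (k i) \<and> v i \<in> gr (-1) \<and> ?\<kappa> i = ex (?p i) \<circ> k i \<circ> ex (v i)) (nhdsin Y y)"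
    using evb ev ev' mx(3) mw(3) mx'(3) mw'(3) by eventually_elim (use kv in blast)
  have k1: "cont_into Y y 1 (\<lambda>i. k i (u i))" if u: "cont_into Y y 1 u" for u
  proof (rule cont_at_cong[OF _ B1[OF u]])
    show "eventually (\<lambda>i. inv_into (gr 1) (bergman L (x' i) (w i)) (u i) = k i (u i)) (nhdsin Y y)"
      using all cont_into_mem(3)[OF u signs(1)]
    proof eventually_elim
      case (elim i)
      then have "inv_into (gr 1) (coef L (ginv (?\<kappa> i)) 1 1) (u i) = k i (u i)"
        using cell_data(3)[of "?p i" "k i" "v i" "?\<kappa> i" "u i"] by blast
      moreover have "inv_into (gr 1) (coef L (ginv (?\<kappa> i)) 1 1) (u i)
          = inv_into (gr 1) (bergman L (x' i) (w i)) (u i)"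
        by (rule inv_into_cong_on, rule bergman_coef(1)) (use elim in simp_all)
      ultimately show ?case by metis
    qed
  qed
  have k2: "cont_into Y y (-1) (\<lambda>i. ginv (k i) (u i))" if u: "cont_into Y y (-1) u" for u
  proof (rule cont_at_cong[OF _ B(2)[OF u]])
    show "eventually (\<lambda>i. inv_into (gr (-1)) (bergman L (w i) (x' i)) (u i) = ginv (k i) (u i)) (nhdsin Y y)"
      using all cont_into_mem(3)[OF u signs(2)]
    proof eventually_elim
      case (elim i)
      then have "inv_into (gr (-1)) (coef L (?\<kappa> i) (-1) (-1)) (u i) = ginv (k i) (u i)"
        using cell_data(5)[of "?p i" "k i" "v i" "?\<kappa> i" "u i"] by blast
      moreover have "inv_into (gr (-1)) (coef L (?\<kappa> i) (-1) (-1)) (u i)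
          = inv_into (gr (-1)) (bergman L (w i) (x' i)) (u i)"
        by (rule inv_into_cong_on, rule bergman_coef(2)) (use elim in simp_all)
      ultimately show ?case by metis
    qed
  qed
  let ?as = "[w, x']"
  have as: "letter_family (cont_into Y y) a" if "a \<in> set ?as" for a
    using that w x' by (auto simp: letter_family_def)
  have at: "word_at ?as i = ?\<kappa> i" for i by (simp add: word_at_simps)
  have p: "cont_into Y y 1 ?p"
  proof (rule cont_at_cong[OF _ k1[OF gclass_ginv_word[OF P as gclass_euler[OF P] signs(1)]]])
    show "eventually (\<lambda>i. k i (pr L 1 (ginv (word_at ?as i) EE)) = ?p i) (nhdsin Y y)"
      using all
    proof eventually_elim
      case (elim i)
      have "inv_into (gr 1) (coef L (ginv (?\<kappa> i)) 1 1) (pr L 1 (ginv (?\<kappa> i) EE)) = k i (pr L 1 (ginv (?\<kappa> i) EE))"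
        by (rule cell_data(3)[of "?p i" "k i" "v i" "?\<kappa> i"]) (use elim pr_gr in blast)+
      then show ?case unfolding at by (simp only: cell_point_def)
    qed
  qed
  have v: "cont_into Y y (-1) v"
  proof (rule cont_at_cong[OF _ k2[OF gclassD(1)[OF gclass_word[OF P as gclass_euler[OF P]] signs(2)]]])
    show "eventually (\<lambda>i. ginv (k i) (pr L (-1) (word_at ?as i EE)) = v i) (nhdsin Y y)"
      using all
    proof eventually_elim
      case (elim i)
      then show ?case
        using cell_data(7)[of "?p i" "k i" "v i" "?\<kappa> i"] unfolding at by blast
    qed
  qed
  show ?thesis
    unfolding cell_family_def
  proof (intro exI conjI allI impI)
    show "cont_into Y y 1 (\<lambda>i. x i + h i (?p i))" by (rule cont_into_plus[OF x h(1)[OF p] signs(1)])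
    show "cont_into Y y (-1) (\<lambda>i. ginv (h' i) (v i) + w' i)" by (rule cont_into_plus[OF h'(2)[OF v] w' signs(2)])
    show "eventually (\<lambda>i. graded_aut (h i \<circ> k i \<circ> h' i) \<and>
        \<gamma> i \<circ> \<gamma>' i = ex (x i + h i (?p i)) \<circ> (h i \<circ> k i \<circ> h' i) \<circ> ex (ginv (h' i) (v i) + w' i)) (nhdsin Y y)"
      using all
    proof eventually_elim
      case (elim i)
      have "\<gamma> i \<circ> \<gamma>' i = ex (x i) \<circ> h i \<circ> ?\<kappa> i \<circ> h' i \<circ> ex (w' i)"
        using elim by (simp only: o_assoc)
      also have "?\<kappa> i = ex (?p i) \<circ> k i \<circ> ex (v i)" using elim by blast
      also have "ex (x i) \<circ> h i \<circ> (ex (?p i) \<circ> k i \<circ> ex (v i)) \<circ> h' i \<circ> ex (w' i)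
          = ex (x i + h i (?p i)) \<circ> (h i \<circ> k i \<circ> h' i) \<circ> ex (ginv (h' i) (v i) + w' i)"
        using elim by (intro big_cell_merge) blast+
      finally have "\<gamma> i \<circ> \<gamma>' i = ex (x i + h i (?p i)) \<circ> (h i \<circ> k i \<circ> h' i) \<circ> ex (ginv (h' i) (v i) + w' i)" .
      moreover have "graded_aut (h i \<circ> k i \<circ> h' i)" using elim by (intro graded_aut_comp) blast+
      ultimately show ?case by blast
    qed
    show "cont_into Y y 1 (\<lambda>i. (h i \<circ> k i \<circ> h' i) (u i))" if "cont_into Y y 1 u" for u
      using h(1)[OF k1[OF h'(1)[OF that]]] by simp
    show "cont_into Y y (-1) (\<lambda>i. ginv (h i \<circ> k i \<circ> h' i) (u i))" if u: "cont_into Y y (-1) u" for u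
    proof (rule cont_at_cong[OF _ h'(2)[OF k2[OF h(2)[OF u]]]])
      show "eventually (\<lambda>i. ginv (h' i) (ginv (k i) (ginv (h i) (u i))) = ginv (h i \<circ> k i \<circ> h' i) (u i)) (nhdsin Y y)"
        using all by eventually_elim (simp add: ginv_comp graded_autD(1) Aut_comp)
    qed
  qed
qed

lemma cell_family_ex:
  assumes "letter_family (cont_into Y y) a"
  shows "cell_family Y y (\<lambda>i. ex (a i))"
proof -
  have y: "y \<in> topspace Y" by (rule letters_cont_into(1)[OF assms])
  have z: "cont_into Y y 1 (\<lambda>_. 0)" "cont_into Y y (-1) (\<lambda>_. 0)" using cont_into_const[OF y] gr_mem(1) by auto
  have gid: "ginv id = (id :: 'g \<Rightarrow> 'g)" by simp
  from assms consider "cont_into Y y 1 a" | "cont_into Y y (-1) a" by (auto simp: letter_family_def)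
  then show ?thesis
  proof cases
    case 1 then show ?thesis
      unfolding cell_family_def
      by (intro exI[of _ a] exI[of _ "\<lambda>_. id"] exI[of _ "\<lambda>_. 0"])
        (simp add: z(2) graded_aut_id ex_0 gid inv_id)
  next
    case 2 then show ?thesis
      unfolding cell_family_def
      by (intro exI[of _ "\<lambda>_. 0"] exI[of _ "\<lambda>_. id"] exI[of _ a])
        (simp add: z(1) graded_aut_id ex_0 gid inv_id)
  qed
qed

text \<open>The graded factor of a group element lies in the group, so it acts continuously; an arbitrary
  graded automorphism need not do so.\<close>

lemma cell_family_const:
  assumes g: "g \<in> elementary_group L" and b: "big_cell g" and y: "y \<in> topspace Y"
  shows "cell_family Y y (\<lambda>_. g)"
proof -
  obtain h w where d: "cell_point g \<in> gr 1" "graded_aut h" "w \<in> gr (-1)" and ge: "g = ex (cell_point g) \<circ> h \<circ> ex w"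
    by (rule big_cell_obtain[OF b])
  define x where "x = cell_point g"
  have mx: "- x \<in> gr 1" and mw: "- w \<in> gr (-1)" and x: "x \<in> gr 1" using d gr_mem(4) by (auto simp: x_def)
  have "h = ex (- x) \<circ> g \<circ> ex (- w)"
    using ex_minus[OF signs(1) x] ex_minus[OF signs(2) d(3)] fun_cong[OF ge[folded x_def]] by (simp add: fun_eq_iff)
  then have h: "h \<in> elementary_group L" using g mx mw by (auto intro!: G_comp G_ex)
  show ?thesis
    unfolding cell_family_def
  proof (intro exI conjI allI impI)
    show "cont_into Y y 1 (\<lambda>_. x)" "cont_into Y y (-1) (\<lambda>_. w)" using cont_into_const[OF y] x d by auto
    show "eventually (\<lambda>i. graded_aut h \<and> g = ex x \<circ> h \<circ> ex w) (nhdsin Y y)"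
      using d ge by (simp add: x_def)
    show "cont_into Y y 1 (\<lambda>i. h (u i))" if u: "cont_into Y y 1 u" for u
      by (rule cont_at_cong[OF eventually_mono[OF cont_into_mem(3)[OF u signs(1)]] group_element_continuous[OF h signs(1) u]])
        (simp add: graded_aut_pr[OF d(2)] pr_of_gr)
    show "cont_into Y y (-1) (\<lambda>i. ginv h (u i))" if u: "cont_into Y y (-1) u" for u
      by (rule cont_at_cong[OF eventually_mono[OF cont_into_mem(3)[OF u signs(2)]] group_element_continuous[OF G_inv[OF h] signs(2) u]])
        (simp add: graded_aut_pr[OF graded_aut_inv[OF d(2)]] pr_of_gr)
  qed
qed

lemma big_cell_id: "big_cell id" and big_cell_ex: "a \<in> letters \<Longrightarrow> big_cell (ex a)"
proof -
  have 1: "big_cell (ex x)" if "x \<in> gr 1" for x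
    unfolding big_cell_def
    using that graded_aut_id gr_mem(1) by (intro exI[of _ x] exI[of _ id] exI[of _ 0]) (simp add: ex_0)
  have 2: "big_cell (ex w)" if "w \<in> gr (-1)" for w
    unfolding big_cell_def
    using that graded_aut_id gr_mem(1) by (intro exI[of _ 0] exI[of _ id] exI[of _ w]) (simp add: ex_0)
  show "big_cell id" using 1[of 0] gr_mem(1) by (simp add: ex_0)
  show "a \<in> letters \<Longrightarrow> big_cell (ex a)" using 1 2 by blast
qed

text \<open>First $e^a \gamma_i$ tends to $e^a$, which is in the big cell, and then $e^a \gamma_i e^{-a}$ tends to
  the identity. Thus no product leaves the big cell in the limit.\<close>

lemma cell_family_conj:
  assumes C1: "condition_C1 L" and a: "a \<in> letters" and y: "y \<in> topspace Y" and f: "cell_family Y y \<gamma>" "\<gamma> y = id"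
  shows "cell_family Y y (\<lambda>i. ex a \<circ> \<gamma> i \<circ> ex (- a))"
proof (rule cell_family_prod[OF C1])
  show "cell_family Y y (\<lambda>i. ex a \<circ> \<gamma> i)"
    by (rule cell_family_prod[OF C1 cell_family_ex[OF letter_const[OF y a]] f(1)]) (simp add: f(2) big_cell_ex[OF a])
  show "cell_family Y y (\<lambda>_. ex (- a))"
    by (rule cell_family_ex[OF letter_const[OF y letters_minus[OF a]]])
  show "big_cell ((ex a \<circ> \<gamma> y) \<circ> ex (- a))" using ex_letter_minus(2)[OF a] by (simp add: f(2) big_cell_id)
qed

text \<open>By induction on the word: splitting off the first letter, the quotient is
  $e^{a_i} e^{-a_y}$ times the conjugate by $e^{a_y}$ of the quotient for the remaining word, and all these
  families tend to the identity.\<close>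

lemma cell_family_near_one:
  assumes C1: "condition_C1 L" and y: "y \<in> topspace Y" and as: "\<And>a. a \<in> set as \<Longrightarrow> letter_family (cont_into Y y) a"
  shows "cell_family Y y (\<lambda>i. word_at as i \<circ> ginv (word_at as y))"
  using as
proof (induction as)
  case Nil
  have e: "word_at [] i \<circ> ginv (word_at [] y) = id" for i by (simp add: word_at_simps fun_eq_iff)
  show ?case unfolding e by (rule cell_family_const[OF G_id big_cell_id y])
next
  case (Cons a as)
  have la: "letter_family (cont_into Y y) a" using Cons.prems by simp
  have aL: "a y \<in> letters" by (rule letters_cont_into(2)[OF la])
  have l: "b y \<in> letters" if "b \<in> set as" for b
    by (rule letters_cont_into(2)[OF Cons.prems]) (simp add: that)
  have W: "word_at as y \<in> Aut" by (rule word_at_Aut[OF l])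
  let ?n = "\<lambda>i. word_at as i \<circ> ginv (word_at as y)"
  have n: "cell_family Y y ?n" by (rule Cons.IH, rule Cons.prems) simp
  have n1: "?n y = id" using W by (simp add: fun_eq_iff Aut_inv_apply)
  have inv: "ginv (ex (a y)) = ex (- a y)"
    using ex_inv[OF signs(1)] ex_inv[OF signs(2)] aL by blast
  have e: "ex (- a y) \<circ> ex (a y) = id" "ex (a y) \<circ> ex (- a y) = id" using ex_letter_minus[OF aL] .
  have "cell_family Y y (\<lambda>i. (ex (a i) \<circ> ex (- a y)) \<circ> (ex (a y) \<circ> ?n i \<circ> ex (- a y)))"
  proof (rule cell_family_prod[OF C1])
    show "cell_family Y y (\<lambda>i. ex (a i) \<circ> ex (- a y))"
      by (rule cell_family_prod[OF C1 cell_family_ex[OF la] cell_family_ex[OF letter_const[OF y letters_minus[OF aL]]]])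
        (simp add: e big_cell_id)
    show "cell_family Y y (\<lambda>i. ex (a y) \<circ> ?n i \<circ> ex (- a y))"
      by (rule cell_family_conj[OF C1 aL y n n1])
    show "big_cell ((ex (a y) \<circ> ex (- a y)) \<circ> (ex (a y) \<circ> ?n y \<circ> ex (- a y)))"
      by (simp only: n1 e comp_id id_comp big_cell_id)
  qed
  moreover have "(ex (a i) \<circ> ex (- a y)) \<circ> (ex (a y) \<circ> ?n i \<circ> ex (- a y))
      = word_at (a # as) i \<circ> ginv (word_at (a # as) y)" for i
    using fun_cong[OF e(1)] ex_Aut[OF aL] W by (simp add: fun_eq_iff word_at_simps ginv_comp inv)
  ultimately show ?case by (simp only:)
qed

text \<open>The family is a family tending to the identity, multiplied by its value at the point.\<close>

theorem cell_family_word: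
  assumes C1: "condition_C1 L" and y: "y \<in> topspace Y" and as: "\<And>a. a \<in> set as \<Longrightarrow> letter_family (cont_into Y y) a"
    and b: "big_cell (word_at as y)"
  shows "cell_family Y y (word_at as)"
proof -
  have l: "a y \<in> letters" if "a \<in> set as" for a using letters_cont_into(2)[OF as[OF that]] .
  have W: "word_at as y \<in> Aut" using l by (rule word_at_Aut)
  have G: "word_at as y \<in> elementary_group L" unfolding word_at_def by (rule G_word) (use l in auto)
  have eq: "word_at as i \<circ> ginv (word_at as y) \<circ> word_at as y = word_at as i" for i
    using W by (simp add: fun_eq_iff Aut_inv_apply)
  have "cell_family Y y (\<lambda>i. (word_at as i \<circ> ginv (word_at as y)) \<circ> word_at as y)"
    by (rule cell_family_prod[OF C1 cell_family_near_one[OF C1 y as] cell_family_const[OF G b y]])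
      (simp_all only: eq b)
  then show ?thesis by (simp only: eq)
qed

text \<open>Write $g e^{x_0} = e^p h e^w$ for the value $x_0$ at the point. Then
  $g e^{x} = e^p h (e^w e^{x - x_0})$, where the bracket is decomposed by means of the Bergman operator
  $B_+(x - x_0, w)$ with the constant $w$.\<close>

theorem cell_regular_C2:
  assumes C2: "condition_C2 L" and g: "g \<in> elementary_group L" and x: "cont_into Y y 1 x" and b: "big_cell (g \<circ> ex (x y))"
  shows "eventually (\<lambda>i. big_cell (g \<circ> ex (x i))) (nhdsin Y y)"
    "cont_into Y y 1 u \<Longrightarrow> cont_into Y y 1 (\<lambda>i. inv_into (gr 1) (coef L (ginv (g \<circ> ex (x i))) 1 1) (u i))"
proof -
  note mx = cont_into_mem[OF x signs(1)]
  have y: "y \<in> topspace Y" by (rule mx(1))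
  define x0 where "x0 = x y"
  have x0: "x0 \<in> gr 1" "- x0 \<in> gr 1" using mx(2) gr_mem(4) by (auto simp: x0_def)
  obtain h w where d: "cell_point (g \<circ> ex x0) \<in> gr 1" and h: "graded_aut h" and w: "w \<in> gr (-1)"
    and ge: "g \<circ> ex x0 = ex (cell_point (g \<circ> ex x0)) \<circ> h \<circ> ex w"
    using big_cell_obtain[OF b[folded x0_def]] by metis
  define p where "p = cell_point (g \<circ> ex x0)"
  have p: "p \<in> gr 1" "- p \<in> gr 1" using d gr_mem(4) by (auto simp: p_def)
  have mw: "- w \<in> gr (-1)" using w gr_mem(4) by blast
  have "h = ex (- p) \<circ> (g \<circ> ex x0) \<circ> ex (- w)"
    using ex_minus[OF signs(1) p(1)] ex_minus[OF signs(2) w] fun_cong[OF ge[folded p_def]] by (simp add: fun_eq_iff)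
  then have hG: "h \<in> elementary_group L" using g p(2) mw x0(1) by (auto intro!: G_comp G_ex)
  have hc: "cont_into Y y 1 (\<lambda>i. h (u i))" if u: "cont_into Y y 1 u" for u
    by (rule cont_at_cong[OF eventually_mono[OF cont_into_mem(3)[OF u signs(1)]] group_element_continuous[OF hG signs(1) u]])
      (simp add: graded_aut_pr[OF h] pr_of_gr)
  \<comment> \<open>The displacement from the base point; what remains of the word is a pair with the constant letter w.\<close>
  define t where "t = (\<lambda>i. x i + - x0)"
  have t: "cont_into Y y 1 t" unfolding t_def by (rule cont_into_plus[OF x cont_into_const[OF y signs(1) x0(2)] signs(1)])
  have "big_cell (ex w \<circ> ex (t y))" using big_cell_ex[of w] w by (simp add: t_def x0_def ex_0)
  from bergman_continuous_C2[OF C2 t w this]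
  have evb: "eventually (\<lambda>i. big_cell (ex w \<circ> ex (t i))) (nhdsin Y y)"
    and B: "\<And>u. cont_into Y y 1 u \<Longrightarrow> cont_into Y y 1 (\<lambda>i. inv_into (gr 1) (bergman L (t i) w) (u i))"
    unfolding bergman_continuous_at_def by blast+
  let ?\<kappa> = "\<lambda>i. ex w \<circ> ex (t i)"
  have main: "big_cell (g \<circ> ex (x i)) \<and> (\<forall>u \<in> gr 1. inv_into (gr 1) (coef L (ginv (g \<circ> ex (x i))) 1 1) u
       = h (inv_into (gr 1) (bergman L (t i) w) u))"
    if bi: "big_cell (?\<kappa> i)" and ti: "t i \<in> gr 1" for i
  proof -
    obtain k v where q: "cell_point (?\<kappa> i) \<in> gr 1" and k: "graded_aut k" and v: "v \<in> gr (-1)"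
      and \<kappa>: "?\<kappa> i = ex (cell_point (?\<kappa> i)) \<circ> k \<circ> ex v"
      by (rule big_cell_obtain[OF bi])
    define q' where "q' = cell_point (?\<kappa> i)"
    note \<kappa>' = \<kappa>[folded q'_def] and q' = q[folded q'_def]
    have "x i = x0 + t i" by (simp add: t_def)
    then have "g \<circ> ex (x i) = g \<circ> ex x0 \<circ> ex (t i)"
      by (simp only: o_assoc flip: ex_add[OF signs(1) x0(1) ti])
    also have "\<dots> = ex p \<circ> h \<circ> ?\<kappa> i" using ge[folded p_def] by (simp only: o_assoc)
    also have "\<dots> = ex p \<circ> h \<circ> (ex q' \<circ> k \<circ> ex v) \<circ> id \<circ> ex 0" by (simp add: \<kappa>' ex_0)
    also have "\<dots> = ex (p + h q') \<circ> (h \<circ> k \<circ> id) \<circ> ex (ginv id v + 0)"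
      by (rule big_cell_merge[OF p(1) h q' k v graded_aut_id gr_mem(1)])
    finally have eq: "g \<circ> ex (x i) = ex (p + h q') \<circ> (h \<circ> k) \<circ> ex v" by (simp add: inv_id)
    have m: "p + h q' \<in> gr 1" "graded_aut (h \<circ> k)"
      using gr_mem(2)[OF p(1) graded_autD(2)[OF h q']] graded_aut_comp[OF h k] by blast+
    have "inv_into (gr 1) (coef L (ginv (g \<circ> ex (x i))) 1 1) u = h (inv_into (gr 1) (bergman L (t i) w) u)"
      if u: "u \<in> gr 1" for u
    proof -
      have "inv_into (gr 1) (coef L (ginv (g \<circ> ex (x i))) 1 1) u = h (k u)"
        using cell_data(3)[OF m v eq u] by simp
      moreover have "inv_into (gr 1) (bergman L (t i) w) u = k u"
      proof -
        have "inv_into (gr 1) (coef L (ginv (?\<kappa> i)) 1 1) u = inv_into (gr 1) (bergman L (t i) w) u"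
          by (rule inv_into_cong_on, rule bergman_coef(1)) (use ti w in simp_all)
        with cell_data(3)[OF q' k v \<kappa>' u] show ?thesis by simp
      qed
      ultimately show ?thesis by simp
    qed
    moreover have "big_cell (g \<circ> ex (x i))" unfolding big_cell_def using m v eq by blast
    ultimately show ?thesis by blast
  qed
  have ev: "eventually (\<lambda>i. big_cell (?\<kappa> i) \<and> t i \<in> gr 1) (nhdsin Y y)"
    using evb cont_into_mem(3)[OF t signs(1)] by eventually_elim simp
  then show "eventually (\<lambda>i. big_cell (g \<circ> ex (x i))) (nhdsin Y y)"
    by (rule eventually_mono) (use main in blast)
  assume u: "cont_into Y y 1 u"
  show "cont_into Y y 1 (\<lambda>i. inv_into (gr 1) (coef L (ginv (g \<circ> ex (x i))) 1 1) (u i))"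
  proof (rule cont_at_cong[OF _ hc[OF B[OF u]]])
    show "eventually (\<lambda>i. h (inv_into (gr 1) (bergman L (t i) w) (u i))
        = inv_into (gr 1) (coef L (ginv (g \<circ> ex (x i))) 1 1) (u i)) (nhdsin Y y)"
      using ev cont_into_mem(3)[OF u signs(1)]
    proof eventually_elim
      case (elim i)
      with main[of i] show ?case by simp
    qed
  qed
qed

section \<open>Smoothness of coordinates\<close>

text \<open>The input for \<open>Cinf_on_solve\<close>: openness of the big cell in the parameter and joint continuity of the
  inverse denominator.\<close>

definition regular_family :: "'e topology \<Rightarrow> 'e set \<Rightarrow> ('e \<Rightarrow> 'g \<Rightarrow> 'g) \<Rightarrow> bool" where
  "regular_family T \<Omega> \<gamma> \<longleftrightarrow>
     openin T {y \<in> \<Omega>. big_cell (\<gamma> y)} \<and>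
     continuous_map (subtopology (prod_topology T (Vt 1)) ({y \<in> \<Omega>. big_cell (\<gamma> y)} \<times> gr 1)) (Vt 1)
       (\<lambda>(y, u). inv_into (gr 1) (coef L (ginv (\<gamma> y)) 1 1) u)"

lemma regular_familyI:
  assumes \<Omega>: "openin T \<Omega>"
    and ev: "\<And>y. y \<in> \<Omega> \<Longrightarrow> big_cell (\<gamma> y) \<Longrightarrow> eventually (\<lambda>i. big_cell (\<gamma> i)) (nhdsin (subtopology T \<Omega>) y)"
    \<comment> \<open>The inverse denominator is tested at each point of the product, with both arguments variable.\<close>
    and cont: "\<And>X p. X = subtopology (prod_topology T (Vt 1)) ({y \<in> \<Omega>. big_cell (\<gamma> y)} \<times> gr 1) \<Longrightarrow>
      p \<in> topspace X \<Longrightarrow> big_cell (\<gamma> (fst p)) \<Longrightarrow> continuous_map X (subtopology T \<Omega>) fst \<Longrightarrow> cont_into X p 1 snd \<Longrightarrow>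
      cont_into X p 1 (\<lambda>p. inv_into (gr 1) (coef L (ginv (\<gamma> (fst p))) 1 1) (snd p))"
  shows "regular_family T \<Omega> \<gamma>"
  unfolding regular_family_def
proof
  let ?\<Omega> = "{y \<in> \<Omega>. big_cell (\<gamma> y)}"
  show "openin T ?\<Omega>"
  proof (subst openin_subopen, intro ballI)
    fix y assume y: "y \<in> ?\<Omega>"
    then have "y \<in> topspace (subtopology T \<Omega>)" using openin_subset[OF \<Omega>] by auto
    then obtain S where S: "openin (subtopology T \<Omega>) S" "y \<in> S" "\<forall>i\<in>S. big_cell (\<gamma> i)"
      using ev[of y] y by (auto simp: eventually_nhdsin)
    then have "openin T S" "S \<subseteq> \<Omega>" using \<Omega> by (auto simp: openin_open_subtopology)
    with S show "\<exists>S. openin T S \<and> y \<in> S \<and> S \<subseteq> ?\<Omega>" by blast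
  qed
  let ?X = "subtopology (prod_topology T (Vt 1)) (?\<Omega> \<times> gr 1)"
  have f: "continuous_map ?X (subtopology T \<Omega>) fst"
    by (auto simp: continuous_map_in_subtopology intro: continuous_map_from_subtopology continuous_map_fst)
  have s: "continuous_map ?X (Vt 1) snd"
    by (intro continuous_map_from_subtopology continuous_map_snd)
  show "continuous_map ?X (Vt 1) (\<lambda>(y, u). inv_into (gr 1) (coef L (ginv (\<gamma> y)) 1 1) u)"
    unfolding continuous_map_iff_cont_at case_prod_unfold
    using cont[OF refl _ _ f] s by (auto simp: continuous_map_iff_cont_at)
qed

lemma continuous_letter:
  assumes "letter_family (\<lambda>\<sigma>. continuous_map Y (Vt \<sigma>)) a" "y \<in> topspace Y"
  shows "letter_family (cont_into Y y) a"
  using assms by (auto simp: letter_family_def continuous_map_iff_cont_at)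

lemma regular_family_C1:
  assumes C1: "condition_C1 L" and \<Omega>: "openin T \<Omega>"
    and as: "\<And>a. a \<in> set as \<Longrightarrow> letter_family (\<lambda>\<sigma>. continuous_map (subtopology T \<Omega>) (Vt \<sigma>)) a"
  shows "regular_family T \<Omega> (word_at as)"
proof (rule regular_familyI[OF \<Omega>])
  have t: "topspace (subtopology T \<Omega>) = \<Omega>" using openin_subset[OF \<Omega>] by auto
  fix y assume y: "y \<in> \<Omega>" "big_cell (word_at as y)"
  have yt: "y \<in> topspace (subtopology T \<Omega>)" using y(1) unfolding t .
  have "cell_family (subtopology T \<Omega>) y (word_at as)"
    by (rule cell_family_word[OF C1 yt continuous_letter[OF as yt] y(2)])
  then show "eventually (\<lambda>i. big_cell (word_at as i)) (nhdsin (subtopology T \<Omega>) y)"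
    by (rule cell_family_regular(1))
next
  fix X p assume p: "p \<in> topspace X" "big_cell (word_at as (fst p))"
    and f: "continuous_map X (subtopology T \<Omega>) fst" and s: "cont_into X p 1 snd"
  let ?as = "map (\<lambda>a. a \<circ> fst) as"
  have at: "word_at ?as q = word_at as (fst q)" for q by (simp add: word_at_def o_def)
  have "letter_family (\<lambda>\<sigma>. continuous_map X (Vt \<sigma>)) b" if b: "b \<in> set ?as" for b
    using b as continuous_map_compose[OF f] by (fastforce simp: letter_family_def)
  then have "cell_family X p (word_at ?as)"
    by (intro cell_family_word[OF C1 p(1) continuous_letter]) (simp_all add: p at)
  from cell_family_regular(2)[OF this s]
  show "cont_into X p 1 (\<lambda>p. inv_into (gr 1) (coef L (ginv (word_at as (fst p))) 1 1) (snd p))"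
    by (simp add: at)
qed

lemma regular_family_C2:
  assumes C2: "condition_C2 L" and g: "g \<in> elementary_group L"
  shows "regular_family (Vt 1) (gr 1) (\<lambda>x. g \<circ> ex x)"
proof (rule regular_familyI)
  show "openin (Vt 1) (gr 1)" using openin_topspace[of "Vt 1"] by simp
  have e: "subtopology (Vt 1) (gr 1) = Vt 1" using subtopology_topspace[of "Vt 1"] by simp
  {
    fix y assume y: "y \<in> gr 1" "big_cell (g \<circ> ex y)"
    have "cont_into (Vt 1) y 1 (\<lambda>i. i)" using y continuous_map_id[of "Vt 1"]
      unfolding continuous_map_iff_cont_at by (auto simp: id_def)
    from cell_regular_C2(1)[OF C2 g this y(2)]
    show "eventually (\<lambda>i. big_cell (g \<circ> ex i)) (nhdsin (subtopology (Vt 1) (gr 1)) y)"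
      unfolding e .
  next
    fix X p assume p: "p \<in> topspace X" "big_cell (g \<circ> ex (fst p))"
      and f: "continuous_map X (subtopology (Vt 1) (gr 1)) fst" and s: "cont_into X p 1 snd"
    have "cont_into X p 1 fst" using f p unfolding e by (simp add: continuous_map_iff_cont_at)
    from cell_regular_C2(2)[OF C2 g this p(2) s]
    show "cont_into X p 1 (\<lambda>p. inv_into (gr 1) (coef L (ginv (g \<circ> ex (fst p))) 1 1) (snd p))" .
  }
qed

lemma coef_inverse:
  assumes "\<gamma> \<in> Aut" "big_cell \<gamma>" "u \<in> gr 1"
  shows "inv_into (gr 1) (coef L (ginv \<gamma>) 1 1) (coef L (ginv \<gamma>) 1 1 u) = u"
    "coef L (ginv \<gamma>) 1 1 (inv_into (gr 1) (coef L (ginv \<gamma>) 1 1) u) = u"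
proof -
  have "bij_betw (coef L (ginv \<gamma>) 1 1) (gr 1) (gr 1)"
    using assms(2) big_cell_iff_GL[OF assms(1)] GL_on_iff[OF module_axioms gr_subspace] by blast
  then show "inv_into (gr 1) (coef L (ginv \<gamma>) 1 1) (coef L (ginv \<gamma>) 1 1 u) = u"
    "coef L (ginv \<gamma>) 1 1 (inv_into (gr 1) (coef L (ginv \<gamma>) 1 1) u) = u"
    using assms(3) bij_betw_inv_into_left bij_betw_inv_into_right by fast+
qed

text \<open>The denominator is a smooth family of endomorphisms and the nominator a smooth map,
  because they are matrix coefficients of an inverse word. So the quotient is smooth once the inverse
  denominator is continuous.\<close>

theorem cell_point_smooth:
  fixes s :: "'k \<Rightarrow> 'e::ab_group_add \<Rightarrow> 'e"
  assumes T: "continuous_module s T" and \<Omega>: "\<Omega> \<subseteq> topspace T"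
    and as: "\<And>a. a \<in> set as \<Longrightarrow> letter_family (\<lambda>\<sigma>. Cinf_on s T sm (Vt \<sigma>) \<Omega>) a"
    and reg: "regular_family T \<Omega> (word_at as)"
  shows "Cinf_on s T sm (Vt 1) {y \<in> \<Omega>. big_cell (word_at as y)} (\<lambda>y. cell_point (word_at as y))"
proof -
  let ?W = "{y \<in> \<Omega>. big_cell (word_at as y)}"
  let ?s = "module_prod.scale s sm" and ?T = "prod_topology T (Vt 1)"
  note V = Vt_continuous_module[OF signs(1)]
  let ?D = "\<lambda>y. coef L (ginv (word_at as y)) 1 1"
  have W: "?W \<subseteq> topspace T" using \<Omega> by auto
  have l: "a y \<in> letters" if "y \<in> ?W" "a \<in> set as" for y a
    using letter_family_mem[where P = "\<lambda>\<sigma>. Cinf_on s T sm (Vt \<sigma>) \<Omega>", OF closed_class_Cinf_on[OF \<Omega>] as] that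
    by (simp add: eventually_principal)
  have A: "word_at as y \<in> Aut" if "y \<in> ?W" for y
    using l[OF that] by (rule word_at_Aut)
  have asW: "letter_family (\<lambda>\<sigma>. Cinf_on s T sm (Vt \<sigma>) ?W) a" if "a \<in> set as" for a
    using as[OF that] by (auto simp: letter_family_def intro: Cinf_on_subset)
  have sub: "?W \<times> gr 1 \<subseteq> topspace ?T" using W by auto
  note sc = module_prod_scale[OF continuous_module_module[OF T] continuous_module_module[OF V]]
  have cf: "Cinf_on ?s ?T s T (?W \<times> gr 1) fst"
    by (rule Cinf_on_linear[OF continuous_map_fst sub]) (simp add: sc)
  have cs: "Cinf_on ?s ?T sm (Vt 1) (?W \<times> gr 1) snd"
    by (rule Cinf_on_linear[OF continuous_map_snd sub]) (simp add: sc)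
  let ?as = "map (\<lambda>a. a \<circ> fst) as"
  have at: "word_at ?as q = word_at as (fst q)" for q :: "'e \<times> 'g" by (simp add: word_at_def o_def)
  have as': "letter_family (\<lambda>\<sigma>. Cinf_on ?s ?T sm (Vt \<sigma>) (?W \<times> gr 1)) b" if b: "b \<in> set ?as" for b
  proof -
    obtain a where a: "a \<in> set as" "b = a \<circ> fst" using b by auto
    show ?thesis using asW[OF a(1)] Cinf_on_compose[OF cf, of sm _ ?W a]
      by (auto simp: letter_family_def a(2) o_def)
  qed
  let ?P = "\<lambda>\<sigma>. Cinf_on ?s ?T sm (Vt \<sigma>) (?W \<times> gr 1)"
  have P: "closed_class (principal (?W \<times> gr 1)) ?P" by (rule closed_class_Cinf_on[OF sub])
  have gs: "gclass ?P snd" by (rule gclass_homogeneous[where P = ?P, OF P signs(1) cs])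
  have "Cinf_on ?s ?T sm (Vt 1) (?W \<times> gr 1) (\<lambda>q. pr L 1 (ginv (word_at ?as q) (snd q)))"
    by (rule gclass_ginv_word[where P = ?P, OF P as' gs signs(1)])
  then have D: "Cinf_on ?s ?T sm (Vt 1) (?W \<times> topspace (Vt 1)) (\<lambda>(y, u). ?D y u)"
    by (simp only: Vt_space1) (erule Cinf_on_cong, auto simp: at coef_apply)
  have S: "Cinf_on ?s ?T sm (Vt 1) (?W \<times> topspace (Vt 1)) (\<lambda>(y, u). inv_into (gr 1) (?D y) u)"
  proof (rule Cinf_on_solve[OF T V W D])
    show "?D y \<in> End_on sm (topspace (Vt 1))" if "y \<in> ?W" for y
      using coef_End[OF Aut_inv[OF A[OF that]]] by simp
    show "continuous_map (subtopology ?T (?W \<times> topspace (Vt 1))) (Vt 1) (\<lambda>(y, u). inv_into (gr 1) (?D y) u)"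
      using reg by (simp add: regular_family_def)
    show "inv_into (gr 1) (?D y) (?D y u) = u \<and> ?D y (inv_into (gr 1) (?D y) u) = u"
      if "y \<in> ?W" "u \<in> topspace (Vt 1)" for y u
      using coef_inverse[OF A[OF that(1)]] that by simp
  qed
  let ?Q = "\<lambda>\<sigma>. Cinf_on s T sm (Vt \<sigma>) ?W"
  have Q: "closed_class (principal ?W) ?Q" by (rule closed_class_Cinf_on[OF W])
  have n: "Cinf_on s T sm (Vt 1) ?W (\<lambda>y. pr L 1 (ginv (word_at as y) EE))"
    by (rule gclass_ginv_word[where P = ?Q, OF Q asW gclass_euler[where P = ?Q, OF Q] signs(1)])
  have i: "Cinf_on s T s T ?W (\<lambda>y. y)"
    by (rule Cinf_on_linear[OF _ W]) (use continuous_map_id[of T] in \<open>auto simp: id_def\<close>)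
  have "Cinf_on s T sm (Vt 1) ?W (\<lambda>y. (\<lambda>(y, u). inv_into (gr 1) (?D y) u) (y, pr L 1 (ginv (word_at as y) EE)))"
    by (rule Cinf_on_compose[OF Cinf_on_pair[OF T V i n] S]) (auto simp: pr_gr)
  then show ?thesis by (simp add: cell_point_def)
qed

end

section \<open>Charted spaces\<close>

text \<open>The part of the manifold structure that does not refer to smoothness; unlike smoothness of transition
  maps it passes at once to products.\<close>

definition charted :: "('k, 'e, 'x) manifold \<Rightarrow> bool" where
  "charted M \<longleftrightarrow> \<Union>(fst ` atlas M) = topspace (mtop M) \<and>
     (\<forall>(U, \<phi>) \<in> atlas M. openin (mtop M) U \<and> openin (model M) (\<phi> ` U) \<and>
        homeomorphic_map (subtopology (mtop M) U) (subtopology (model M) (\<phi> ` U)) \<phi>)"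

lemma smooth_manifold_charted: "smooth_manifold M \<Longrightarrow> charted M"
  unfolding smooth_manifold_def charted_def by blast

lemma chartedD:
  assumes "charted M" "(U, \<phi>) \<in> atlas M"
  shows "openin (mtop M) U" "openin (model M) (\<phi> ` U)" "inj_on \<phi> U" "U \<subseteq> topspace (mtop M)"
    "continuous_map (subtopology (mtop M) U) (subtopology (model M) (\<phi> ` U)) \<phi>"
    "\<And>S. S \<subseteq> U \<Longrightarrow> openin (model M) (\<phi> ` S) \<longleftrightarrow> openin (mtop M) S"
    "homeomorphic_map (subtopology (mtop M) U) (subtopology (model M) (\<phi> ` U)) \<phi>"
proof -
  have h: "openin (mtop M) U" "openin (model M) (\<phi> ` U)"
    "homeomorphic_map (subtopology (mtop M) U) (subtopology (model M) (\<phi> ` U)) \<phi>"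
    using assms unfolding charted_def by blast+
  then show "openin (mtop M) U" "openin (model M) (\<phi> ` U)"
    "homeomorphic_map (subtopology (mtop M) U) (subtopology (model M) (\<phi> ` U)) \<phi>" by blast+
  show s: "U \<subseteq> topspace (mtop M)" by (rule openin_subset[OF h(1)])
  then have t: "topspace (subtopology (mtop M) U) = U" by auto
  show inj: "inj_on \<phi> U" using h(3) t by (simp add: homeomorphic_map_def)
  show "continuous_map (subtopology (mtop M) U) (subtopology (model M) (\<phi> ` U)) \<phi>"
    by (rule homeomorphic_imp_continuous_map[OF h(3)])
  fix S assume S: "S \<subseteq> U"
  have "openin (subtopology (model M) (\<phi> ` U)) (\<phi> ` S) \<longleftrightarrow> openin (subtopology (mtop M) U) S"
    by (rule homeomorphic_map_openness[OF h(3)]) (use S t in blast)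
  then show "openin (model M) (\<phi> ` S) \<longleftrightarrow> openin (mtop M) S"
    using S h(1,2) by (auto simp: openin_open_subtopology)
qed

lemma charted_cover:
  assumes "charted M" "p \<in> topspace (mtop M)"
  shows "\<exists>U \<phi>. (U, \<phi>) \<in> atlas M \<and> p \<in> U"
proof -
  have "p \<in> \<Union>(fst ` atlas M)" using assms by (simp add: charted_def)
  then obtain c where "c \<in> atlas M" "p \<in> fst c" by blast
  then show ?thesis by (cases c) auto
qed

lemma charted_openI:
  assumes M: "charted M" and D: "D \<subseteq> topspace (mtop M)"
    and op: "\<And>U \<phi>. (U, \<phi>) \<in> atlas M \<Longrightarrow> openin (model M) (\<phi> ` (U \<inter> D))"
  shows "openin (mtop M) D"
proof (subst openin_subopen, intro ballI)
  fix p assume p: "p \<in> D"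
  then obtain U \<phi> where U: "(U, \<phi>) \<in> atlas M" "p \<in> U" using charted_cover[OF M] D by blast
  have "openin (mtop M) (U \<inter> D)" using chartedD(6)[OF M U(1)] op[OF U(1)] by simp
  then show "\<exists>T. openin (mtop M) T \<and> p \<in> T \<and> T \<subseteq> D" using U p by blast
qed

lemma smooth_on_continuous:
  assumes "smooth_on s T s' T' U f"
  shows "continuous_map (subtopology T U) T' f"
proof -
  have U: "U \<subseteq> topspace T" using assms openin_subset by (auto simp: smooth_on_def)
  have "Ck_level s T s' T' 0 0 (Pt ` U) (f \<circ> un_Pt)" using assms unfolding smooth_on_def by blast
  from continuous_map_compose[OF continuous_map_Pt[OF U] this[unfolded Ck_level.simps]] show ?thesis by (simp add: o_def)
qed

text \<open>Openness of the domain and continuity follow from the local representatives: each one is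
  continuous on an open set, and charts carry open sets to open sets.\<close>

lemma smooth_map_onI:
  assumes M: "charted M" and N: "charted N" and D: "D \<subseteq> topspace (mtop M)" and f: "f ` D \<subseteq> topspace (mtop N)"
    and rep: "\<And>U \<phi> W \<psi>. (U, \<phi>) \<in> atlas M \<Longrightarrow> (W, \<psi>) \<in> atlas N \<Longrightarrow>
        smooth_on (scal M) (model M) (scal N) (model N)
          (\<phi> ` {p \<in> U \<inter> D. f p \<in> W}) (\<lambda>x. \<psi> (f (inv_into U \<phi> x)))"
  shows "smooth_map_on M N D f"
proof -
  have pre: "openin (mtop M) {p \<in> D. f p \<in> Z}" if Z: "openin (mtop N) Z" for Z
  proof (subst openin_subopen, intro ballI)
    fix p assume p: "p \<in> {p \<in> D. f p \<in> Z}"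
    obtain U \<phi> where U: "(U, \<phi>) \<in> atlas M" "p \<in> U" using charted_cover[OF M] D p by blast
    obtain W \<psi> where W: "(W, \<psi>) \<in> atlas N" "f p \<in> W" using charted_cover[OF N] f p by blast
    let ?R = "{q \<in> U \<inter> D. f q \<in> W}" and ?r = "\<lambda>x. \<psi> (f (inv_into U \<phi> x))"
    note cM = chartedD[OF M U(1)] and cN = chartedD[OF N W(1)]
    have sm: "smooth_on (scal M) (model M) (scal N) (model N) (\<phi> ` ?R) ?r" by (rule rep[OF U(1) W(1)])
    then have R: "openin (model M) (\<phi> ` ?R)" by (simp add: smooth_on_def)
    have cr: "continuous_map (subtopology (model M) (\<phi> ` ?R)) (model N) ?r" by (rule smooth_on_continuous[OF sm])
    have ZW: "openin (model N) (\<psi> ` (Z \<inter> W))"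
      using cN(6)[of "Z \<inter> W"] Z cN(1) by (simp add: openin_Int)
    have Rs: "topspace (subtopology (model M) (\<phi> ` ?R)) = \<phi> ` ?R" using openin_subset[OF R] by auto
    have "openin (subtopology (model M) (\<phi> ` ?R)) {x \<in> \<phi> ` ?R. ?r x \<in> \<psi> ` (Z \<inter> W)}"
      using openin_continuous_map_preimage[OF cr ZW] unfolding Rs .
    then have A: "openin (model M) {x \<in> \<phi> ` ?R. ?r x \<in> \<psi> ` (Z \<inter> W)}"
      using openin_open_subtopology[OF R] by blast
    have ii: "inv_into U \<phi> (\<phi> q) = q" if "q \<in> U" for q by (rule inv_into_f_f[OF cM(3) that])
    have "{x \<in> \<phi> ` ?R. ?r x \<in> \<psi> ` (Z \<inter> W)} = \<phi> ` {q \<in> ?R. f q \<in> Z}"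
    proof
      show "{x \<in> \<phi> ` ?R. ?r x \<in> \<psi> ` (Z \<inter> W)} \<subseteq> \<phi> ` {q \<in> ?R. f q \<in> Z}"
      proof
        fix x assume "x \<in> {x \<in> \<phi> ` ?R. ?r x \<in> \<psi> ` (Z \<inter> W)}"
        then obtain q where q: "q \<in> ?R" "x = \<phi> q" "?r x \<in> \<psi> ` (Z \<inter> W)" by blast
        then have "\<psi> (f q) \<in> \<psi> ` (Z \<inter> W)" using ii[of q] by simp
        then obtain z where "z \<in> Z" "z \<in> W" "\<psi> (f q) = \<psi> z" by blast
        then have "f q = z" using inj_onD[OF cN(3)] q(1) by blast
        then show "x \<in> \<phi> ` {q \<in> ?R. f q \<in> Z}" using q \<open>z \<in> Z\<close> by blast
      qed
      show "\<phi> ` {q \<in> ?R. f q \<in> Z} \<subseteq> {x \<in> \<phi> ` ?R. ?r x \<in> \<psi> ` (Z \<inter> W)}"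
        using ii by auto
    qed
    with A have "openin (mtop M) {q \<in> ?R. f q \<in> Z}" using cM(6)[of "{q \<in> ?R. f q \<in> Z}"] by auto
    then show "\<exists>T. openin (mtop M) T \<and> p \<in> T \<and> T \<subseteq> {p \<in> D. f p \<in> Z}"
      using U W p by (intro exI[of _ "{q \<in> ?R. f q \<in> Z}"]) auto
  qed
  have "{p \<in> D. f p \<in> topspace (mtop N)} = D" using f by auto
  with pre[OF openin_topspace] have oD: "openin (mtop M) D" by simp
  have "continuous_map (subtopology (mtop M) D) (mtop N) f"
    unfolding continuous_map_def
  proof (intro conjI allI impI)
    show "f \<in> topspace (subtopology (mtop M) D) \<rightarrow> topspace (mtop N)" using f by auto
    fix Z assume "openin (mtop N) Z"
    have "{x \<in> topspace (subtopology (mtop M) D). f x \<in> Z} = {p \<in> D. f p \<in> Z}" using D by auto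
    then show "openin (subtopology (mtop M) D) {x \<in> topspace (subtopology (mtop M) D). f x \<in> Z}"
      using pre[OF \<open>openin (mtop N) Z\<close>] oD by (simp add: openin_open_subtopology)
  qed
  with oD rep show ?thesis unfolding smooth_map_on_def by blast
qed

lemma charted_prod:
  assumes M: "charted M" and N: "charted N"
  shows "charted (prod_manifold M N)"
  unfolding charted_def
proof (intro conjI ballI)
  show "\<Union> (fst ` atlas (prod_manifold M N)) = topspace (mtop (prod_manifold M N))"
  proof
    show "\<Union> (fst ` atlas (prod_manifold M N)) \<subseteq> topspace (mtop (prod_manifold M N))"
      using chartedD(4)[OF M] chartedD(4)[OF N] by (fastforce simp: prod_manifold_def)
    show "topspace (mtop (prod_manifold M N)) \<subseteq> \<Union> (fst ` atlas (prod_manifold M N))"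
    proof
      fix p assume "p \<in> topspace (mtop (prod_manifold M N))"
      then obtain x y where p: "p = (x, y)" "x \<in> topspace (mtop M)" "y \<in> topspace (mtop N)"
        by (auto simp: prod_manifold_def)
      then obtain U \<phi> W \<psi> where "(U, \<phi>) \<in> atlas M" "x \<in> U" "(W, \<psi>) \<in> atlas N" "y \<in> W"
        using charted_cover[OF M] charted_cover[OF N] by blast
      then have "(U \<times> W, map_prod \<phi> \<psi>) \<in> atlas (prod_manifold M N)" "p \<in> U \<times> W"
        by (auto simp: prod_manifold_def p)
      then show "p \<in> \<Union> (fst ` atlas (prod_manifold M N))" by force
    qed
  qed
  fix c assume "c \<in> atlas (prod_manifold M N)"
  then obtain U \<phi> W \<psi> where c: "c = (U \<times> W, map_prod \<phi> \<psi>)" and U: "(U, \<phi>) \<in> atlas M" and W: "(W, \<psi>) \<in> atlas N"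
    by (auto simp: prod_manifold_def)
  note cM = chartedD[OF M U] and cN = chartedD[OF N W]
  obtain \<phi>' \<psi>' where "homeomorphic_maps (subtopology (mtop M) U) (subtopology (model M) (\<phi> ` U)) \<phi> \<phi>'"
    "homeomorphic_maps (subtopology (mtop N) W) (subtopology (model N) (\<psi> ` W)) \<psi> \<psi>'"
    using cM(7) cN(7) unfolding homeomorphic_map_maps by blast
  then have "homeomorphic_maps (prod_topology (subtopology (mtop M) U) (subtopology (mtop N) W))
     (prod_topology (subtopology (model M) (\<phi> ` U)) (subtopology (model N) (\<psi> ` W)))
     (\<lambda>(x, y). (\<phi> x, \<psi> y)) (\<lambda>(x, y). (\<phi>' x, \<psi>' y))"
    unfolding homeomorphic_maps_prod by blast
  moreover have "(\<lambda>(x, y). (\<phi> x, \<psi> y)) = map_prod \<phi> \<psi>" by auto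
  ultimately have "homeomorphic_map (prod_topology (subtopology (mtop M) U) (subtopology (mtop N) W))
     (prod_topology (subtopology (model M) (\<phi> ` U)) (subtopology (model N) (\<psi> ` W))) (map_prod \<phi> \<psi>)"
    unfolding homeomorphic_map_maps by (intro exI) (simp only:)
  moreover have "map_prod \<phi> \<psi> ` (U \<times> W) = \<phi> ` U \<times> \<psi> ` W" by (rule map_prod_surj_on[OF refl refl])
  ultimately show "case c of (U, \<phi>) \<Rightarrow> openin (mtop (prod_manifold M N)) U \<and> openin (model (prod_manifold M N)) (\<phi> ` U) \<and>
        homeomorphic_map (subtopology (mtop (prod_manifold M N)) U) (subtopology (model (prod_manifold M N)) (\<phi> ` U)) \<phi>"
    using cM(1,2) cN(1,2)
    by (simp add: c prod_manifold_def openin_prod_Times_iff subtopology_Times)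
qed

lemma charted_module: "charted (module_manifold s T)"
proof -
  have "homeomorphic_map T T (\<lambda>x. x)" using homeomorphic_map_id[of T T] by (simp add: id_def)
  then show ?thesis by (simp add: charted_def module_manifold_def)
qed

section \<open>The manifold structure of the projective completion\<close>

lemma chart_image_eq:
  assumes "inj_on \<phi> U"
  shows "\<phi> ` {p \<in> U \<inter> D. f p \<in> W} = {x \<in> \<phi> ` (U \<inter> D). f (inv_into U \<phi> x) \<in> W}"
proof -
  have "inv_into U \<phi> (\<phi> q) = q" if "q \<in> U" for q by (rule inv_into_f_f[OF assms that])
  then show ?thesis by auto
qed

locale quasi_inverse_jordan_lie = topological_jordan_lie L
  for L :: "('k::{comm_ring_1, topological_space}, 'g::ab_group_add) graded_lie" +
  assumes C2: "condition_C2 L"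
begin

abbreviation "G \<equiv> elementary_group L"
abbreviation "base_plus \<equiv> base_flag L 1"
abbreviation "emb \<equiv> flag_embed L 1"
abbreviation "X \<equiv> proj_completion L 1"
abbreviation "cdom \<equiv> chart_dom L 1"
abbreviation "cmap \<equiv> chart_map L 1"

lemma act_emb: "act g (emb x) = act (g \<circ> ex x) base_plus"
  by (simp add: act_comp flag_embed_def)

lemma chart_dom_iff:
  assumes "h \<in> G" "\<kappa> \<in> Aut"
  shows "act \<kappa> base_plus \<in> cdom h \<longleftrightarrow> big_cell (ginv h \<circ> \<kappa>)"
proof -
  have h: "h \<in> Aut" by (rule G_Aut[OF assms(1)])
  have "act \<kappa> base_plus \<in> cdom h \<longleftrightarrow> act (ginv h \<circ> \<kappa>) base_plus \<in> emb ` gr 1"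
  proof -
    have d: "cdom h = act h ` (emb ` gr 1)" by (simp add: chart_dom_def image_image)
    show ?thesis
    proof
      assume "act \<kappa> base_plus \<in> cdom h"
      then obtain q where q: "q \<in> emb ` gr 1" "act \<kappa> base_plus = act h q" unfolding d by blast
      then show "act (ginv h \<circ> \<kappa>) base_plus \<in> emb ` gr 1" by (simp only: act_comp act_inv(1)[OF h])
    next
      assume "act (ginv h \<circ> \<kappa>) base_plus \<in> emb ` gr 1"
      from imageI[OF this, of "act h"] show "act \<kappa> base_plus \<in> cdom h"
        by (simp only: d act_comp act_inv(2)[OF h])
    qed
  qed
  then show ?thesis using in_embed_iff_big_cell[OF Aut_comp[OF Aut_inv[OF h] assms(2)]] by simp
qed

lemma chart_map_act: "h \<in> G \<Longrightarrow> x \<in> gr 1 \<Longrightarrow> cmap h (act h (emb x)) = x"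
  unfolding chart_map_def
  by (rule the_equality) (use act_inj[OF G_Aut] flag_embed_inj in blast)+

lemma chart_map_point:
  assumes "h \<in> G" "\<kappa> \<in> Aut" "big_cell (ginv h \<circ> \<kappa>)"
  shows "cmap h (act \<kappa> base_plus) = cell_point (ginv h \<circ> \<kappa>)"
proof -
  have "act \<kappa> base_plus = act h (act (ginv h \<circ> \<kappa>) base_plus)"
    using act_inv(2)[OF G_Aut[OF assms(1)]] by (simp add: act_comp)
  also have "\<dots> = act h (emb (cell_point (ginv h \<circ> \<kappa>)))" by (simp only: act_big_cell[OF assms(3)])
  finally show ?thesis using chart_map_act[OF assms(1) big_cell_point_gr[OF assms(3)]] by simp
qed

lemma chart_bij:
  assumes h: "h \<in> G"
  shows "inj_on (cmap h) (cdom h)" "cmap h ` cdom h = gr 1"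
    "x \<in> gr 1 \<Longrightarrow> inv_into (cdom h) (cmap h) x = act h (emb x)"
    "x \<in> gr 1 \<Longrightarrow> act h (emb x) \<in> cdom h"
proof -
  show 1: "inj_on (cmap h) (cdom h)"
    by (rule inj_on_inverseI[where g = "\<lambda>x. act h (emb x)"]) (auto simp: chart_dom_def chart_map_act[OF h])
  show "cmap h ` cdom h = gr 1"
    unfolding chart_dom_def image_image by (simp add: chart_map_act[OF h] cong: image_cong_simp)
  show 2: "x \<in> gr 1 \<Longrightarrow> act h (emb x) \<in> cdom h" for x by (simp add: chart_dom_def)
  show "x \<in> gr 1 \<Longrightarrow> inv_into (cdom h) (cmap h) x = act h (emb x)"
    using inv_into_f_f[OF 1 2[of x]] chart_map_act[OF h, of x] by simp
qed

lemma emb_0: "emb 0 = base_plus"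
  by (simp add: flag_embed_def ex_0 act_id)

lemma chart_dom_subset: "g \<in> G \<Longrightarrow> cdom g \<subseteq> X"
  unfolding chart_dom_def proj_completion_def act_emb using G_comp G_ex by blast

lemma chart_cover: "X = (\<Union>g\<in>G. cdom g)"
proof
  show "X \<subseteq> (\<Union>g\<in>G. cdom g)"
  proof
    fix p assume "p \<in> X"
    then obtain g where "g \<in> G" "p = act g (emb 0)" by (auto simp: proj_completion_def emb_0)
    then show "p \<in> (\<Union>g\<in>G. cdom g)" using chart_bij(4)[of g 0] gr_mem(1) by blast
  qed
qed (use chart_dom_subset in blast)

lemma word_const_at: "word_at (map (\<lambda>a _. a) cs @ as) y = word cs \<circ> word_at as y"
  by (simp add: word_at_def word_append o_def)

lemma letter_const_Cinf_on:
  assumes "c \<in> letters" "\<Omega> \<subseteq> topspace T"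
  shows "letter_family (\<lambda>\<sigma>. Cinf_on s T sm (Vt \<sigma>) \<Omega>) (\<lambda>_. c)"
  using assms Cinf_on_const[OF Vt_continuous_module[OF signs(1)], of c \<Omega> T s] Cinf_on_const[OF Vt_continuous_module[OF signs(2)], of c \<Omega> T s]
  by (auto simp: letter_family_def)

lemma Cinf_on_self: "U \<subseteq> topspace T \<Longrightarrow> Cinf_on s T s T U (\<lambda>x. x)"
  by (rule Cinf_on_linear) (use continuous_map_id[of T] in \<open>auto simp: id_def\<close>)

text \<open>The coordinate change between the charts of $g$ and $h$ is the coordinate of
  $h^{-1} g\, e^{ad(x)}.o^+$, a family covered by (C2).\<close>

lemma transition:
  assumes "g \<in> G"
  shows "openin (Vt 1) {x \<in> gr 1. big_cell (g \<circ> ex x)}"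
    "Cinf_on sm (Vt 1) sm (Vt 1) {x \<in> gr 1. big_cell (g \<circ> ex x)} (\<lambda>x. cell_point (g \<circ> ex x))"
proof -
  obtain cs where cs: "set cs \<subseteq> letters" "g = word cs" by (rule G_obtain_word[OF assms])
  let ?as = "map (\<lambda>a _. a) cs @ [\<lambda>x. x]"
  have at: "word_at ?as x = g \<circ> ex x" for x unfolding word_const_at by (simp add: word_at_def cs(2))
  have r: "regular_family (Vt 1) (gr 1) (\<lambda>x. g \<circ> ex x)" by (rule regular_family_C2[OF C2 assms])
  then show "openin (Vt 1) {x \<in> gr 1. big_cell (g \<circ> ex x)}" by (simp add: regular_family_def)
  have l: "letter_family (\<lambda>\<sigma>. Cinf_on sm (Vt 1) sm (Vt \<sigma>) (gr 1)) a" if "a \<in> set ?as" for a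
  proof -
    from that consider c where "c \<in> letters" "a = (\<lambda>_. c)" | "a = (\<lambda>x. x)" using cs(1) by auto
    then show ?thesis
    proof cases
      case 1 show ?thesis unfolding 1(2) by (rule letter_const_Cinf_on[OF 1(1)]) simp
    next
      case 2 then show ?thesis using Cinf_on_self[of "gr 1" "Vt 1" sm] by (simp add: letter_family_def)
    qed
  qed
  have "Cinf_on sm (Vt 1) sm (Vt 1) {x \<in> gr 1. big_cell (word_at ?as x)} (\<lambda>x. cell_point (word_at ?as x))"
  proof (rule cell_point_smooth[OF Vt_continuous_module[OF signs(1)] _ l])
    have "word_at ?as = (\<lambda>x. g \<circ> ex x)" by (rule ext) (rule at)
    with r show "regular_family (Vt 1) (gr 1) (word_at ?as)" by (simp only:)
  qed simp_all
  then show "Cinf_on sm (Vt 1) sm (Vt 1) {x \<in> gr 1. big_cell (g \<circ> ex x)} (\<lambda>x. cell_point (g \<circ> ex x))"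
    by (simp only: at)
qed

text \<open>The final topology with respect to all the maps $x \mapsto g.x$ from $V^+$.\<close>

definition final_open :: "'g flag set \<Rightarrow> bool" where
  "final_open S \<longleftrightarrow> S \<subseteq> X \<and> (\<forall>g\<in>G. openin (Vt 1) {x \<in> gr 1. act g (emb x) \<in> S})"

definition final_topology :: "'g flag topology" where
  "final_topology = topology final_open"

lemma openin_final: "openin final_topology S \<longleftrightarrow> final_open S"
proof -
  have "istopology final_open"
    unfolding istopology_def
  proof (intro conjI allI impI)
    fix S T assume "final_open S" "final_open T"
    moreover have "{x \<in> gr 1. act g (emb x) \<in> S \<inter> T}
        = {x \<in> gr 1. act g (emb x) \<in> S} \<inter> {x \<in> gr 1. act g (emb x) \<in> T}" for g by auto
    ultimately show "final_open (S \<inter> T)" by (auto simp: final_open_def)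
  next
    fix K assume K: "\<forall>S\<in>K. final_open S"
    have "{x \<in> gr 1. act g (emb x) \<in> \<Union>K} = \<Union>((\<lambda>S. {x \<in> gr 1. act g (emb x) \<in> S}) ` K)" for g by auto
    then show "final_open (\<Union>K)" using K by (auto simp: final_open_def)
  qed
  then show ?thesis by (simp add: final_topology_def topology_inverse')
qed

lemma act_emb_X: "g \<in> G \<Longrightarrow> x \<in> gr 1 \<Longrightarrow> act g (emb x) \<in> X"
  using chart_bij(4) chart_dom_subset by blast

lemma topspace_final: "topspace final_topology = X"
proof -
  have "{x \<in> gr 1. act g (emb x) \<in> X} = topspace (Vt 1)" if "g \<in> G" for g
    using act_emb_X[OF that] by auto
  then have "openin final_topology X" using openin_topspace[of "Vt 1"] by (simp add: openin_final final_open_def)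
  then show ?thesis using openin_subset[of final_topology] openin_topspace[of final_topology]
    by (metis final_open_def openin_final subset_antisym)
qed

lemma act_emb_Aut: "g \<in> G \<Longrightarrow> x \<in> gr 1 \<Longrightarrow> g \<circ> ex x \<in> Aut"
  by (intro Aut_comp G_Aut ex_signed_Aut)

lemma chart_change:
  assumes "g \<in> G" "h \<in> G" "x \<in> gr 1"
  shows "act g (emb x) \<in> cdom h \<longleftrightarrow> big_cell ((ginv h \<circ> g) \<circ> ex x)"
    "big_cell ((ginv h \<circ> g) \<circ> ex x) \<Longrightarrow> cmap h (act g (emb x)) = cell_point ((ginv h \<circ> g) \<circ> ex x)"
  using chart_dom_iff[OF assms(2) act_emb_Aut[OF assms(1,3)]] chart_map_point[OF assms(2) act_emb_Aut[OF assms(1,3)]]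
  by (simp_all add: act_emb o_assoc)

text \<open>In the chart of any other group element this set is the preimage of an open set under a coordinate
  change, which is continuous on an open domain.\<close>

lemma final_preimage:
  assumes h: "h \<in> G" and Z: "openin (Vt 1) Z"
  shows "openin final_topology {p \<in> cdom h. cmap h p \<in> Z}"
  unfolding openin_final final_open_def
proof (intro conjI ballI)
  show "{p \<in> cdom h. cmap h p \<in> Z} \<subseteq> X" using chart_dom_subset[OF h] by blast
  fix g assume g: "g \<in> G"
  let ?k = "ginv h \<circ> g"
  have k: "?k \<in> G" by (rule G_comp[OF G_inv[OF h] g])
  let ?R = "{x \<in> gr 1. big_cell (?k \<circ> ex x)}"
  have R: "openin (Vt 1) ?R" by (rule transition(1)[OF k])
  have Rs: "topspace (subtopology (Vt 1) ?R) = ?R" by auto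
  have "openin (subtopology (Vt 1) ?R) {x \<in> ?R. cell_point (?k \<circ> ex x) \<in> Z}"
    using openin_continuous_map_preimage[OF Cinf_on_continuous[OF transition(2)[OF k]] Z] unfolding Rs .
  then have "openin (Vt 1) {x \<in> ?R. cell_point (?k \<circ> ex x) \<in> Z}"
    using openin_open_subtopology[OF R] by blast
  moreover have "{x \<in> gr 1. act g (emb x) \<in> {p \<in> cdom h. cmap h p \<in> Z}} = {x \<in> ?R. cell_point (?k \<circ> ex x) \<in> Z}"
  proof (rule Collect_cong)
    fix x show "x \<in> gr 1 \<and> act g (emb x) \<in> {p \<in> cdom h. cmap h p \<in> Z} \<longleftrightarrow> x \<in> ?R \<and> cell_point (?k \<circ> ex x) \<in> Z"
    proof (cases "x \<in> gr 1")
      case True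
      from chart_change[OF g h True] show ?thesis
        by (cases "big_cell (?k \<circ> ex x)") (simp_all add: True)
    qed simp
  qed
  ultimately show "openin (Vt 1) {x \<in> gr 1. act g (emb x) \<in> {p \<in> cdom h. cmap h p \<in> Z}}" by simp
qed

lemma Vt1_sub: "subtopology (Vt 1) (gr 1) = Vt 1"
  using subtopology_topspace[of "Vt 1"] by simp

lemma chart_homeomorphic:
  assumes h: "h \<in> G"
  shows "openin final_topology (cdom h)"
    "homeomorphic_map (subtopology final_topology (cdom h)) (Vt 1) (cmap h)"
proof -
  have "{p \<in> cdom h. cmap h p \<in> topspace (Vt 1)} = cdom h" using chart_bij(2)[OF h] by auto
  then show o: "openin final_topology (cdom h)" using final_preimage[OF h openin_topspace] by simp
  have t: "topspace (subtopology final_topology (cdom h)) = cdom h"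
    using chart_dom_subset[OF h] by (auto simp: topspace_final)
  show "homeomorphic_map (subtopology final_topology (cdom h)) (Vt 1) (cmap h)"
  proof (rule bijective_open_imp_homeomorphic_map)
    show "continuous_map (subtopology final_topology (cdom h)) (Vt 1) (cmap h)"
      unfolding continuous_map_def t
    proof (intro conjI allI impI)
      show "cmap h \<in> cdom h \<rightarrow> topspace (Vt 1)" using chart_bij(2)[OF h] by auto
      fix Z assume "openin (Vt 1) Z"
      from final_preimage[OF h this]
      show "openin (subtopology final_topology (cdom h)) {x \<in> cdom h. cmap h x \<in> Z}"
        unfolding openin_open_subtopology[OF o] by blast
    qed
    show "open_map (subtopology final_topology (cdom h)) (Vt 1) (cmap h)"
      unfolding open_map_def
    proof (intro allI impI)
      fix S assume "openin (subtopology final_topology (cdom h)) S"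
      then have S: "openin final_topology S" "S \<subseteq> cdom h" using openin_open_subtopology[OF o] by blast+
      have "cmap h ` S = {x \<in> gr 1. act h (emb x) \<in> S}"
      proof
        show "cmap h ` S \<subseteq> {x \<in> gr 1. act h (emb x) \<in> S}"
        proof
          fix y assume "y \<in> cmap h ` S"
          then obtain p where p: "p \<in> S" "y = cmap h p" by blast
          then obtain x where "x \<in> gr 1" "p = act h (emb x)" using S(2) unfolding chart_dom_def by blast
          then show "y \<in> {x \<in> gr 1. act h (emb x) \<in> S}" using p chart_map_act[OF h] by simp
        qed
        show "{x \<in> gr 1. act h (emb x) \<in> S} \<subseteq> cmap h ` S"
        proof
          fix x assume "x \<in> {x \<in> gr 1. act h (emb x) \<in> S}"
          then show "x \<in> cmap h ` S" using chart_map_act[OF h, of x] by (metis (mono_tags, lifting) image_iff mem_Collect_eq)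
        qed
      qed
      then show "openin (Vt 1) (cmap h ` S)" using S(1) h by (simp add: openin_final final_open_def)
    qed
    show "cmap h ` topspace (subtopology final_topology (cdom h)) = topspace (Vt 1)"
      unfolding t using chart_bij(2)[OF h] by simp
    show "inj_on (cmap h) (topspace (subtopology final_topology (cdom h)))"
      unfolding t by (rule chart_bij(1)[OF h])
  qed
qed

lemma completion_with_simps [simp]: "scal (completion_with L \<sigma> T) = sm" "model (completion_with L \<sigma> T) = Vt \<sigma>"
  "mtop (completion_with L \<sigma> T) = T" "atlas (completion_with L \<sigma> T) = chart_atlas L \<sigma>"
  by (simp_all add: completion_with_def)

lemma chart_atlas_iff: "(U, \<phi>) \<in> chart_atlas L 1 \<longleftrightarrow> (\<exists>g\<in>G. U = cdom g \<and> \<phi> = cmap g)"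
  by (auto simp: chart_atlas_def)

lemma completion_smooth_manifold: "smooth_manifold (completion_with L 1 final_topology)"
  unfolding smooth_manifold_def completion_with_simps
proof (intro conjI)
  show "topological_module sm (Vt 1)" by (rule Vt_topological_module[OF signs(1)])
  have "fst ` chart_atlas L 1 = cdom ` G" by (auto simp: chart_atlas_def image_image)
  then show "\<Union> (fst ` chart_atlas L 1) = topspace final_topology" using chart_cover by (simp add: topspace_final)
  show "\<forall>(U, \<phi>)\<in>chart_atlas L 1. openin final_topology U \<and> openin (Vt 1) (\<phi> ` U) \<and>
      homeomorphic_map (subtopology final_topology U) (subtopology (Vt 1) (\<phi> ` U)) \<phi>"
    using chart_homeomorphic chart_bij(2) openin_topspace[of "Vt 1"]
    by (auto simp: chart_atlas_iff Vt1_sub)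
  show "\<forall>(U, \<phi>)\<in>chart_atlas L 1. \<forall>(W, \<psi>)\<in>chart_atlas L 1.
      smooth_on sm (Vt 1) sm (Vt 1) (\<phi> ` (U \<inter> W)) (\<lambda>x. \<psi> (inv_into U \<phi> x))"
  proof (clarsimp simp: chart_atlas_iff)
    fix g h assume g: "g \<in> G" and h: "h \<in> G"
    let ?k = "ginv h \<circ> g"
    have k: "?k \<in> G" by (rule G_comp[OF G_inv[OF h] g])
    have "cmap g ` (cdom g \<inter> cdom h) = cmap g ` {p \<in> cdom g \<inter> UNIV. p \<in> cdom h}" by auto
    also have "\<dots> = {x \<in> gr 1. big_cell (?k \<circ> ex x)}"
      using chart_image_eq[OF chart_bij(1)[OF g], of UNIV "\<lambda>p. p"] chart_bij(2,3)[OF g] chart_change(1)[OF g h] by auto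
    finally have im: "cmap g ` (cdom g \<inter> cdom h) = {x \<in> gr 1. big_cell (?k \<circ> ex x)}" .
    show "smooth_on sm (Vt 1) sm (Vt 1) (cmap g ` (cdom g \<inter> cdom h)) (\<lambda>x. cmap h (inv_into (cdom g) (cmap g) x))"
      unfolding im
      by (rule Cinf_on_smooth_on[OF Cinf_on_cong[OF transition(2)[OF k]] transition(1)[OF k]])
        (use chart_bij(3)[OF g] chart_change(2)[OF g h] in auto)
  qed
qed

text \<open>A topology for which the charts are homeomorphisms of open sets is determined by
  the images of $S$ in all charts.\<close>

lemma completion_topology_unique:
  assumes "topspace T = X" "smooth_manifold (completion_with L 1 T)"
  shows "T = final_topology"
proof (unfold topology_eq, intro allI)
  fix S
  have c: "charted (completion_with L 1 T)" by (rule smooth_manifold_charted[OF assms(2)])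
  have ch: "openin T (cdom g)" "\<And>S. S \<subseteq> cdom g \<Longrightarrow> openin (Vt 1) (cmap g ` S) \<longleftrightarrow> openin T S" if "g \<in> G" for g
    using chartedD(1,6)[OF c, of "cdom g" "cmap g"] that by (auto simp: chart_atlas_iff)
  have c': "charted (completion_with L 1 final_topology)" by (rule smooth_manifold_charted[OF completion_smooth_manifold])
  have ch': "openin final_topology (cdom g)" "\<And>S. S \<subseteq> cdom g \<Longrightarrow> openin (Vt 1) (cmap g ` S) \<longleftrightarrow> openin final_topology S" if "g \<in> G" for g
    using chartedD(1,6)[OF c', of "cdom g" "cmap g"] that by (auto simp: chart_atlas_iff)
  have loc: "openin A S \<longleftrightarrow> S \<subseteq> X \<and> (\<forall>g\<in>G. openin (Vt 1) (cmap g ` (S \<inter> cdom g)))"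
    if A: "topspace A = X" "\<And>g. g \<in> G \<Longrightarrow> openin A (cdom g)"
      "\<And>g S. g \<in> G \<Longrightarrow> S \<subseteq> cdom g \<Longrightarrow> openin (Vt 1) (cmap g ` S) \<longleftrightarrow> openin A S" for A
  proof
    assume S: "openin A S"
    then show "S \<subseteq> X \<and> (\<forall>g\<in>G. openin (Vt 1) (cmap g ` (S \<inter> cdom g)))"
      using openin_subset[OF S] A by (auto simp: openin_Int)
  next
    assume S: "S \<subseteq> X \<and> (\<forall>g\<in>G. openin (Vt 1) (cmap g ` (S \<inter> cdom g)))"
    then have "S = (\<Union>g\<in>G. S \<inter> cdom g)" using chart_cover by blast
    moreover have "openin A (\<Union>g\<in>G. S \<inter> cdom g)" using S A(3)[of _ "S \<inter> cdom _"] by (intro openin_Union) auto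
    ultimately show "openin A S" by simp
  qed
  show "openin T S = openin final_topology S"
    using loc[OF assms(1) ch] loc[OF topspace_final ch'] by simp
qed

lemma completion_unique: "\<exists>!T. topspace T = X \<and> smooth_manifold (completion_with L 1 T)"
  using topspace_final completion_smooth_manifold completion_topology_unique by blast

lemma completion_manifold_eq: "completion_manifold L 1 = completion_with L 1 final_topology"
proof -
  have "(THE T. topspace T = X \<and> smooth_manifold (completion_with L 1 T)) = final_topology"
    by (rule the1_equality[OF completion_unique]) (simp add: topspace_final completion_smooth_manifold)
  then show ?thesis by (simp add: completion_manifold_def)
qed

abbreviation "Xplus \<equiv> completion_manifold L 1"

lemma Xplus_simps [simp]: "scal Xplus = sm" "model Xplus = Vt 1" "topspace (mtop Xplus) = X" "atlas Xplus = chart_atlas L 1"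
  by (simp_all add: completion_manifold_eq topspace_final)

lemma Xplus_charted: "charted Xplus"
  unfolding completion_manifold_eq by (rule smooth_manifold_charted[OF completion_smooth_manifold])

text \<open>If a map is given in a chart by $x \mapsto \kappa_x.o^+$, then its representative in the chart of
  $h$ is the coordinate of $h^{-1} \kappa_x$.\<close>

lemma smooth_into_completion:
  assumes M: "charted M" and D: "D \<subseteq> topspace (mtop M)"
    and local: "\<And>U \<phi> h. (U, \<phi>) \<in> atlas M \<Longrightarrow> h \<in> G \<Longrightarrow> \<exists>\<kappa>.
      (\<forall>x \<in> \<phi> ` (U \<inter> D). \<kappa> x \<in> G \<and> f (inv_into U \<phi> x) = act (\<kappa> x) base_plus) \<and>
      openin (model M) {x \<in> \<phi> ` (U \<inter> D). big_cell (ginv h \<circ> \<kappa> x)} \<and>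
      Cinf_on (scal M) (model M) sm (Vt 1) {x \<in> \<phi> ` (U \<inter> D). big_cell (ginv h \<circ> \<kappa> x)} (\<lambda>x. cell_point (ginv h \<circ> \<kappa> x))"
  shows "smooth_map_on M Xplus D f"
proof (rule smooth_map_onI[OF M Xplus_charted D])
  show "f ` D \<subseteq> topspace (mtop Xplus)"
  proof
    fix q assume "q \<in> f ` D"
    then obtain p where p: "p \<in> D" "q = f p" by blast
    then obtain U \<phi> where U: "(U, \<phi>) \<in> atlas M" "p \<in> U" using charted_cover[OF M] D by blast
    obtain \<kappa> where \<kappa>: "\<forall>x \<in> \<phi> ` (U \<inter> D). \<kappa> x \<in> G \<and> f (inv_into U \<phi> x) = act (\<kappa> x) base_plus"
      using local[OF U(1) G_id] by blast
    have "inv_into U \<phi> (\<phi> p) = p" by (rule inv_into_f_f[OF chartedD(3)[OF M U(1)] U(2)])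
    moreover have "\<phi> p \<in> \<phi> ` (U \<inter> D)" using U(2) p(1) by blast
    with \<kappa> have "\<kappa> (\<phi> p) \<in> G" "f (inv_into U \<phi> (\<phi> p)) = act (\<kappa> (\<phi> p)) base_plus" by blast+
    ultimately have "\<kappa> (\<phi> p) \<in> G" "q = act (\<kappa> (\<phi> p)) base_plus" using p(2) by simp_all
    then show "q \<in> topspace (mtop Xplus)" by (auto simp: proj_completion_def)
  qed
next
  fix U \<phi> W \<psi> assume U: "(U, \<phi>) \<in> atlas M" and W: "(W, \<psi>) \<in> atlas Xplus"
  then obtain h where h: "h \<in> G" "W = cdom h" "\<psi> = cmap h" by (auto simp: chart_atlas_iff)
  obtain \<kappa> where \<kappa>: "\<And>x. x \<in> \<phi> ` (U \<inter> D) \<Longrightarrow> \<kappa> x \<in> G \<and> f (inv_into U \<phi> x) = act (\<kappa> x) base_plus"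
    and o: "openin (model M) {x \<in> \<phi> ` (U \<inter> D). big_cell (ginv h \<circ> \<kappa> x)}"
    and C: "Cinf_on (scal M) (model M) sm (Vt 1) {x \<in> \<phi> ` (U \<inter> D). big_cell (ginv h \<circ> \<kappa> x)} (\<lambda>x. cell_point (ginv h \<circ> \<kappa> x))"
    using local[OF U h(1)] by blast
  have im: "\<phi> ` {p \<in> U \<inter> D. f p \<in> W} = {x \<in> \<phi> ` (U \<inter> D). big_cell (ginv h \<circ> \<kappa> x)}"
    unfolding chart_image_eq[OF chartedD(3)[OF M U]] h
    using \<kappa> chart_dom_iff[OF h(1) G_Aut] by auto
  show "smooth_on (scal M) (model M) (scal Xplus) (model Xplus)
          (\<phi> ` {p \<in> U \<inter> D. f p \<in> W}) (\<lambda>x. \<psi> (f (inv_into U \<phi> x)))"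
    unfolding im Xplus_simps
    by (rule Cinf_on_smooth_on[OF Cinf_on_cong[OF C] o]) (use \<kappa> chart_map_point[OF h(1) G_Aut] h in auto)
qed

lemma smooth_act:
  assumes g: "g \<in> G" and f: "\<And>p. p \<in> X \<Longrightarrow> f p = act g p"
  shows "smooth_map Xplus Xplus f"
proof (rule smooth_into_completion[OF Xplus_charted subset_refl])
  fix U \<phi> h assume "(U, \<phi>) \<in> atlas Xplus" and h: "h \<in> G"
  then obtain k where k: "k \<in> G" "U = cdom k" "\<phi> = cmap k" by (auto simp: chart_atlas_iff)
  let ?m = "ginv h \<circ> (g \<circ> k)"
  have m: "?m \<in> G" by (intro G_comp G_inv g h k)
  have Ux: "\<phi> ` (U \<inter> topspace (mtop Xplus)) = gr 1"
    using chart_bij(2)[OF k(1)] chart_dom_subset[OF k(1)] by (simp add: k Int_absorb2)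
  show "\<exists>\<kappa>. (\<forall>x \<in> \<phi> ` (U \<inter> topspace (mtop Xplus)). \<kappa> x \<in> G \<and> f (inv_into U \<phi> x) = act (\<kappa> x) base_plus) \<and>
      openin (model Xplus) {x \<in> \<phi> ` (U \<inter> topspace (mtop Xplus)). big_cell (ginv h \<circ> \<kappa> x)} \<and>
      Cinf_on (scal Xplus) (model Xplus) sm (Vt 1) {x \<in> \<phi> ` (U \<inter> topspace (mtop Xplus)). big_cell (ginv h \<circ> \<kappa> x)} (\<lambda>x. cell_point (ginv h \<circ> \<kappa> x))"
    unfolding Ux Xplus_simps(1,2)
  proof (intro exI[of _ "\<lambda>x. g \<circ> k \<circ> ex x"] conjI ballI)
    fix x assume x: "x \<in> gr 1"
    show "g \<circ> k \<circ> ex x \<in> G" using x by (intro G_comp G_ex g k) auto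
    show "f (inv_into U \<phi> x) = act (g \<circ> k \<circ> ex x) base_plus"
      using f[OF act_emb_X[OF k(1) x]] chart_bij(3)[OF k(1) x] by (simp add: k act_emb act_comp)
  qed (use transition[OF m] in \<open>simp_all add: o_assoc\<close>)
qed

lemma diffeomorphism_act:
  assumes g: "g \<in> G"
  shows "diffeomorphism Xplus Xplus (act g)"
proof -
  have A: "g \<in> Aut" by (rule G_Aut[OF g])
  have st: "act h p \<in> X" if h: "h \<in> G" and p: "p \<in> X" for h p
  proof -
    obtain k where "k \<in> G" "p = act k base_plus" using p by (auto simp: proj_completion_def)
    then show ?thesis using G_comp[OF h, of k] by (auto simp: proj_completion_def act_comp[symmetric])
  qed
  have b: "bij_betw (act g) X X"
    by (rule bij_betw_byWitness[where f' = "act (ginv g)"]) (use act_inv[OF A] st g G_inv in auto)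
  have "smooth_map Xplus Xplus (inv_into X (act g))"
  proof (rule smooth_act[OF G_inv[OF g]])
    fix p assume p: "p \<in> X"
    have "inv_into X (act g) (act g (act (ginv g) p)) = act (ginv g) p"
      using b st[OF G_inv[OF g] p] by (intro inv_into_f_f) (auto simp: bij_betw_def)
    then show "inv_into X (act g) p = act (ginv g) p" by (simp add: act_inv[OF A])
  qed
  then show ?thesis using b smooth_act[OF g] by (simp add: diffeomorphism_def)
qed

end

section \<open>The opposite completion and the affine structures\<close>

lemma flip_jordan_triple: "jordan_triple (flip L) = jordan_triple L"
  by (simp add: jordan_triple_def fun_eq_iff)

lemma topological_jordan_pair_flip: "topological_jordan_pair L \<Longrightarrow> topological_jordan_pair (flip L)"
  unfolding topological_jordan_pair_def flip_simps flip_jordan_triple by simp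

lemma condition_C2_flip: "condition_C2 L \<Longrightarrow> condition_C2 (flip L)"
  unfolding condition_C2_def flip_simps flip_const by simp

lemma inv_into_map_prod:
  assumes "inj_on \<phi> U" "inj_on \<psi> W" "x \<in> \<phi> ` U" "y \<in> \<psi> ` W"
  shows "inv_into (U \<times> W) (map_prod \<phi> \<psi>) (x, y) = (inv_into U \<phi> x, inv_into W \<psi> y)"
proof -
  obtain a b where ab: "a \<in> U" "x = \<phi> a" "b \<in> W" "y = \<psi> b" using assms by blast
  have "inv_into (U \<times> W) (map_prod \<phi> \<psi>) (map_prod \<phi> \<psi> (a, b)) = (a, b)"
    by (rule inv_into_f_f[OF map_prod_inj_on[OF assms(1,2)]]) (use ab in simp)
  then show ?thesis using ab inv_into_f_f[OF assms(1) ab(1)] inv_into_f_f[OF assms(2) ab(3)] by simp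
qed

lemma Cinf_on_fst:
  assumes "module s" "module s'" "U \<subseteq> topspace (prod_topology T T')"
  shows "Cinf_on (module_prod.scale s s') (prod_topology T T') s T U fst"
    "Cinf_on (module_prod.scale s s') (prod_topology T T') s' T' U snd"
  by (rule Cinf_on_linear[OF continuous_map_fst assms(3)], simp add: module_prod_scale[OF assms(1,2)])
    (rule Cinf_on_linear[OF continuous_map_snd assms(3)], simp add: module_prod_scale[OF assms(1,2)])

text \<open>A difference quotient is determined by its values at units $t$, and these are dense, so along a line
  it may be computed by any continuous function.\<close>

lemma differential_eqI:
  fixes s :: "'k::{comm_ring_1, topological_space} \<Rightarrow> 'e::ab_group_add \<Rightarrow> 'e"
    and s' :: "'k \<Rightarrow> 'f::ab_group_add \<Rightarrow> 'f"
  assumes dense: "closure {u::'k. u dvd 1} = UNIV"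
    and T': "topological_module s' T'"
    and f: "smooth_on s T s' T' U f" and x: "x \<in> U" and v: "v \<in> topspace T"
    and N: "open N" "0 \<in> N" and N': "\<And>t. t \<in> N \<Longrightarrow> x + s t v \<in> U"
    and q: "continuous_map (subtopology euclidean N) T' q"
    and eq: "\<And>t. t \<in> N \<Longrightarrow> f (x + s t v) - f x = s' t (q t)"
  shows "differential s T s' T' U f x v = q 0"
proof -
  interpret m: module s' using T' by (simp add: topological_module_def)
  let ?U = "Pt ` U :: ('k, 'e) tower set" and ?f = "f \<circ> un_Pt :: ('k, 'e) tower \<Rightarrow> 'f"
  have U: "U \<subseteq> topspace T" using f openin_subset by (auto simp: smooth_on_def)
  have uniq: "F1 (Inc (Pt x) (Pt v) 0) = q 0" if F1: "diff_quotient s T s' T' 0 ?U ?f F1" for F1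
  proof (rule ccontr)
    let ?q1 = "\<lambda>t. F1 (Inc (Pt x) (Pt v) t)"
    assume ne: "?q1 0 \<noteq> q 0"
    have i: "Inc (Pt x) (Pt v) t \<in> dq_domain s T 0 ?U" if "t \<in> N" for t
      using x v N'[OF that] by simp
    have "continuous_map (subtopology euclidean N) (subtopology (tower_top T (Suc 0)) (dq_domain s T 0 ?U))
        (\<lambda>t. Inc (Pt x) (Pt v) t)"
      using i x v U by (auto simp: continuous_map_in_subtopology continuous_map_tower_Suc continuous_map_tower_0
          intro: continuous_map_from_subtopology)
    moreover have "continuous_map (subtopology (tower_top T (Suc 0)) (dq_domain s T 0 ?U)) T' F1"
      using F1 by (simp add: diff_quotient_def)
    ultimately have q1: "continuous_map (subtopology euclidean N) T' ?q1"
      by (auto dest: continuous_map_compose simp: o_def)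
    have tN: "topspace (subtopology euclidean N) = N" by simp
    have "?q1 0 \<in> topspace T'" "q 0 \<in> topspace T'"
      using continuous_map_image_subset_topspace[OF q1] continuous_map_image_subset_topspace[OF q] N(2) by auto
    moreover have "Hausdorff_space T'" using T' by (simp add: topological_module_def)
    ultimately obtain A B where AB: "openin T' A" "openin T' B" "?q1 0 \<in> A" "q 0 \<in> B" "disjnt A B"
      using ne unfolding Hausdorff_space_def by blast
    \<comment> \<open>An open neighbourhood of 0, so it contains a unit; there both functions agree.\<close>
    let ?M = "{t \<in> N. ?q1 t \<in> A} \<inter> {t \<in> N. q t \<in> B}"
    have "openin (subtopology euclidean N) ?M"
      using openin_continuous_map_preimage[OF q1 AB(1)] openin_continuous_map_preimage[OF q AB(2)]
      unfolding tN by (rule openin_Int)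
    then have "open ?M" using N(1) openin_open_subtopology[of euclidean N] by simp
    moreover have "0 \<in> ?M" using N(2) AB by simp
    ultimately have "?M \<inter> {u. u dvd 1} \<noteq> {}"
      using dense open_Int_closure_eq_empty[of ?M "{u. u dvd 1}"] by auto
    then obtain u where u: "u \<in> ?M" "u dvd 1" by blast
    obtain w where w: "w * u = 1" using u(2) by (metis dvdE mult.commute)
    have "s' u (?q1 u) = s' u (q u)"
      using F1[unfolded diff_quotient_def, THEN conjunct2, rule_format, OF i[of u]] eq[of u] u(1) by simp
    then have "s' w (s' u (?q1 u)) = s' w (s' u (q u))" by simp
    then have "?q1 u = q u" by (simp add: w)
    then show False using u(1) AB(5) by (auto simp: disjnt_iff)
  qed
  have "Ck_level s T s' T' (Suc 0) 0 ?U ?f" using f unfolding smooth_on_def by blast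
  then obtain F1 where F1: "diff_quotient s T s' T' 0 ?U ?f F1" by auto
  show ?thesis
    unfolding differential_def
    by (rule the_equality) (use F1 uniq in metis)+
qed

context quasi_inverse_jordan_lie
begin

lemma quasi_inverse_flip: "quasi_inverse_jordan_lie (flip L)"
proof -
  interpret F: jordan_lie "flip L" by (rule jordan_lie_flip)
  show ?thesis
    by unfold_locales (rule topological_jordan_pair_flip[OF jordan], rule condition_C2_flip[OF C2])
qed

abbreviation "Xminus \<equiv> completion_manifold L (-1)"

lemma Xminus_facts:
  "charted Xminus" "scal Xminus = sm" "model Xminus = Vt (-1)" "topspace (mtop Xminus) = proj_completion L (-1)"
  "atlas Xminus = chart_atlas L (-1)"
  "h \<in> G \<Longrightarrow> inj_on (chart_map L (-1) h) (chart_dom L (-1) h)"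
  "h \<in> G \<Longrightarrow> chart_map L (-1) h ` chart_dom L (-1) h = gr (-1)"
  "h \<in> G \<Longrightarrow> y \<in> gr (-1) \<Longrightarrow> inv_into (chart_dom L (-1) h) (chart_map L (-1) h) y = act h (flag_embed L (-1) y)"
  "h \<in> G \<Longrightarrow> chart_dom L (-1) h \<subseteq> proj_completion L (-1)"
  "h \<in> G \<Longrightarrow> diffeomorphism Xminus Xminus (act h)"
  "\<exists>!T. topspace T = proj_completion L (-1) \<and> smooth_manifold (completion_with L (-1) T)"
proof -
  interpret F: quasi_inverse_jordan_lie "flip L" by (rule quasi_inverse_flip)
  have e: "completion_manifold (flip L) 1 = Xminus" by (simp add: completion_manifold_flip)
  show "charted Xminus" "scal Xminus = sm" "model Xminus = Vt (-1)" "topspace (mtop Xminus) = proj_completion L (-1)"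
    "atlas Xminus = chart_atlas L (-1)"
    using F.Xplus_charted F.Xplus_simps unfolding e by (simp_all add: flip_const)
  show "h \<in> G \<Longrightarrow> inj_on (chart_map L (-1) h) (chart_dom L (-1) h)"
    "h \<in> G \<Longrightarrow> chart_map L (-1) h ` chart_dom L (-1) h = gr (-1)"
    "h \<in> G \<Longrightarrow> y \<in> gr (-1) \<Longrightarrow> inv_into (chart_dom L (-1) h) (chart_map L (-1) h) y = act h (flag_embed L (-1) y)"
    "h \<in> G \<Longrightarrow> chart_dom L (-1) h \<subseteq> proj_completion L (-1)"
    using F.chart_bij[of h] F.chart_dom_subset[of h] by (simp_all add: flip_const)
  show "h \<in> G \<Longrightarrow> diffeomorphism Xminus Xminus (act h)"
    using F.diffeomorphism_act[of h] unfolding e by (simp add: flip_const)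
  show "\<exists>!T. topspace T = proj_completion L (-1) \<and> smooth_manifold (completion_with L (-1) T)"
    using F.completion_unique by (simp add: flip_const)
qed

lemma transversal_pair_iff:
  assumes "\<kappa> \<in> Aut" "\<mu> \<in> Aut"
  shows "transversal (act \<kappa> base_plus) (act \<mu> (base_flag L (-1))) \<longleftrightarrow> big_cell (ginv \<mu> \<circ> \<kappa>)"
proof -
  have "transversal (act \<kappa> base_plus) (act \<mu> (base_flag L (-1)))
      \<longleftrightarrow> transversal (act (ginv \<mu>) (act \<kappa> base_plus)) (act (ginv \<mu>) (act \<mu> (base_flag L (-1))))"
    by (simp only: transversal_act[OF Aut_inv[OF assms(2)]])
  also have "\<dots> \<longleftrightarrow> big_cell (ginv \<mu> \<circ> \<kappa>)"
    using transversal_iff_big_cell[OF Aut_comp[OF Aut_inv[OF assms(2)] assms(1)]]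
    by (simp add: act_inv(1)[OF assms(2)] act_comp)
  finally show ?thesis .
qed

text \<open>Such $k$ has a Gauss decomposition with respect to the reversed grading, whose factor from
  $V^-$ is trivial as it is the coordinate of $k.o^- = o^-$. What remains is $h e^{ad(v)}$.\<close>

lemma stabilizer_affine:
  assumes k: "k \<in> Aut" "act k (base_flag L (-1)) = base_flag L (-1)"
  obtains h v where "graded_aut h" "v \<in> gr 1" "\<And>u. u \<in> gr 1 \<Longrightarrow> act k (emb u) = emb (h (u + v))"
proof -
  interpret F: jordan_lie "flip L" by (rule jordan_lie_flip)
  have k': "k \<in> F.Aut" using k(1) by (simp add: flip_const)
  have "act k (base_flag (flip L) 1) = flag_embed (flip L) 1 0"
    using k(2) F.act_id by (simp add: flag_embed_def flip_const ex_0 act_id)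
  from F.cell_point_eq[OF k' _ this] have b: "F.big_cell k" and p: "F.cell_point k = 0"
    using gr_mem(1) by simp_all
  obtain h v where h: "F.graded_aut h" and v: "v \<in> gr 1" and ke: "k = h \<circ> ex v"
    by (rule F.big_cell_obtain[OF b]) (use p in \<open>simp add: flip_const ex_0\<close>)
  have hg: "graded_aut h"
    unfolding graded_aut_def
  proof (intro conjI allI)
    show "h \<in> Aut" using h by (simp add: F.graded_aut_def flip_const)
    show "h ` gr i = gr i" for i using h[unfolded F.graded_aut_def, THEN conjunct2, rule_format, of "- i"] by simp
  qed
  have "act k (emb u) = emb (h (u + v))" if u: "u \<in> gr 1" for u
  proof -
    have "act k (emb u) = act (h \<circ> (ex v \<circ> ex u)) base_plus" by (simp add: ke act_comp flag_embed_def)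
    also have "\<dots> = act (ex (h (u + v)) \<circ> h) base_plus"
      using ex_add[OF signs(1) v u] graded_aut_ex[OF hg] by (simp add: add.commute)
    finally show ?thesis using graded_aut_base[OF hg signs(1)] by (simp add: act_comp flag_embed_def)
  qed
  with hg v that show ?thesis by blast
qed

text \<open>Two choices of the group element differ by an element of the stabilizer of $o^-$, which acts on $V^+$
  by an affine map and hence commutes with forming $u + r(w - u)$.\<close>

lemma mu_eq:
  assumes g: "g \<in> G" and u: "u \<in> gr 1" and w: "w \<in> gr 1"
  shows "mu L r (act g (emb u)) (act g (base_flag L (-1))) (act g (emb w)) = act g (emb (u + r \<cdot> (w - u)))"
  unfolding mu_def
proof (rule the_equality)
  show "\<exists>g'\<in>G. \<exists>u'\<in>gr 1. \<exists>w'\<in>gr 1. act g (base_flag L (-1)) = act g' (base_flag L (-1)) \<and>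
       act g (emb u) = act g' (emb u') \<and> act g (emb w) = act g' (emb w') \<and>
       act g (emb (u + r \<cdot> (w - u))) = act g' (emb (u' + r \<cdot> (w' - u')))"
    using assms by blast
  fix p assume "\<exists>g'\<in>G. \<exists>u'\<in>gr 1. \<exists>w'\<in>gr 1. act g (base_flag L (-1)) = act g' (base_flag L (-1)) \<and>
       act g (emb u) = act g' (emb u') \<and> act g (emb w) = act g' (emb w') \<and>
       p = act g' (emb (u' + r \<cdot> (w' - u')))"
  then obtain g' u' w' where g': "g' \<in> G" and u': "u' \<in> gr 1" and w': "w' \<in> gr 1"
    and e: "act g (base_flag L (-1)) = act g' (base_flag L (-1))" "act g (emb u) = act g' (emb u')"
       "act g (emb w) = act g' (emb w')" "p = act g' (emb (u' + r \<cdot> (w' - u')))" by blast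
  note A = G_Aut[OF g] and A' = G_Aut[OF g']
  let ?k = "ginv g \<circ> g'"
  have k: "?k \<in> Aut" by (rule Aut_comp[OF Aut_inv[OF A] A'])
  have ak: "act g' q = act g (act ?k q)" for q by (simp add: act_comp act_inv(2)[OF A])
  have "act ?k (base_flag L (-1)) = base_flag L (-1)" using e(1) unfolding ak act_inj[OF A] by simp
  from stabilizer_affine[OF k this] obtain h v where h: "graded_aut h" and v: "v \<in> gr 1"
    and aff: "\<And>u. u \<in> gr 1 \<Longrightarrow> act ?k (emb u) = emb (h (u + v))" by blast
  note hl = Aut_lin[OF graded_autD(1)[OF h]]
  have m: "h (z + v) \<in> gr 1" if "z \<in> gr 1" for z by (rule graded_autD(2)[OF h gr_mem(2)[OF that v]])
  have uu: "u = h (u' + v)"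
    by (rule flag_embed_inj[OF u m[OF u']]) (use e(2) aff[OF u'] in \<open>simp add: ak act_inj[OF A]\<close>)
  have ww: "w = h (w' + v)"
    by (rule flag_embed_inj[OF w m[OF w']]) (use e(3) aff[OF w'] in \<open>simp add: ak act_inj[OF A]\<close>)
  have c: "u' + r \<cdot> (w' - u') \<in> gr 1" by (intro gr_mem(2) gr_mem(3) gr_mem(5) u' w')
  have "h (u' + r \<cdot> (w' - u') + v) = u + r \<cdot> (w - u)"
    by (simp add: uu ww hl scale_right_distrib scale_right_diff_distrib algebra_simps)
  then show "p = act g (emb (u + r \<cdot> (w - u)))" using e(4) aff[OF c] by (simp add: ak)
qed

section \<open>Regular sets and differentials\<close>

lemma denom_eq:
  assumes "g \<in> G" "x \<in> gr 1"
  shows "denom L g x = coef L (ginv (g \<circ> ex x)) 1 1" "codenom L g x = coef L (g \<circ> ex x) (-1) (-1)"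
    "inv_into (gr 1) (denom L g x) (nomin L g x) = cell_point (g \<circ> ex x)"
proof -
  have i: "ginv (g \<circ> ex x) = ex (- x) \<circ> ginv g"
    using ginv_comp[OF G_Aut[OF assms(1)] ex_signed_Aut(1)[OF assms(2)]] ex_inv[OF signs(1) assms(2)] by simp
  show 1: "denom L g x = coef L (ginv (g \<circ> ex x)) 1 1" by (simp add: denom_def i)
  show "codenom L g x = coef L (g \<circ> ex x) (-1) (-1)" by (simp add: codenom_def)
  show "inv_into (gr 1) (denom L g x) (nomin L g x) = cell_point (g \<circ> ex x)"
    unfolding 1 cell_point_def by (simp add: i nomin_def)
qed

lemma regular_set_eq: "g \<in> G \<Longrightarrow> regular_set L g = {x \<in> gr 1. big_cell (g \<circ> ex x)}"
  unfolding regular_set_def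
  by (rule Collect_cong) (auto simp: denom_eq big_cell_iff_GL[OF act_emb_Aut])

lemma cell_translate:
  assumes "p \<in> gr 1" "graded_aut h" "big_cell \<kappa>"
  shows "big_cell (ex p \<circ> h \<circ> \<kappa>)" "cell_point (ex p \<circ> h \<circ> \<kappa>) = p + h (cell_point \<kappa>)"
proof -
  obtain k v where q: "cell_point \<kappa> \<in> gr 1" and k: "graded_aut k" and v: "v \<in> gr (-1)"
    and \<kappa>: "\<kappa> = ex (cell_point \<kappa>) \<circ> k \<circ> ex v"
    by (rule big_cell_obtain[OF assms(3)])
  have "ex p \<circ> h \<circ> \<kappa> = ex p \<circ> h \<circ> (ex (cell_point \<kappa>) \<circ> k \<circ> ex v) \<circ> id \<circ> ex 0"
    using \<kappa> by (simp add: ex_0)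
  also have "\<dots> = ex (p + h (cell_point \<kappa>)) \<circ> (h \<circ> k \<circ> id) \<circ> ex (ginv id v + 0)"
    by (rule big_cell_merge[OF assms(1,2) q k v graded_aut_id gr_mem(1)])
  finally have eq: "ex p \<circ> h \<circ> \<kappa> = ex (p + h (cell_point \<kappa>)) \<circ> (h \<circ> k) \<circ> ex v" by (simp add: inv_id)
  have m: "p + h (cell_point \<kappa>) \<in> gr 1" "graded_aut (h \<circ> k)"
    using gr_mem(2)[OF assms(1) graded_autD(2)[OF assms(2) q]] graded_aut_comp[OF assms(2) k] by blast+
  show "big_cell (ex p \<circ> h \<circ> \<kappa>)" unfolding big_cell_def using m v eq by blast
  show "cell_point (ex p \<circ> h \<circ> \<kappa>) = p + h (cell_point \<kappa>)" by (rule cell_data(6)[OF m v eq])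
qed

text \<open>The nominator of $e^{ad(w)} e^{ad(tv)}$ is $tv - \frac{1}{2} t^2 [v,[v,w]]$, which is divisible by $t$.\<close>

lemma cell_point_line:
  assumes w: "w \<in> gr (-1)" and v: "v \<in> gr 1" and b: "big_cell (ex w \<circ> ex (t \<cdot> v))"
  shows "cell_point (ex w \<circ> ex (t \<cdot> v)) =
    t \<cdot> inv_into (gr 1) (bergman L (t \<cdot> v) w) (v + t \<cdot> (half \<cdot> - \<lbrakk>v, \<lbrakk>v, w\<rbrakk>\<rbrakk>))"
proof -
  let ?\<kappa> = "ex w \<circ> ex (t \<cdot> v)" and ?n = "v + t \<cdot> (half \<cdot> - \<lbrakk>v, \<lbrakk>v, w\<rbrakk>\<rbrakk>)"
  have tv: "t \<cdot> v \<in> gr 1" by (rule gr_mem(3)[OF v])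
  have mtv: "- (t \<cdot> v) \<in> gr 1" and mw: "- w \<in> gr (-1)" using tv w gr_mem(4) by blast+
  obtain k z where d: "cell_point ?\<kappa> \<in> gr 1" "graded_aut k" "z \<in> gr (-1)" "?\<kappa> = ex (cell_point ?\<kappa>) \<circ> k \<circ> ex z"
    by (rule big_cell_obtain[OF b])
  have gi: "ginv ?\<kappa> = ex (- (t \<cdot> v)) \<circ> ex (- w)"
    using ginv_comp[OF ex_signed_Aut(2)[OF w] ex_signed_Aut(1)[OF tv]] ex_inv[OF signs(1) tv] ex_inv[OF signs(2) w] by simp
  have vE: "\<lbrakk>v, EE\<rbrakk> = - v" using br_anti[of v EE] euler_br[OF v] by simp
  have n: "?n \<in> gr 1"
    by (intro gr_mem v br_gr'[OF v br_gr[OF v w]]) simp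
  have "pr L 1 (ginv ?\<kappa> EE) = t \<cdot> ?n"
    using w euler_gr
    by (simp add: gi ex_euler[OF signs(2) mw] pr_ex(1)[OF signs(1) mtv] pr_lin pr_of_gr br_lin vE
        scale_right_distrib scale_right_diff_distrib mult_ac)
  then have "cell_point ?\<kappa> = k (t \<cdot> ?n)"
    unfolding cell_point_def using cell_data(3)[OF d gr_mem(3)[OF n, of t]] by simp
  also have "\<dots> = t \<cdot> k ?n" by (rule Aut_lin(2)[OF graded_autD(1)[OF d(2)]])
  also have "k ?n = inv_into (gr 1) (coef L (ginv ?\<kappa>) 1 1) ?n" using cell_data(3)[OF d n] by simp
  also have "\<dots> = inv_into (gr 1) (bergman L (t \<cdot> v) w) ?n"
    by (rule inv_into_cong_on, rule bergman_coef(1)[OF tv w])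
  finally show ?thesis .
qed

lemma smooth_cell_point:
  assumes "g \<in> G"
  shows "smooth_on sm (Vt 1) sm (Vt 1) (regular_set L g) (\<lambda>x. inv_into (gr 1) (denom L g x) (nomin L g x))"
  unfolding regular_set_eq[OF assms]
  by (rule Cinf_on_smooth_on[OF Cinf_on_cong[OF transition(2)[OF assms]] transition(1)[OF assms]])
    (auto simp: denom_eq(3)[OF assms])

text \<open>With $g e^{ad(x)} = e^y h e^w$ the increment $g(x + tv) - g(x)$ is $h$ applied to the
  coordinate of $e^w e^{tv}$, hence $t$ times a function of $t$ which is continuous near 0 by (C2) and equals $h v$ at
  $t = 0$. Finally $h$ is the inverse denominator.\<close>

theorem differential_regular:
  assumes dense: "closure {u::'k. u dvd 1} = UNIV"
    and g: "g \<in> G" and x: "x \<in> regular_set L g" and v: "v \<in> gr 1"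
  shows "differential sm (Vt 1) sm (Vt 1) (regular_set L g)
            (\<lambda>x. inv_into (gr 1) (denom L g x) (nomin L g x)) x v = inv_into (gr 1) (denom L g x) v"
proof -
  have xg: "x \<in> gr 1" and b: "big_cell (g \<circ> ex x)" using x by (auto simp: regular_set_eq[OF g])
  obtain h w where p: "cell_point (g \<circ> ex x) \<in> gr 1" and h: "graded_aut h" and w: "w \<in> gr (-1)"
    and ge: "g \<circ> ex x = ex (cell_point (g \<circ> ex x)) \<circ> h \<circ> ex w"
    by (rule big_cell_obtain[OF b])
  define y where "y = cell_point (g \<circ> ex x)"
  note p' = p[folded y_def] and ge' = ge[folded y_def]
  have my: "- y \<in> gr 1" and mw: "- w \<in> gr (-1)" using p' w gr_mem(4) by blast+
  have "h = ex (- y) \<circ> (g \<circ> ex x) \<circ> ex (- w)"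
    using ex_minus[OF signs(1) p'] ex_minus[OF signs(2) w] fun_cong[OF ge'] by (simp add: fun_eq_iff)
  then have hG: "h \<in> G" using g my mw xg by (auto intro!: G_comp G_ex)
  \<comment> \<open>The parameters for which the core of the decomposition stays in the big cell: a neighbourhood of 0.\<close>
  let ?N = "{t. big_cell (ex w \<circ> ex (t \<cdot> v))}"
  let ?n = "\<lambda>t. v + t \<cdot> (half \<cdot> - \<lbrakk>v, \<lbrakk>v, w\<rbrakk>\<rbrakk>)"
  let ?q = "\<lambda>t. h (inv_into (gr 1) (bergman L (t \<cdot> v) w) (?n t))"
  let ?E = "euclidean :: 'k topology"
  have line: "cont_into ?E t 1 (\<lambda>t. t \<cdot> a)" if "a \<in> gr 1" for t a
    using continuous_map_scale_module[OF Vt_continuous_module[OF signs(1)], of ?E "\<lambda>t. t" "\<lambda>_. a"] that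
    by (simp add: continuous_map_iff_cont_at)
  have c: "half \<cdot> - \<lbrakk>v, \<lbrakk>v, w\<rbrakk>\<rbrakk> \<in> gr 1"
    by (intro gr_mem br_gr'[OF v br_gr[OF v w]]) simp
  have B: "bergman_continuous_at ?E t (\<lambda>t. t \<cdot> v) (\<lambda>_. w)" if "t \<in> ?N" for t
    by (rule bergman_continuous_C2[OF C2 line[OF v] w]) (use that in simp)
  have N: "open ?N"
  proof (subst open_openin, subst openin_subopen, intro ballI)
    fix t assume "t \<in> ?N"
    from B[OF this] obtain S where "openin ?E S" "t \<in> S" "\<forall>i\<in>S. big_cell (ex w \<circ> ex (i \<cdot> v))"
      by (auto simp: bergman_continuous_at_def eventually_nhdsin)
    then show "\<exists>T. openin ?E T \<and> t \<in> T \<and> T \<subseteq> ?N" by blast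
  qed
  have q: "continuous_map (subtopology ?E ?N) (Vt 1) ?q"
    unfolding continuous_map_iff_cont_at
  proof
    fix t assume "t \<in> topspace (subtopology ?E ?N)"
    then have t: "t \<in> ?N" by simp
    have n: "cont_into ?E t 1 ?n"
      by (rule cont_into_plus[OF cont_into_const[OF _ signs(1) v] line[OF c] signs(1)]) simp
    have k: "cont_into ?E t 1 (\<lambda>t. inv_into (gr 1) (bergman L (t \<cdot> v) w) (?n t))"
      using B[OF t] n unfolding bergman_continuous_at_def by blast
    have "cont_into ?E t 1 ?q"
      by (rule cont_at_cong[OF eventually_mono[OF cont_into_mem(3)[OF k signs(1)]] group_element_continuous[OF hG signs(1) k]])
        (simp add: graded_aut_pr[OF h] pr_of_gr)
    then have "limitin (Vt 1) ?q (?q t) (nhdsin ?E t)" by (simp add: cont_at_def)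
    moreover have "nhdsin (subtopology ?E ?N) t \<le> nhdsin ?E t"
    proof (rule filter_leI)
      fix P assume "eventually P (nhdsin ?E t)"
      then obtain S where "openin ?E S" "t \<in> S" "\<forall>i\<in>S. P i" by (auto simp: eventually_nhdsin)
      then show "eventually P (nhdsin (subtopology ?E ?N) t)"
        using t unfolding eventually_nhdsin by (intro disjI2 exI[of _ "S \<inter> ?N"]) (auto simp: openin_subtopology)
    qed
    ultimately show "cont_into (subtopology ?E ?N) t 1 ?q"
      using t by (auto simp: cont_at_def limitin_def le_filter_def)
  qed
  have main: "x + t \<cdot> v \<in> regular_set L g \<and>
      cell_point (g \<circ> ex (x + t \<cdot> v)) = y + t \<cdot> ?q t" if t: "t \<in> ?N" for t
  proof -
    have tv: "t \<cdot> v \<in> gr 1" by (rule gr_mem(3)[OF v])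
    have "g \<circ> ex (x + t \<cdot> v) = g \<circ> ex x \<circ> ex (t \<cdot> v)"
      by (simp only: o_assoc flip: ex_add[OF signs(1) xg tv])
    also have "\<dots> = ex y \<circ> h \<circ> (ex w \<circ> ex (t \<cdot> v))" unfolding ge' by (simp only: o_assoc)
    finally have e: "g \<circ> ex (x + t \<cdot> v) = ex y \<circ> h \<circ> (ex w \<circ> ex (t \<cdot> v))" .
    have bt: "big_cell (ex w \<circ> ex (t \<cdot> v))" using t by simp
    show ?thesis
      unfolding regular_set_eq[OF g] e
      using cell_translate[OF p' h bt] cell_point_line[OF w v bt] gr_mem(2)[OF xg tv]
      by (simp add: Aut_lin(2)[OF graded_autD(1)[OF h]] e)
  qed
  have z: "0 \<in> ?N" using big_cell_ex[of w] w by (simp add: ex_0)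
  have "differential sm (Vt 1) sm (Vt 1) (regular_set L g)
            (\<lambda>x. inv_into (gr 1) (denom L g x) (nomin L g x)) x v = ?q 0"
  proof (rule differential_eqI[OF dense Vt_topological_module[OF signs(1)] smooth_cell_point[OF g] x _ N z _ q])
    show "v \<in> topspace (Vt 1)" using v by simp
    show "x + t \<cdot> v \<in> regular_set L g" if "t \<in> ?N" for t using main[OF that] by blast
    show "inv_into (gr 1) (denom L g (x + t \<cdot> v)) (nomin L g (x + t \<cdot> v)) - inv_into (gr 1) (denom L g x) (nomin L g x)
        = t \<cdot> ?q t" if "t \<in> ?N" for t
      using main[OF that] denom_eq(3)[OF g, of "x + t \<cdot> v"] denom_eq(3)[OF g xg]
      by (simp add: regular_set_eq[OF g] y_def)
  qed
  also have "?q 0 = h v"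
  proof -
    have "inv_into (gr 1) (bergman L 0 w) v = inv_into (gr 1) (coef L (ginv (ex w \<circ> ex 0)) 1 1) v"
      by (rule inv_into_cong_on) (rule bergman_coef(1)[OF gr_mem(1) w, symmetric])
    also have "\<dots> = id v"
      by (rule cell_data(3)[OF gr_mem(1) graded_aut_id w _ v]) (simp add: ex_0)
    finally show ?thesis by simp
  qed
  also have "h v = inv_into (gr 1) (denom L g x) v"
    using cell_data(3)[OF p' h w ge' v] by (simp add: denom_eq(1)[OF g xg])
  finally show ?thesis .
qed

section \<open>Smooth actions and multiplications\<close>

lemma word_family_local:
  fixes s :: "'k \<Rightarrow> 'e::ab_group_add \<Rightarrow> 'e"
  assumes C1: "condition_C1 L" and T: "continuous_module s T" and \<Omega>: "openin T \<Omega>"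
    and as: "\<And>a. a \<in> set as \<Longrightarrow> letter_family (\<lambda>\<sigma>. Cinf_on s T sm (Vt \<sigma>) \<Omega>) a" and g: "g \<in> G"
  shows "openin T {x \<in> \<Omega>. big_cell (g \<circ> word_at as x)}"
    "Cinf_on s T sm (Vt 1) {x \<in> \<Omega>. big_cell (g \<circ> word_at as x)} (\<lambda>x. cell_point (g \<circ> word_at as x))"
proof -
  obtain cs where cs: "set cs \<subseteq> letters" "g = word cs" by (rule G_obtain_word[OF g])
  let ?as = "map (\<lambda>a _. a) cs @ as"
  have at: "word_at ?as x = g \<circ> word_at as x" for x unfolding word_const_at by (simp add: cs(2))
  have sub: "\<Omega> \<subseteq> topspace T" by (rule openin_subset[OF \<Omega>])
  have l: "letter_family (\<lambda>\<sigma>. Cinf_on s T sm (Vt \<sigma>) \<Omega>) a" if a: "a \<in> set ?as" for a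
  proof -
    from a consider c where "c \<in> letters" "a = (\<lambda>_. c)" | "a \<in> set as" using cs(1) by auto
    then show ?thesis
    proof cases
      case 1 show ?thesis unfolding 1(2) by (rule letter_const_Cinf_on[OF 1(1) sub])
    qed (rule as)
  qed
  have "letter_family (\<lambda>\<sigma>. continuous_map (subtopology T \<Omega>) (Vt \<sigma>)) a" if "a \<in> set ?as" for a
    using l[OF that] Cinf_on_continuous unfolding letter_family_def by blast
  from regular_family_C1[OF C1 \<Omega> this]
  have r: "regular_family T \<Omega> (word_at ?as)" .
  show "openin T {x \<in> \<Omega>. big_cell (g \<circ> word_at as x)}"
    using r unfolding regular_family_def at by blast
  show "Cinf_on s T sm (Vt 1) {x \<in> \<Omega>. big_cell (g \<circ> word_at as x)} (\<lambda>x. cell_point (g \<circ> word_at as x))"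
    using cell_point_smooth[OF T sub l r] unfolding at .
qed

lemma prod_manifold_simps: "scal (prod_manifold M N) = module_prod.scale (scal M) (scal N)"
  "model (prod_manifold M N) = prod_topology (model M) (model N)"
  "mtop (prod_manifold M N) = prod_topology (mtop M) (mtop N)"
  by (simp_all add: prod_manifold_def)

lemma prod_atlasE:
  assumes "(V, \<phi>) \<in> atlas (prod_manifold M N)"
  obtains U \<psi> W \<theta> where "(U, \<psi>) \<in> atlas M" "(W, \<theta>) \<in> atlas N" "V = U \<times> W" "\<phi> = map_prod \<psi> \<theta>"
  using assms unfolding prod_manifold_def by auto

lemma smooth_exp_action:
  assumes C1: "condition_C1 L" and \<tau>: "\<tau> \<in> {1, -1}"
  shows "smooth_map (prod_manifold (module_manifold sm (Vt \<tau>)) Xplus) Xplus (\<lambda>(v, p). act (ex v) p)"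
proof (rule smooth_into_completion[OF charted_prod[OF charted_module Xplus_charted] subset_refl])
  let ?M = "prod_manifold (module_manifold sm (Vt \<tau>)) Xplus"
  let ?s = "module_prod.scale sm sm" and ?T = "prod_topology (Vt \<tau>) (Vt 1)"
  fix U \<phi> h assume c: "(U, \<phi>) \<in> atlas ?M" and h: "h \<in> G"
  obtain U1 \<phi>1 U2 \<phi>2 where c': "(U1, \<phi>1) \<in> atlas (module_manifold sm (Vt \<tau>))" "(U2, \<phi>2) \<in> atlas Xplus"
     "U = U1 \<times> U2" "\<phi> = map_prod \<phi>1 \<phi>2" by (rule prod_atlasE[OF c])
  then obtain g where g: "g \<in> G" and U: "U = gr \<tau> \<times> cdom g" and \<phi>: "\<phi> = map_prod id (cmap g)"
    using \<tau> by (auto simp: module_manifold_def chart_atlas_iff Vt_space)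
  have scal: "scal ?M = ?s" and model: "model ?M = ?T"
    by (simp_all add: prod_manifold_simps) (simp_all add: module_manifold_def)
  have "U \<inter> topspace (mtop ?M) = U"
    using chart_dom_subset[OF g] \<tau> unfolding U by (auto simp: prod_manifold_simps module_manifold_def Vt_space)
  moreover have "\<phi> ` U = gr \<tau> \<times> gr 1"
    unfolding \<phi> U by (rule map_prod_surj_on) (use chart_bij(2)[OF g] in auto)
  ultimately have im: "\<phi> ` (U \<inter> topspace (mtop ?M)) = gr \<tau> \<times> gr 1" by simp
  have ii: "inv_into U \<phi> (v, x) = (v, act g (emb x))" if "v \<in> gr \<tau>" "x \<in> gr 1" for v x
  proof -
    have "inv_into U \<phi> (v, x) = (inv_into (gr \<tau>) id v, inv_into (cdom g) (cmap g) x)"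
      unfolding U \<phi> by (rule inv_into_map_prod) (use chart_bij(1,2)[OF g] that in auto)
    then show ?thesis using that inv_into_f_f[of id "gr \<tau>" v] chart_bij(3)[OF g that(2)] by simp
  qed
  obtain cs where cs: "set cs \<subseteq> letters" "g = word cs" by (rule G_obtain_word[OF g])
  let ?as = "fst # (map (\<lambda>a _. a) cs @ [snd])"
  have at: "word_at ?as q = ex (fst q) \<circ> (g \<circ> ex (snd q))" for q
    by (simp only: word_at_simps word_const_at cs(2) comp_id)
  have T: "continuous_module ?s ?T" by (rule continuous_module_prod[OF Vt_continuous_module[OF \<tau>] Vt_continuous_module[OF signs(1)]])
  have sp: "topspace ?T = gr \<tau> \<times> gr 1" using \<tau> by (simp add: Vt_space)
  have o: "openin ?T (gr \<tau> \<times> gr 1)" using openin_topspace[of ?T] unfolding sp .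
  note F = Cinf_on_fst[OF module_axioms module_axioms, of "gr \<tau> \<times> gr 1" "Vt \<tau>" "Vt 1", unfolded sp, OF subset_refl]
  have l: "letter_family (\<lambda>\<sigma>. Cinf_on ?s ?T sm (Vt \<sigma>) (gr \<tau> \<times> gr 1)) a" if a: "a \<in> set ?as" for a
  proof -
    from a consider c where "c \<in> letters" "a = (\<lambda>_. c)" | "a = fst" | "a = snd" using cs(1) by auto
    then show ?thesis
    proof cases
      case 1 show ?thesis unfolding 1(2) by (rule letter_const_Cinf_on[OF 1(1)]) (simp only: sp subset_refl)
    next
      case 2 show ?thesis unfolding 2 letter_family_def using F(1) \<tau> by auto
    next
      case 3 show ?thesis unfolding 3 letter_family_def using F(2) by blast
    qed
  qed
  note W = word_family_local[where as = ?as, OF C1 T o l G_inv[OF h]]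
  show "\<exists>\<kappa>. (\<forall>x \<in> \<phi> ` (U \<inter> topspace (mtop ?M)). \<kappa> x \<in> G \<and> (\<lambda>(v, p). act (ex v) p) (inv_into U \<phi> x) = act (\<kappa> x) base_plus) \<and>
      openin (model ?M) {x \<in> \<phi> ` (U \<inter> topspace (mtop ?M)). big_cell (ginv h \<circ> \<kappa> x)} \<and>
      Cinf_on (scal ?M) (model ?M) sm (Vt 1) {x \<in> \<phi> ` (U \<inter> topspace (mtop ?M)). big_cell (ginv h \<circ> \<kappa> x)} (\<lambda>x. cell_point (ginv h \<circ> \<kappa> x))"
    unfolding im scal model
  proof (intro exI[of _ "word_at ?as"] conjI ballI)
    fix q assume q: "q \<in> gr \<tau> \<times> gr 1"
    show "word_at ?as q \<in> G" unfolding at using q \<tau> by (intro G_comp G_ex g) auto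
    show "(\<lambda>(v, p). act (ex v) p) (inv_into U \<phi> q) = act (word_at ?as q) base_plus"
    proof -
      obtain v x where vx: "q = (v, x)" "v \<in> gr \<tau>" "x \<in> gr 1" using q by blast
      show ?thesis unfolding at by (simp add: vx(1) ii[OF vx(2,3)] act_emb act_comp)
    qed
  next
    show "openin ?T {x \<in> gr \<tau> \<times> gr 1. big_cell (ginv h \<circ> word_at ?as x)}" using W(1) .
    show "Cinf_on ?s ?T sm (Vt 1) {x \<in> gr \<tau> \<times> gr 1. big_cell (ginv h \<circ> word_at ?as x)} (\<lambda>x. cell_point (ginv h \<circ> word_at ?as x))"
      using W(2) .
  qed
qed

text \<open>The coordinate of one point in the affine space defined by another one. As a family it is a word, since
  the inverse of $g' e^{ad(\eta)}$ is $e^{-ad(\eta)} g'^{-1}$.\<close>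

lemma pair_coordinate:
  fixes s :: "'k \<Rightarrow> 'e::ab_group_add \<Rightarrow> 'e"
  assumes C1: "condition_C1 L" and T: "continuous_module s T" and \<Omega>: "openin T \<Omega>"
    and \<xi>: "Cinf_on s T sm (Vt 1) \<Omega> \<xi>" and \<eta>: "Cinf_on s T sm (Vt (-1)) \<Omega> \<eta>" and g: "g \<in> G" and g': "g' \<in> G"
  shows "openin T {q \<in> \<Omega>. big_cell (ginv (g' \<circ> ex (\<eta> q)) \<circ> (g \<circ> ex (\<xi> q)))}"
    "Cinf_on s T sm (Vt 1) {q \<in> \<Omega>. big_cell (ginv (g' \<circ> ex (\<eta> q)) \<circ> (g \<circ> ex (\<xi> q)))}
       (\<lambda>q. cell_point (ginv (g' \<circ> ex (\<eta> q)) \<circ> (g \<circ> ex (\<xi> q))))"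
proof -
  have k: "ginv g' \<circ> g \<in> G" by (rule G_comp[OF G_inv[OF g'] g])
  obtain cs where cs: "set cs \<subseteq> letters" "ginv g' \<circ> g = word cs" by (rule G_obtain_word[OF k])
  let ?as = "(\<lambda>q. - \<eta> q) # (map (\<lambda>a _. a) cs @ [\<xi>])"
  have sub: "\<Omega> \<subseteq> topspace T" by (rule openin_subset[OF \<Omega>])
  have at: "word_at ?as q = ginv (g' \<circ> ex (\<eta> q)) \<circ> (g \<circ> ex (\<xi> q))" if q: "q \<in> \<Omega>" for q
  proof -
    have e: "\<eta> q \<in> gr (-1)" using Cinf_on_mem[OF \<eta> q] by simp
    have "ginv (g' \<circ> ex (\<eta> q)) = ex (- \<eta> q) \<circ> ginv g'"
      using ginv_comp[OF G_Aut[OF g'] ex_signed_Aut(2)[OF e]] ex_inv[OF signs(2) e] by simp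
    moreover have "word_at ?as q = ex (- \<eta> q) \<circ> ((ginv g' \<circ> g) \<circ> ex (\<xi> q))"
      by (simp only: word_at_simps word_const_at cs(2) comp_id)
    ultimately show ?thesis by (simp only: o_assoc)
  qed
  have m: "Cinf_on s T sm (Vt (-1)) \<Omega> (\<lambda>q. - \<eta> q)"
    using Cinf_on_scale[OF Vt_continuous_module[OF signs(2)] \<eta>, of "-1"] by simp
  have l: "letter_family (\<lambda>\<sigma>. Cinf_on s T sm (Vt \<sigma>) \<Omega>) a" if a: "a \<in> set ?as" for a
  proof -
    from a consider c where "c \<in> letters" "a = (\<lambda>_. c)" | "a = (\<lambda>q. - \<eta> q)" | "a = \<xi>" using cs(1) by auto
    then show ?thesis
    proof cases
      case 1 show ?thesis unfolding 1(2) by (rule letter_const_Cinf_on[OF 1(1) sub])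
    next
      case 2 show ?thesis unfolding 2 letter_family_def using m by blast
    next
      case 3 show ?thesis unfolding 3 letter_family_def using \<xi> by blast
    qed
  qed
  note W = word_family_local[where as = ?as, OF C1 T \<Omega> l G_id, unfolded id_comp]
  have e: "{q \<in> \<Omega>. big_cell (word_at ?as q)} = {q \<in> \<Omega>. big_cell (ginv (g' \<circ> ex (\<eta> q)) \<circ> (g \<circ> ex (\<xi> q)))}"
    by (rule Collect_cong) (use at in \<open>auto simp del: o_apply\<close>)
  show "openin T {q \<in> \<Omega>. big_cell (ginv (g' \<circ> ex (\<eta> q)) \<circ> (g \<circ> ex (\<xi> q)))}"
    using W(1) unfolding e .
  show "Cinf_on s T sm (Vt 1) {q \<in> \<Omega>. big_cell (ginv (g' \<circ> ex (\<eta> q)) \<circ> (g \<circ> ex (\<xi> q)))}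
       (\<lambda>q. cell_point (ginv (g' \<circ> ex (\<eta> q)) \<circ> (g \<circ> ex (\<xi> q))))"
    using W(2) unfolding e
  proof (rule Cinf_on_cong)
    fix q assume "q \<in> {q \<in> \<Omega>. big_cell (ginv (g' \<circ> ex (\<eta> q)) \<circ> (g \<circ> ex (\<xi> q)))}"
    then have "q \<in> \<Omega>" by blast
    then show "cell_point (word_at ?as q) = cell_point (ginv (g' \<circ> ex (\<eta> q)) \<circ> (g \<circ> ex (\<xi> q)))"
      by (simp only: at)
  qed
qed

lemma act_emb_minus: "act g (flag_embed L (-1) y) = act (g \<circ> ex y) (base_flag L (-1))"
  by (simp add: act_comp flag_embed_def)

lemma transversal_charts:
  assumes "g \<in> G" "g' \<in> G" "x \<in> gr 1" "y \<in> gr (-1)"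
  shows "(act g (emb x), act g' (flag_embed L (-1) y)) \<in> transversal_pairs L \<longleftrightarrow>
      big_cell (ginv (g' \<circ> ex y) \<circ> (g \<circ> ex x))"
    "big_cell (ginv (g' \<circ> ex y) \<circ> (g \<circ> ex x)) \<Longrightarrow>
      act g (emb x) = act (g' \<circ> ex y) (emb (cell_point (ginv (g' \<circ> ex y) \<circ> (g \<circ> ex x))))"
proof -
  have A: "g \<circ> ex x \<in> Aut" and B: "g' \<circ> ex y \<in> Aut" and gy: "g' \<circ> ex y \<in> G"
    using assms by (auto intro!: Aut_comp G_Aut ex_signed_Aut G_comp G_ex)
  have "act g (emb x) \<in> X" "act g' (flag_embed L (-1) y) \<in> proj_completion L (-1)"
    using act_emb_X[OF assms(1,3)] gy by (auto simp: act_emb_minus proj_completion_def)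
  then show "(act g (emb x), act g' (flag_embed L (-1) y)) \<in> transversal_pairs L \<longleftrightarrow>
      big_cell (ginv (g' \<circ> ex y) \<circ> (g \<circ> ex x))"
    using transversal_pair_iff[OF A B] by (simp add: transversal_pairs_def act_emb act_emb_minus)
  show "act g (emb x) = act (g' \<circ> ex y) (emb (cell_point (ginv (g' \<circ> ex y) \<circ> (g \<circ> ex x))))"
    if "big_cell (ginv (g' \<circ> ex y) \<circ> (g \<circ> ex x))"
  proof -
    have "act (g' \<circ> ex y) (emb (cell_point (ginv (g' \<circ> ex y) \<circ> (g \<circ> ex x))))
        = act (g' \<circ> ex y) (act (ginv (g' \<circ> ex y)) (act (g \<circ> ex x) base_plus))"
      unfolding act_big_cell[OF that, symmetric] by (simp only: act_comp)
    also have "\<dots> = act (g \<circ> ex x) base_plus" by (rule act_inv(2)[OF B])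
    finally show ?thesis by (simp only: act_emb)
  qed
qed

lemma minus_atlas_iff: "(U, \<phi>) \<in> chart_atlas L (-1) \<longleftrightarrow> (\<exists>g\<in>G. U = chart_dom L (-1) g \<and> \<phi> = chart_map L (-1) g)"
  by (auto simp: chart_atlas_def)

lemma transversal_pairs_open:
  assumes C1: "condition_C1 L"
  shows "openin (prod_topology (mtop Xplus) (mtop Xminus)) (transversal_pairs L)"
proof -
  let ?M = "prod_manifold Xplus Xminus" and ?P = "transversal_pairs L"
  let ?s = "module_prod.scale sm sm" and ?T = "prod_topology (Vt 1) (Vt (-1))"
  have "openin (mtop ?M) ?P"
  proof (rule charted_openI[OF charted_prod[OF Xplus_charted Xminus_facts(1)]])
    show "?P \<subseteq> topspace (mtop ?M)"
      by (auto simp: transversal_pairs_def prod_manifold_simps Xminus_facts(4))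
    fix U \<phi> assume c: "(U, \<phi>) \<in> atlas ?M"
    obtain U1 \<phi>1 U2 \<phi>2 where c': "(U1, \<phi>1) \<in> atlas Xplus" "(U2, \<phi>2) \<in> atlas Xminus"
       "U = U1 \<times> U2" "\<phi> = map_prod \<phi>1 \<phi>2" by (rule prod_atlasE[OF c])
    then obtain g g' where g: "g \<in> G" "g' \<in> G" and U: "U = cdom g \<times> chart_dom L (-1) g'"
      and \<phi>: "\<phi> = map_prod (cmap g) (chart_map L (-1) g')"
      by (auto simp: chart_atlas_iff Xminus_facts(5) minus_atlas_iff)
    have T: "continuous_module ?s ?T" by (rule continuous_module_prod[OF Vt_continuous_module[OF signs(1)] Vt_continuous_module[OF signs(2)]])
    let ?E = "gr 1 \<times> gr (-1)"
    have sp: "topspace ?T = ?E" by simp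
    have o: "openin ?T ?E" using openin_topspace[of ?T] unfolding sp .
    note F = Cinf_on_fst[OF module_axioms module_axioms, of ?E "Vt 1" "Vt (-1)", unfolded sp, OF subset_refl]
    have inj: "inj_on \<phi> U" unfolding \<phi> U by (rule map_prod_inj_on[OF chart_bij(1)[OF g(1)] Xminus_facts(6)[OF g(2)]])
    have im: "\<phi> ` U = ?E"
      unfolding \<phi> U by (rule map_prod_surj_on[OF chart_bij(2)[OF g(1)] Xminus_facts(7)[OF g(2)]])
    have ii: "inv_into U \<phi> (x, y) = (act g (emb x), act g' (flag_embed L (-1) y))" if "x \<in> gr 1" "y \<in> gr (-1)" for x y
      unfolding U \<phi> using that chart_bij[OF g(1)] Xminus_facts(6-8)[OF g(2)] by (simp add: inv_into_map_prod)
    have "\<phi> ` (U \<inter> ?P) = {q \<in> ?E. inv_into U \<phi> q \<in> ?P}"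
      using chart_image_eq[OF inj, of UNIV "\<lambda>p. p" ?P] im by (simp add: Int_def)
    also have "\<dots> = {q \<in> ?E. big_cell (ginv (g' \<circ> ex (snd q)) \<circ> (g \<circ> ex (fst q)))}"
    proof (rule Collect_cong)
      fix q show "q \<in> ?E \<and> inv_into U \<phi> q \<in> ?P \<longleftrightarrow> q \<in> ?E \<and> big_cell (ginv (g' \<circ> ex (snd q)) \<circ> (g \<circ> ex (fst q)))"
        by (cases q) (use ii transversal_charts(1)[OF g] in auto)
    qed
    finally have e: "\<phi> ` (U \<inter> ?P) = {q \<in> ?E. big_cell (ginv (g' \<circ> ex (snd q)) \<circ> (g \<circ> ex (fst q)))}" .
    show "openin (model ?M) (\<phi> ` (U \<inter> ?P))"
      unfolding e prod_manifold_simps Xplus_simps Xminus_facts(3)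
      by (rule pair_coordinate(1)[OF C1 T o F g])
  qed
  then show ?thesis by (simp add: prod_manifold_simps)
qed

lemma mu_domain_iff: "(x, y, z) \<in> mu_domain L \<longleftrightarrow> (x, y) \<in> transversal_pairs L \<and> (z, y) \<in> transversal_pairs L"
  by (simp add: mu_domain_def)

text \<open>For $y = g_2 e^{ad(\eta)}.o^-$ the points $x$ and $z$ have coordinates $u$ and $w$ in $V_y$ that depend
  smoothly on all data, and $\mu_r(x,y,z) = g_2 e^{ad(\eta)} e^{ad(u + r(w-u))}.o^+$ is again given by a word with
  smooth letters.\<close>

lemma mu_smooth:
  assumes C1: "condition_C1 L"
  shows "smooth_map_on (prod_manifold Xplus (prod_manifold Xminus Xplus)) Xplus (mu_domain L) (\<lambda>(x, y, z). mu L r x y z)"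
proof (rule smooth_into_completion[OF charted_prod[OF Xplus_charted charted_prod[OF Xminus_facts(1) Xplus_charted]]])
  let ?M = "prod_manifold Xplus (prod_manifold Xminus Xplus)" and ?D = "mu_domain L"
  show "?D \<subseteq> topspace (mtop ?M)"
    by (auto simp: mu_domain_def transversal_pairs_def prod_manifold_simps Xminus_facts(4))
  let ?s = "module_prod.scale sm (module_prod.scale sm sm)"
  let ?T = "prod_topology (Vt 1) (prod_topology (Vt (-1)) (Vt 1))"
  fix U \<phi> h assume c: "(U, \<phi>) \<in> atlas ?M" and h: "h \<in> G"
  obtain U1 \<phi>1 U' \<phi>' where c1: "(U1, \<phi>1) \<in> atlas Xplus" "(U', \<phi>') \<in> atlas (prod_manifold Xminus Xplus)"
     "U = U1 \<times> U'" "\<phi> = map_prod \<phi>1 \<phi>'" by (rule prod_atlasE[OF c])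
  obtain U2 \<phi>2 U3 \<phi>3 where c2: "(U2, \<phi>2) \<in> atlas Xminus" "(U3, \<phi>3) \<in> atlas Xplus"
     "U' = U2 \<times> U3" "\<phi>' = map_prod \<phi>2 \<phi>3" by (rule prod_atlasE[OF c1(2)])
  obtain g1 where g1: "g1 \<in> G" "U1 = cdom g1" "\<phi>1 = cmap g1" using c1(1) by (auto simp: chart_atlas_iff)
  obtain g2 where g2: "g2 \<in> G" "U2 = chart_dom L (-1) g2" "\<phi>2 = chart_map L (-1) g2"
    using c2(1) by (auto simp: Xminus_facts(5) minus_atlas_iff)
  obtain g3 where g3: "g3 \<in> G" "U3 = cdom g3" "\<phi>3 = cmap g3" using c2(2) by (auto simp: chart_atlas_iff)
  have U: "U = cdom g1 \<times> (chart_dom L (-1) g2 \<times> cdom g3)"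
    and \<phi>: "\<phi> = map_prod (cmap g1) (map_prod (chart_map L (-1) g2) (cmap g3))"
    by (simp_all add: c1 c2 g1 g2 g3)
  have scal: "scal ?M = ?s" and model: "model ?M = ?T"
    by (simp_all add: prod_manifold_simps Xminus_facts)
  note t1 = Vt_continuous_module[OF signs(1)] and t2 = Vt_continuous_module[OF signs(2)]
  have T': "continuous_module (module_prod.scale sm sm) (prod_topology (Vt (-1)) (Vt 1))" by (rule continuous_module_prod[OF t2 t1])
  have T: "continuous_module ?s ?T" by (rule continuous_module_prod[OF t1 T'])
  let ?E = "gr 1 \<times> (gr (-1) \<times> gr 1)"
  have sp: "topspace ?T = ?E" by simp
  have o: "openin ?T ?E" using openin_topspace[of ?T] unfolding sp .
  note P1 = Cinf_on_fst[OF module_axioms continuous_module_module[OF T'], of ?E "Vt 1" "prod_topology (Vt (-1)) (Vt 1)", unfolded sp, OF subset_refl]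
  have sub': "gr (-1) \<times> gr 1 \<subseteq> topspace (prod_topology (Vt (-1)) (Vt 1))" by simp
  note P2 = Cinf_on_fst[OF module_axioms module_axioms sub']
  have \<xi>: "Cinf_on ?s ?T sm (Vt 1) ?E fst" by (rule P1(1))
  have \<eta>: "Cinf_on ?s ?T sm (Vt (-1)) ?E (\<lambda>q. fst (snd q))" by (rule Cinf_on_compose[OF P1(2) P2(1)]) auto
  have \<zeta>: "Cinf_on ?s ?T sm (Vt 1) ?E (\<lambda>q. snd (snd q))" by (rule Cinf_on_compose[OF P1(2) P2(2)]) auto
  let ?A = "\<lambda>q. ginv (g2 \<circ> ex (fst (snd q))) \<circ> (g1 \<circ> ex (fst q))"
  let ?B = "\<lambda>q. ginv (g2 \<circ> ex (fst (snd q))) \<circ> (g3 \<circ> ex (snd (snd q)))"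
  note A = pair_coordinate[OF C1 T o \<xi> \<eta> g1(1) g2(1)]
  note B = pair_coordinate[OF C1 T o \<zeta> \<eta> g3(1) g2(1)]
  let ?\<Omega> = "{q \<in> ?E. big_cell (?A q)} \<inter> {q \<in> ?E. big_cell (?B q)}"
  have \<Omega>: "openin ?T ?\<Omega>" by (rule openin_Int[OF A(1) B(1)])
  let ?u = "\<lambda>q. cell_point (?A q)" and ?w = "\<lambda>q. cell_point (?B q)"
  have u: "Cinf_on ?s ?T sm (Vt 1) ?\<Omega> ?u" by (rule Cinf_on_subset[OF A(2)]) blast
  have w: "Cinf_on ?s ?T sm (Vt 1) ?\<Omega> ?w" by (rule Cinf_on_subset[OF B(2)]) blast
  have \<eta>': "Cinf_on ?s ?T sm (Vt (-1)) ?\<Omega> (\<lambda>q. fst (snd q))" by (rule Cinf_on_subset[OF \<eta>]) blast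
  let ?m = "\<lambda>q. ?u q + r \<cdot> (?w q - ?u q)"
  have m: "Cinf_on ?s ?T sm (Vt 1) ?\<Omega> ?m"
    by (rule Cinf_on_add[OF t1 u Cinf_on_scale[OF t1 Cinf_on_diff[OF t1 w u]]])
  obtain cs where cs: "set cs \<subseteq> letters" "g2 = word cs" by (rule G_obtain_word[OF g2(1)])
  \<comment> \<open>The letters of the fixed element g2, then the coordinate of y, then u + r (w - u).\<close>
  let ?as = "map (\<lambda>a _. a) cs @ [\<lambda>q. fst (snd q), ?m]"
  have at: "word_at ?as q = g2 \<circ> (ex (fst (snd q)) \<circ> ex (?m q))" for q
    by (simp only: word_at_simps word_const_at cs(2) comp_id)
  have l: "letter_family (\<lambda>\<sigma>. Cinf_on ?s ?T sm (Vt \<sigma>) ?\<Omega>) a" if a: "a \<in> set ?as" for a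
  proof -
    from a consider c where "c \<in> letters" "a = (\<lambda>_. c)" | "a = (\<lambda>q. fst (snd q))" | "a = ?m" using cs(1) by auto
    then show ?thesis
    proof cases
      case 1 show ?thesis unfolding 1(2) by (rule letter_const_Cinf_on[OF 1(1)]) (simp only: sp, blast)
    next
      case 2 show ?thesis unfolding 2 letter_family_def using \<eta>' by blast
    next
      case 3 show ?thesis unfolding 3 letter_family_def using m by blast
    qed
  qed
  note W = word_family_local[where as = ?as, OF C1 T \<Omega> l G_inv[OF h]]
  note i1 = chart_bij[OF g1(1)] and i3 = chart_bij[OF g3(1)] and i2 = Xminus_facts(6-8)[OF g2(1)]
  have inj': "inj_on (map_prod (chart_map L (-1) g2) (cmap g3)) (chart_dom L (-1) g2 \<times> cdom g3)"
    by (rule map_prod_inj_on[OF i2(1) i3(1)])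
  have im': "map_prod (chart_map L (-1) g2) (cmap g3) ` (chart_dom L (-1) g2 \<times> cdom g3) = gr (-1) \<times> gr 1"
    by (rule map_prod_surj_on[OF i2(2) i3(2)])
  have inj: "inj_on \<phi> U" unfolding \<phi> U by (rule map_prod_inj_on[OF i1(1) inj'])
  have im: "\<phi> ` U = ?E" unfolding \<phi> U by (rule map_prod_surj_on[OF i1(2) im'])
  have ii: "inv_into U \<phi> (x, y, z) = (act g1 (emb x), act g2 (flag_embed L (-1) y), act g3 (emb z))"
    if "x \<in> gr 1" "y \<in> gr (-1)" "z \<in> gr 1" for x y z
    unfolding U \<phi> using that i1(1-3) i2 i3(1-3) inj' im' by (simp add: inv_into_map_prod)
  have "\<phi> ` (U \<inter> ?D) = {q \<in> ?E. inv_into U \<phi> q \<in> ?D}"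
    using chart_image_eq[OF inj, of UNIV "\<lambda>p. p" ?D] im by (simp add: Int_def)
  also have "\<dots> = ?\<Omega>"
  proof -
    have "q \<in> ?E \<and> inv_into U \<phi> q \<in> ?D \<longleftrightarrow> q \<in> ?E \<and> big_cell (?A q) \<and> big_cell (?B q)" for q
    proof -
      obtain x y z where xyz: "q = (x, y, z)" by (cases q)
      show ?thesis
      proof (cases "x \<in> gr 1 \<and> y \<in> gr (-1) \<and> z \<in> gr 1")
        case True
        then have m: "x \<in> gr 1" "y \<in> gr (-1)" "z \<in> gr 1" by blast+
        have "inv_into U \<phi> q \<in> ?D \<longleftrightarrow> big_cell (?A q) \<and> big_cell (?B q)"
          by (simp only: xyz ii[OF m] mu_domain_iff transversal_charts(1)[OF g1(1) g2(1) m(1,2)]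
              transversal_charts(1)[OF g3(1) g2(1) m(3,2)] fst_conv snd_conv)
        then show ?thesis by blast
      next
        case False then show ?thesis unfolding xyz by blast
      qed
    qed
    then show ?thesis by blast
  qed
  finally have \<Omega>_eq: "\<phi> ` (U \<inter> ?D) = ?\<Omega>" .
  show "\<exists>\<kappa>. (\<forall>x \<in> \<phi> ` (U \<inter> ?D). \<kappa> x \<in> G \<and> (\<lambda>(x, y, z). mu L r x y z) (inv_into U \<phi> x) = act (\<kappa> x) base_plus) \<and>
      openin (model ?M) {x \<in> \<phi> ` (U \<inter> ?D). big_cell (ginv h \<circ> \<kappa> x)} \<and>
      Cinf_on (scal ?M) (model ?M) sm (Vt 1) {x \<in> \<phi> ` (U \<inter> ?D). big_cell (ginv h \<circ> \<kappa> x)} (\<lambda>x. cell_point (ginv h \<circ> \<kappa> x))"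
    unfolding \<Omega>_eq scal model
  proof (intro exI[of _ "word_at ?as"] conjI ballI)
    fix q assume q: "q \<in> ?\<Omega>"
    obtain x y z where xyz: "q = (x, y, z)" by (cases q)
    have x: "x \<in> gr 1" and y: "y \<in> gr (-1)" and z: "z \<in> gr 1" and bA: "big_cell (?A q)" and bB: "big_cell (?B q)"
      using q by (auto simp: xyz)
    have gy: "g2 \<circ> ex y \<in> G" using y by (intro G_comp g2 G_ex) auto
    have mq: "?m q \<in> gr 1" using Cinf_on_mem[OF m q] by simp
    have aw: "act (word_at ?as q) base_plus = act (g2 \<circ> ex y) (emb (?m q))"
      unfolding at by (simp add: xyz act_comp flag_embed_def)
    show "word_at ?as q \<in> G" unfolding at using y mq by (intro G_comp g2 G_ex) (auto simp: xyz)
    have p1: "act g1 (emb x) = act (g2 \<circ> ex y) (emb (?u q))"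
      using transversal_charts(2)[OF g1(1) g2(1) x y] bA by (simp add: xyz)
    have p3: "act g3 (emb z) = act (g2 \<circ> ex y) (emb (?w q))"
      using transversal_charts(2)[OF g3(1) g2(1) z y] bB by (simp add: xyz)
    have "(\<lambda>(x, y, z). mu L r x y z) (inv_into U \<phi> q)
        = mu L r (act (g2 \<circ> ex y) (emb (?u q))) (act (g2 \<circ> ex y) (base_flag L (-1))) (act (g2 \<circ> ex y) (emb (?w q)))"
      using ii[OF x y z] p1 p3 by (simp only: xyz act_emb_minus prod.case)
    also have "\<dots> = act (g2 \<circ> ex y) (emb (?m q))"
      by (rule mu_eq[OF gy big_cell_point_gr[OF bA] big_cell_point_gr[OF bB]])
    finally show "(\<lambda>(x, y, z). mu L r x y z) (inv_into U \<phi> q) = act (word_at ?as q) base_plus"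
      by (simp only: aw)
  next
    show "openin ?T {x \<in> ?\<Omega>. big_cell (ginv h \<circ> word_at ?as x)}" using W(1) .
    show "Cinf_on ?s ?T sm (Vt 1) {x \<in> ?\<Omega>. big_cell (ginv h \<circ> word_at ?as x)} (\<lambda>x. cell_point (ginv h \<circ> word_at ?as x))"
      using W(2) .
  qed
qed

end

theorem theorem5p3:
  fixes L :: "('k::{comm_ring_1, topological_ab_group_add, topological_semigroup_mult},
               'g::ab_group_add) graded_lie"
  assumes units_open: "open {u::'k. u dvd 1}"
    and inversion_continuous: "continuous_on {u::'k. u dvd 1} ring_inv"
    and units_dense: "closure {u::'k. u dvd 1} = UNIV"
    and two_invertible: "(2::'k) dvd 1"
    and graded: "three_graded_lie_algebra L"
    and automorphic: "exp_ad_automorphic L"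
    and jordan: "topological_jordan_pair L"
    and C2: "condition_C2 L"
  shows
    "(\<forall>\<sigma> \<in> {1, -1}. \<exists>!T. topspace T = proj_completion L \<sigma> \<and> smooth_manifold (completion_with L \<sigma> T)) \<and>
     (\<forall>g \<in> elementary_group L. \<forall>\<sigma> \<in> {1, -1}.
       diffeomorphism (completion_manifold L \<sigma>) (completion_manifold L \<sigma>) (act g)) \<and>
     (\<forall>g \<in> elementary_group L.
       (\<exists>x \<in> grade L 1. denom L g x \<in> GL_on (smul L) (grade L 1)) \<longrightarrow>
       regular_set L g = {x \<in> grade L 1. act g (flag_embed L 1 x) \<in> flag_embed L 1 ` grade L 1} \<and>
       openin (gtop L 1) (regular_set L g) \<and>
       (\<forall>x \<in> regular_set L g.
          act g (flag_embed L 1 x) = flag_embed L 1 (inv_into (grade L 1) (denom L g x) (nomin L g x))) \<and>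
       smooth_on (smul L) (gtop L 1) (smul L) (gtop L 1) (regular_set L g)
         (\<lambda>x. inv_into (grade L 1) (denom L g x) (nomin L g x)) \<and>
       (\<forall>x \<in> regular_set L g. \<forall>v \<in> grade L 1.
          differential (smul L) (gtop L 1) (smul L) (gtop L 1) (regular_set L g)
            (\<lambda>x. inv_into (grade L 1) (denom L g x) (nomin L g x)) x v
          = inv_into (grade L 1) (denom L g x) v)) \<and>
     (condition_C1 L \<longrightarrow>
       smooth_map (prod_manifold (module_manifold (smul L) (gtop L 1)) (completion_manifold L 1))
         (completion_manifold L 1) (\<lambda>(v, p). act (exp_ad L v) p) \<and>
       smooth_map (prod_manifold (module_manifold (smul L) (gtop L (-1))) (completion_manifold L 1))
         (completion_manifold L 1) (\<lambda>(w, p). act (exp_ad L w) p)) \<and>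
     (condition_C1 L \<longrightarrow>
       openin (prod_topology (mtop (completion_manifold L 1)) (mtop (completion_manifold L (-1))))
         (transversal_pairs L)) \<and>
     (condition_C1 L \<longrightarrow>
       (\<forall>r. r dvd 1 \<longrightarrow>
          smooth_map_on
            (prod_manifold (completion_manifold L 1)
              (prod_manifold (completion_manifold L (-1)) (completion_manifold L 1)))
            (completion_manifold L 1) (mu_domain L) (\<lambda>(x, y, z). mu L r x y z)))"
proof -
  interpret quasi_inverse_jordan_lie L
    by unfold_locales (fact two_invertible graded automorphic jordan C2)+
  show ?thesis
  proof (intro conjI ballI impI allI)
    fix \<sigma> :: int assume "\<sigma> \<in> {1, -1}"
    then show "\<exists>!T. topspace T = proj_completion L \<sigma> \<and> smooth_manifold (completion_with L \<sigma> T)"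
      using completion_unique Xminus_facts(11) by auto
  next
    fix g and \<sigma> :: int assume "g \<in> G" "\<sigma> \<in> {1, -1}"
    then show "diffeomorphism (completion_manifold L \<sigma>) (completion_manifold L \<sigma>) (act g)"
      using diffeomorphism_act Xminus_facts(10) by auto
  next
    fix g assume g: "g \<in> G"
    have cell: "act g (emb x) \<in> emb ` gr 1 \<longleftrightarrow> big_cell (g \<circ> ex x)" if "x \<in> gr 1" for x
      using in_embed_iff_big_cell[OF act_emb_Aut[OF g that]] by (simp add: act_emb)
    show "regular_set L g = {x \<in> gr 1. act g (emb x) \<in> emb ` gr 1}"
      unfolding regular_set_eq[OF g] by (rule Collect_cong) (use cell in blast)
    show "openin (Vt 1) (regular_set L g)"
      unfolding regular_set_eq[OF g] by (rule transition(1)[OF g])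
    show "act g (emb x) = emb (inv_into (gr 1) (denom L g x) (nomin L g x))" if "x \<in> regular_set L g" for x
      using that act_big_cell[of "g \<circ> ex x"] denom_eq(3)[OF g, of x] by (simp add: regular_set_eq[OF g] act_emb)
    show "smooth_on sm (Vt 1) sm (Vt 1) (regular_set L g) (\<lambda>x. inv_into (gr 1) (denom L g x) (nomin L g x))"
      by (rule smooth_cell_point[OF g])
    show "differential sm (Vt 1) sm (Vt 1) (regular_set L g)
            (\<lambda>x. inv_into (gr 1) (denom L g x) (nomin L g x)) x v = inv_into (gr 1) (denom L g x) v"
      if "x \<in> regular_set L g" "v \<in> gr 1" for x v
      by (rule differential_regular[OF units_dense g that])
  next
    assume C1: "condition_C1 L"
    show "smooth_map (prod_manifold (module_manifold sm (Vt 1)) Xplus) Xplus (\<lambda>(v, p). act (ex v) p)"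
      by (rule smooth_exp_action[OF C1 signs(1)])
    show "smooth_map (prod_manifold (module_manifold sm (Vt (-1))) Xplus) Xplus (\<lambda>(w, p). act (ex w) p)"
      by (rule smooth_exp_action[OF C1 signs(2)])
    show "openin (prod_topology (mtop Xplus) (mtop Xminus)) (transversal_pairs L)"
      by (rule transversal_pairs_open[OF C1])
    show "smooth_map_on (prod_manifold Xplus (prod_manifold Xminus Xplus)) Xplus (mu_domain L) (\<lambda>(x, y, z). mu L r x y z)" for r
      by (rule mu_smooth[OF C1])
  qed
qed

end
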